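(* Let $K$ be a field complete with respect to a (possibly trivial) non-Archimedean valuation, let $M\cong\mathbb{Z}^d$ be a lattice with dual $N$, and let $\mathcal{A}=\mathcal{A}(a,r)$ be an affine hyperplane arrangement in $M_{\mathbb{R}}$ defined by a primitive spanning configuration $a\in N^E$ ($E$ a finite set) and $r\in\mathbb{Z}^E$. Let $\mathfrak{M}_{\mathcal{A}}\subseteq\mathfrak{B}_{\mathcal{A}}$ be the hypertoric variety in its Lawrence toric variety. Then, unless $\mathfrak{M}_{\mathcal{A}}\cong\mathbb{A}^{2d}$, the hypertoric variety $\mathfrak{M}_{\mathcal{A}}$ does not meet each torus orbit of $\mathfrak{B}_{\mathcal{A}}$ properly; that is, if $\mathfrak{M}_{\mathcal{A}}\not\cong\mathbb{A}^{2d}$, then there is a cone $\sigma$ of the fan of $\mathfrak{B}_{\mathcal{A}}$ such that $\mathfrak{M}_{\mathcal{A}}\cap O(\sigma)$ is nonempty and $\dim(\mathfrak{M}_{\mathcal{A}}\cap O(\sigma))\ne\dim\mathfrak{M}_{\mathcal{A}}-\dim\sigma$.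
   Context: **Arrangements.** $M\cong\mathbb{Z}^d$, $N=\mathrm{Hom}(M,\mathbb{Z})$, $M_{\mathbb{R}}=M\otimes\mathbb{R}$. A tuple $a=(a_e)_{e\in E}\in N^E$ of nonzero vectors is a primitive spanning configuration if each $a_e$ is primitive and the $a_e$ generate $N$. The arrangement $\mathcal{A}=\mathcal{A}(a,r)$ is the multiset of hyperplanes $H_e=\{m\in M_{\mathbb{R}}: \langle m,a_e\rangle+r_e=0\}$, $e\in E$, with closed halfspaces $H_e^+=\{\langle m,a_e\rangle+r_e\le 0\}$ and $H_e^-=\{\langle m,a_e\rangle+r_e\ge 0\}$. A vertex of $\mathcal{A}$ is a point $\xi\in M_{\mathbb{R}}$ such that $\{\xi\}$ is a fiber of the map sending $m\in M_{\mathbb R}$ to its sign vector in $\{+,0,-\}^E$ (entry $+$ if $m\in H_e^+\setminus H_e$, $0$ if $m\in H_e$, $-$ if $m\in H_e^-\setminus H_e$); put $E^{\pm}(\xi)=\{e\in E:\xi\in H_e^{\pm}\}$. **Lawrence toric variety.** Let $\Lambda=\ker(\mathbb{Z}^E\to N,\ \delta_e\mapsto a_e)$, embedded in $\mathbb{Z}^E\oplus\mathbb{Z}^E$ (with bases $\delta_e^+$, $\delta_e^-$) via $\delta_e\mapsto\delta_e^+-\delta_e^-$. Let $\widetilde N=(\mathbb{Z}^E\oplus\mathbb{Z}^E)/\Lambda$ (free of rank $|E|+d$), $\rho_e^{\pm}$ the image of $\delta_e^{\pm}$, and $\widetilde M$ the dual lattice. The Lawrence toric variety $\mathfrak{B}_{\mathcal{A}}$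 is the toric $K$-variety with dense torus $\widetilde T=\mathrm{Spec}\,K[\widetilde M]$ and fan $\Delta_{\mathcal{A}}$ in $\widetilde N_{\mathbb{R}}$ whose maximal cones are the cones generated by $\{\rho_e^+: e\in E^+(\xi)\}\cup\{\rho_f^-: f\in E^-(\xi)\}$ for $\xi$ a vertex of $\mathcal{A}$. $O(\sigma)$ denotes the torus orbit corresponding to a cone $\sigma\in\Delta_{\mathcal{A}}$. **Hypertoric variety.** The map $\widetilde N\to\mathbb{Z}^E$, $\rho_e^{\pm}\mapsto\delta_e$, induces a surjective toric morphism $\Phi:\mathfrak{B}_{\mathcal{A}}\to\mathbb{A}^E$. Let $L_{\mathcal{A}_0}\subseteq\mathbb{A}^E=\mathrm{Spec}\,K[x_e: e\in E]$ be the linear subspace cut out by the forms $\sum_e c_e x_e$ for all relations $\sum_e c_e a_e=0$ in $N$. The hypertoric variety is $\mathfrak{M}_{\mathcal{A}}=\Phi^{-1}(L_{\mathcal{A}_0})$; it is irreducible of dimension $2d$. **Proper intersection.** A subvariety $X$ of a toric variety intersects the torus orbit $O(\sigma)$ properly if $X\cap O(\sigma)$ has the expected dimension $\dim X-\dim\sigma$. Orbits that $X$ does not meet at all are not counted as violations. *)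

theory Defs
  imports
    "HOL-Analysis.Analysis"
    "HOL-Analysis.Finite_Function_Topology"
    "HOL-Library.Poly_Mapping"
    "HOL-Library.Extended_Real"
    "HOL-Algebra.QuotRing"
begin

section \<open>Complete non-Archimedean fields\<close>

text \<open>Valuations are written additively with values in the reals extended by \<open>\<infinity>\<close>;
  the trivial valuation (value 0 on all nonzero elements) is allowed.\<close>

definition nonarch_valuation :: "('k::field \<Rightarrow> ereal) \<Rightarrow> bool" where
  "nonarch_valuation v \<longleftrightarrow>
     (\<forall>x. v x \<noteq> -\<infinity>) \<and> (\<forall>x. v x = \<infinity> \<longleftrightarrow> x = 0) \<and>
     (\<forall>x y. v (x * y) = v x + v y) \<and> (\<forall>x y. min (v x) (v y) \<le> v (x + y))"

definition valuation_complete :: "('k::field \<Rightarrow> ereal) \<Rightarrow> bool" where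
  "valuation_complete v \<longleftrightarrow>
     (\<forall>X :: nat \<Rightarrow> 'k.
        (\<forall>c::real. \<exists>n0. \<forall>m\<ge>n0. \<forall>n\<ge>n0. ereal c < v (X m - X n)) \<longrightarrow>
        (\<exists>l. \<forall>c::real. \<exists>n0. \<forall>n\<ge>n0. ereal c < v (X n - l)))"


section \<open>Krull dimension of a topological space\<close>

definition irreducible_closed :: "'p topology \<Rightarrow> 'p set \<Rightarrow> bool" where
  "irreducible_closed X Z \<longleftrightarrow>
     closedin X Z \<and> Z \<noteq> {} \<and>
     (\<forall>C D. closedin X C \<and> closedin X D \<and> Z = C \<union> D \<longrightarrow> Z = C \<or> Z = D)"

definition krull_dim :: "'p topology \<Rightarrow> enat" where
  "krull_dim X =
     Sup {enat n | n. \<exists>Z :: nat \<Rightarrow> 'p set.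
            (\<forall>i\<le>n. irreducible_closed X (Z i)) \<and> (\<forall>i<n. Z i \<subset> Z (Suc i))}"


section \<open>Ringed spaces over a field and their isomorphisms\<close>

text \<open>Sections over an open set are functions from its points to the stalks (extensional
  outside the open set), so that the restriction maps of the sheaf are restrictions of functions.
  The component \<open>const\<close> is the structure map from the base field.\<close>

record ('p, 's, 'k) k_space =
  topo :: "'p topology"
  sheaf :: "'p set \<Rightarrow> ('p \<Rightarrow> 's) ring"
  const :: "'p set \<Rightarrow> 'k \<Rightarrow> 'p \<Rightarrow> 's"

definition k_isomorphic ::
  "('p, 's, 'k) k_space \<Rightarrow> ('q, 't, 'k) k_space \<Rightarrow> bool" where
  "k_isomorphic X Y \<longleftrightarrow>
     (\<exists>\<phi> \<theta>. homeomorphic_map (topo X) (topo Y) \<phi> \<and>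
       (\<forall>V. openin (topo Y) V \<longrightarrow>
          (let U = {x \<in> topspace (topo X). \<phi> x \<in> V} in
             \<theta> V \<in> ring_iso (sheaf Y V) (sheaf X U) \<and>
             (\<forall>c. \<theta> V (const Y V c) = const X U c) \<and>
             (\<forall>V' s. openin (topo Y) V' \<and> V' \<subseteq> V \<and> s \<in> carrier (sheaf Y V) \<longrightarrow>
                \<theta> V' (restrict s V') =
                restrict (\<theta> V s) {x \<in> topspace (topo X). \<phi> x \<in> V'}))))"


section \<open>Schemes glued from spectra of quotients of monoid algebras\<close>

definition monoid_algebra :: "'m::comm_monoid_add set \<Rightarrow> ('m \<Rightarrow>\<^sub>0 'k::field) ring" where
  "monoid_algebra S =
     \<lparr>carrier = {f. Poly_Mapping.keys f \<subseteq> S}, mult = (*), one = 1, zero = 0, add = (+)\<rparr>"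

lemma cring_monoid_algebra:
  assumes "0 \<in> S" and "\<And>x y. x \<in> S \<Longrightarrow> y \<in> S \<Longrightarrow> x + y \<in> S"
  shows "cring (monoid_algebra S :: ('m::comm_monoid_add \<Rightarrow>\<^sub>0 'k::field) ring)"
proof (rule cringI)
  let ?R = "monoid_algebra S :: ('m \<Rightarrow>\<^sub>0 'k) ring"
  have mult: "Poly_Mapping.keys (f * g) \<subseteq> S"
    if "Poly_Mapping.keys f \<subseteq> S" "Poly_Mapping.keys g \<subseteq> S" for f g :: "'m \<Rightarrow>\<^sub>0 'k"
    using keys_mult[of f g] that assms(2) by blast
  have add: "Poly_Mapping.keys (f + g) \<subseteq> S"
    if "Poly_Mapping.keys f \<subseteq> S" "Poly_Mapping.keys g \<subseteq> S" for f g :: "'m \<Rightarrow>\<^sub>0 'k"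
    using keys_add[of f g] that by blast
  show "abelian_group ?R"
  proof (rule abelian_groupI)
    fix f assume "f \<in> carrier ?R"
    then show "\<exists>g\<in>carrier ?R. g \<oplus>\<^bsub>?R\<^esub> f = \<zero>\<^bsub>?R\<^esub>"
      by (intro bexI[of _ "- f"]) (auto simp: monoid_algebra_def)
  qed (use add in \<open>auto simp: monoid_algebra_def add_ac\<close>)
  show "comm_monoid ?R"
    by (rule comm_monoidI) (use mult assms(1) in \<open>auto simp: monoid_algebra_def mult_ac\<close>)
qed (auto simp: monoid_algebra_def distrib_right)

abbreviation monomial :: "'m \<Rightarrow> ('m \<Rightarrow>\<^sub>0 'k::field)" where
  "monomial u \<equiv> Poly_Mapping.single u 1"

text \<open>The chart with index \<open>i\<close> is \<open>Spec (K[S i] / I i)\<close>, where \<open>S = mon X\<close> and \<open>I = van X\<close>.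
  The relation \<open>sub X j i\<close> says that chart \<open>j\<close> is an open subscheme of chart \<open>i\<close>; then
  \<open>S i \<subseteq> S j\<close>, and the inclusion of charts is given by contraction of prime ideals along
  \<open>K[S i] \<subseteq> K[S j]\<close>. Every point of the glued scheme is listed exactly once, as a pair of one
  chart containing it and the corresponding prime ideal of that chart.\<close>

record (overloaded) ('i, 'm, 'k) atlas =
  charts :: "'i set"
  sub :: "'i \<Rightarrow> 'i \<Rightarrow> bool"
  mon :: "'i \<Rightarrow> 'm set"
  van :: "'i \<Rightarrow> ('m \<Rightarrow>\<^sub>0 'k::zero) set"
  pts :: "('i \<times> ('m \<Rightarrow>\<^sub>0 'k::zero) set) set"

definition chart_open ::
  "('i, 'm, 'k) atlas \<Rightarrow> 'i \<Rightarrow> ('i \<times> ('m \<Rightarrow>\<^sub>0 'k::zero) set) set" where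
  "chart_open X i = {x \<in> pts X. sub X (fst x) i}"

definition zariski ::
  "('i, 'm::comm_monoid_add, 'k::field) atlas \<Rightarrow> ('i \<times> ('m \<Rightarrow>\<^sub>0 'k) set) topology" where
  "zariski X = topology_generated_by
     {{x \<in> chart_open X i. f \<notin> snd x} | i f.
        i \<in> charts X \<and> f \<in> carrier (monoid_algebra (mon X i))}"

text \<open>The class of the fraction \<open>f / g\<close> in the localization of \<open>K[S] / I\<close> at the prime \<open>q\<close>.\<close>

definition germ ::
  "'m::comm_monoid_add set \<Rightarrow> ('m \<Rightarrow>\<^sub>0 'k::field) set \<Rightarrow> ('m \<Rightarrow>\<^sub>0 'k) set \<Rightarrow>
   ('m \<Rightarrow>\<^sub>0 'k) \<Rightarrow> ('m \<Rightarrow>\<^sub>0 'k) \<Rightarrow> (('m \<Rightarrow>\<^sub>0 'k) \<times> ('m \<Rightarrow>\<^sub>0 'k)) set" where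
  "germ S I q f g =
     {(f', g'). f' \<in> carrier (monoid_algebra S) \<and> g' \<in> carrier (monoid_algebra S) - q \<and>
        (\<exists>h \<in> carrier (monoid_algebra S) - q. h * (f * g' - f' * g) \<in> I)}"

abbreviation germ_at ::
  "('i, 'm::comm_monoid_add, 'k::field) atlas \<Rightarrow> 'i \<times> ('m \<Rightarrow>\<^sub>0 'k) set \<Rightarrow>
   ('m \<Rightarrow>\<^sub>0 'k) \<Rightarrow> ('m \<Rightarrow>\<^sub>0 'k) \<Rightarrow> (('m \<Rightarrow>\<^sub>0 'k) \<times> ('m \<Rightarrow>\<^sub>0 'k)) set" where
  "germ_at X x \<equiv> germ (mon X (fst x)) (van X (fst x)) (snd x)"

definition germ_add ::
  "('i, 'm::comm_monoid_add, 'k::field) atlas \<Rightarrow> 'i \<times> ('m \<Rightarrow>\<^sub>0 'k) set \<Rightarrow>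
   (('m \<Rightarrow>\<^sub>0 'k) \<times> ('m \<Rightarrow>\<^sub>0 'k)) set \<Rightarrow> (('m \<Rightarrow>\<^sub>0 'k) \<times> ('m \<Rightarrow>\<^sub>0 'k)) set \<Rightarrow>
   (('m \<Rightarrow>\<^sub>0 'k) \<times> ('m \<Rightarrow>\<^sub>0 'k)) set" where
  "germ_add X x G H =
     (\<Union>(f, g) \<in> G. \<Union>(f', g') \<in> H. germ_at X x (f * g' + f' * g) (g * g'))"

definition germ_mult ::
  "('i, 'm::comm_monoid_add, 'k::field) atlas \<Rightarrow> 'i \<times> ('m \<Rightarrow>\<^sub>0 'k) set \<Rightarrow>
   (('m \<Rightarrow>\<^sub>0 'k) \<times> ('m \<Rightarrow>\<^sub>0 'k)) set \<Rightarrow> (('m \<Rightarrow>\<^sub>0 'k) \<times> ('m \<Rightarrow>\<^sub>0 'k)) set \<Rightarrow>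
   (('m \<Rightarrow>\<^sub>0 'k) \<times> ('m \<Rightarrow>\<^sub>0 'k)) set" where
  "germ_mult X x G H =
     (\<Union>(f, g) \<in> G. \<Union>(f', g') \<in> H. germ_at X x (f * f') (g * g'))"

definition structure_sheaf ::
  "('i, 'm::comm_monoid_add, 'k::field) atlas \<Rightarrow> ('i \<times> ('m \<Rightarrow>\<^sub>0 'k) set) set \<Rightarrow>
   ('i \<times> ('m \<Rightarrow>\<^sub>0 'k) set \<Rightarrow> (('m \<Rightarrow>\<^sub>0 'k) \<times> ('m \<Rightarrow>\<^sub>0 'k)) set) ring" where
  "structure_sheaf X W =
     \<lparr>carrier = {s \<in> extensional W.
        \<forall>x \<in> W. \<exists>i \<in> charts X. \<exists>f \<in> carrier (monoid_algebra (mon X i)).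
          \<exists>g \<in> carrier (monoid_algebra (mon X i)). \<exists>V.
            openin (zariski X) V \<and> x \<in> V \<and> V \<subseteq> W \<inter> chart_open X i \<and>
            (\<forall>y \<in> V. g \<notin> snd y \<and> s y = germ_at X y f g)},
      mult = (\<lambda>s t. \<lambda>x \<in> W. germ_mult X x (s x) (t x)),
      one = (\<lambda>x \<in> W. germ_at X x 1 1),
      zero = (\<lambda>x \<in> W. germ_at X x 0 1),
      add = (\<lambda>s t. \<lambda>x \<in> W. germ_add X x (s x) (t x))\<rparr>"

definition scheme_of ::
  "('i, 'm::comm_monoid_add, 'k::field) atlas \<Rightarrow>
   ('i \<times> ('m \<Rightarrow>\<^sub>0 'k) set, (('m \<Rightarrow>\<^sub>0 'k) \<times> ('m \<Rightarrow>\<^sub>0 'k)) set, 'k) k_space" where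
  "scheme_of X =
     \<lparr>topo = zariski X, sheaf = structure_sheaf X,
      const = (\<lambda>W c. \<lambda>x \<in> W. germ_at X x (Poly_Mapping.single 0 c) 1)\<rparr>"

definition closed_subatlas ::
  "('i, 'm, 'k::zero) atlas \<Rightarrow> ('i \<Rightarrow> ('m \<Rightarrow>\<^sub>0 'k) set) \<Rightarrow> ('i, 'm, 'k) atlas" where
  "closed_subatlas X I = X\<lparr>van := I, pts := {x \<in> pts X. I (fst x) \<subseteq> snd x}\<rparr>"

text \<open>Affine \<open>n\<close>-space: a single chart, the spectrum of the polynomial ring in the variables
  with indices below \<open>n\<close>.\<close>

definition affine_atlas :: "nat \<Rightarrow> (unit, nat \<Rightarrow>\<^sub>0 nat, 'k::field) atlas" where
  "affine_atlas n =
     (let S = {u. Poly_Mapping.keys u \<subseteq> {..<n}} in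
       \<lparr>charts = UNIV, sub = (\<lambda>_ _. True), mon = (\<lambda>_. S), van = (\<lambda>_. {0}),
        pts = {x. primeideal (snd x) (monoid_algebra S)}\<rparr>)"

abbreviation affine_space ::
  "nat \<Rightarrow> (unit \<times> ((nat \<Rightarrow>\<^sub>0 nat) \<Rightarrow>\<^sub>0 'k) set,
            (((nat \<Rightarrow>\<^sub>0 nat) \<Rightarrow>\<^sub>0 'k) \<times> ((nat \<Rightarrow>\<^sub>0 nat) \<Rightarrow>\<^sub>0 'k)) set,
            'k::field) k_space" where
  "affine_space n \<equiv> scheme_of (affine_atlas n)"


section \<open>Arrangements\<close>

text \<open>\<open>M\<close> and \<open>N\<close> are \<open>\<int>^d\<close> with \<open>d = rk A\<close>, in dual bases, and \<open>M\<^sub>\<real>\<close> is \<open>\<real>^d\<close>; vectors are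
  functions on \<open>nat\<close> that vanish from \<open>d\<close> on.\<close>

record 'e arrangement =
  rk :: nat
  idx :: "'e set"
  normal :: "'e \<Rightarrow> nat \<Rightarrow> int"
  shift :: "'e \<Rightarrow> int"

definition coord_space :: "nat \<Rightarrow> (nat \<Rightarrow> 'a::zero) set" where
  "coord_space d = {m. \<forall>i\<ge>d. m i = 0}"

definition primitive_vector :: "nat \<Rightarrow> (nat \<Rightarrow> int) \<Rightarrow> bool" where
  "primitive_vector d v \<longleftrightarrow>
     v \<in> coord_space d \<and> v \<noteq> (\<lambda>_. 0) \<and>
     (\<forall>k. \<forall>w \<in> coord_space d. v = (\<lambda>i. k * w i) \<longrightarrow> \<bar>k\<bar> = 1)"

definition primitive_spanning :: "'e arrangement \<Rightarrow> bool" where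
  "primitive_spanning A \<longleftrightarrow>
     finite (idx A) \<and>
     (\<forall>e \<in> idx A. primitive_vector (rk A) (normal A e)) \<and>
     (\<forall>w \<in> coord_space (rk A). \<exists>c :: 'e \<Rightarrow> int. w = (\<lambda>i. \<Sum>e\<in>idx A. c e * normal A e i))"

definition aff :: "'e arrangement \<Rightarrow> 'e \<Rightarrow> (nat \<Rightarrow> real) \<Rightarrow> real" where
  "aff A e m = (\<Sum>i<rk A. m i * real_of_int (normal A e i)) + real_of_int (shift A e)"

text \<open>The positive halfspace of \<open>e\<close> is \<open>aff A e m \<le> 0\<close>, hence the minus sign in the sign vector.\<close>

definition sign_vector :: "'e arrangement \<Rightarrow> (nat \<Rightarrow> real) \<Rightarrow> 'e \<Rightarrow> real" where
  "sign_vector A m = (\<lambda>e \<in> idx A. - sgn (aff A e m))"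

definition vertices :: "'e arrangement \<Rightarrow> (nat \<Rightarrow> real) set" where
  "vertices A =
     {\<xi>. {m \<in> coord_space (rk A). sign_vector A m = sign_vector A \<xi>} = {\<xi>}}"

definition E_pos :: "'e arrangement \<Rightarrow> (nat \<Rightarrow> real) \<Rightarrow> 'e set" where
  "E_pos A \<xi> = {e \<in> idx A. aff A e \<xi> \<le> 0}"

definition E_neg :: "'e arrangement \<Rightarrow> (nat \<Rightarrow> real) \<Rightarrow> 'e set" where
  "E_neg A \<xi> = {e \<in> idx A. aff A e \<xi> \<ge> 0}"


section \<open>The Lawrence fan\<close>

datatype sign = Pos | Neg

text \<open>\<open>\<Lambda>\<close>, as a sublattice of \<open>\<int>^E\<close>, and the image of one of its elements in \<open>\<real>^E \<oplus> \<real>^E\<close>.\<close>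

definition relations :: "'e arrangement \<Rightarrow> ('e \<Rightarrow>\<^sub>0 int) set" where
  "relations A =
     {c. Poly_Mapping.keys c \<subseteq> idx A \<and>
         (\<forall>i. (\<Sum>e\<in>idx A. Poly_Mapping.lookup c e * normal A e i) = 0)}"

definition relation_vec :: "'e arrangement \<Rightarrow> ('e \<Rightarrow>\<^sub>0 int) \<Rightarrow> ('e \<times> sign \<Rightarrow>\<^sub>0 real)" where
  "relation_vec A c =
     (\<Sum>e\<in>idx A. real_of_int (Poly_Mapping.lookup c e) *\<^sub>R
        (Poly_Mapping.single (e, Pos) 1 - Poly_Mapping.single (e, Neg) 1))"

definition Lam_real :: "'e arrangement \<Rightarrow> ('e \<times> sign \<Rightarrow>\<^sub>0 real) set" where
  "Lam_real A = span (relation_vec A ` relations A)"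

definition pairing :: "('e \<times> sign \<Rightarrow>\<^sub>0 int) \<Rightarrow> ('e \<times> sign \<Rightarrow>\<^sub>0 real) \<Rightarrow> real" where
  "pairing u v =
     (\<Sum>x\<in>Poly_Mapping.keys u. real_of_int (Poly_Mapping.lookup u x) * Poly_Mapping.lookup v x)"

text \<open>The dual of the quotient lattice \<open>(\<int>^E \<oplus> \<int>^E) / \<Lambda>\<close> consists of the integral functionals
  on \<open>\<int>^E \<oplus> \<int>^E\<close>, given by their values on the basis, that vanish on \<open>\<Lambda>\<close>.\<close>

definition M_tilde :: "'e arrangement \<Rightarrow> ('e \<times> sign \<Rightarrow>\<^sub>0 int) set" where
  "M_tilde A =
     {u. Poly_Mapping.keys u \<subseteq> idx A \<times> UNIV \<and>
         (\<forall>c \<in> relations A. pairing u (relation_vec A c) = 0)}"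

text \<open>A cone in the quotient space \<open>(\<real>^E \<oplus> \<real>^E) / \<Lambda>\<^sub>\<real>\<close> is represented by its preimage in
  \<open>\<real>^E \<oplus> \<real>^E\<close>, a cone that contains the subspace \<open>\<Lambda>\<^sub>\<real>\<close>. This is a bijection which is compatible
  with passing to nonempty faces; the dimension of the cone in the quotient is that of
  its preimage minus that of \<open>\<Lambda>\<^sub>\<real>\<close>.\<close>

definition vertex_cone :: "'e arrangement \<Rightarrow> (nat \<Rightarrow> real) \<Rightarrow> ('e \<times> sign \<Rightarrow>\<^sub>0 real) set" where
  "vertex_cone A \<xi> =
     convex_cone hull
       ((\<lambda>e. Poly_Mapping.single (e, Pos) 1) ` E_pos A \<xi> \<union>
        (\<lambda>e. Poly_Mapping.single (e, Neg) 1) ` E_neg A \<xi> \<union> Lam_real A)"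

definition lawrence_fan :: "'e arrangement \<Rightarrow> ('e \<times> sign \<Rightarrow>\<^sub>0 real) set set" where
  "lawrence_fan A = {\<sigma>. \<sigma> \<noteq> {} \<and> (\<exists>\<xi> \<in> vertices A. \<sigma> face_of vertex_cone A \<xi>)}"

definition cone_dim :: "'e arrangement \<Rightarrow> ('e \<times> sign \<Rightarrow>\<^sub>0 real) set \<Rightarrow> nat" where
  "cone_dim A \<sigma> = dim \<sigma> - dim (Lam_real A)"

definition dual_monoid ::
  "'e arrangement \<Rightarrow> ('e \<times> sign \<Rightarrow>\<^sub>0 real) set \<Rightarrow> ('e \<times> sign \<Rightarrow>\<^sub>0 int) set" where
  "dual_monoid A \<sigma> = {u \<in> M_tilde A. \<forall>v\<in>\<sigma>. pairing u v \<ge> 0}"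

lemma pairing_add: "pairing (u + w) v = pairing u v + pairing w v"
proof -
  have "pairing x v =
      (\<Sum>z\<in>Poly_Mapping.keys u \<union> Poly_Mapping.keys w.
        real_of_int (Poly_Mapping.lookup x z) * Poly_Mapping.lookup v z)"
    if "Poly_Mapping.keys x \<subseteq> Poly_Mapping.keys u \<union> Poly_Mapping.keys w" for x
    unfolding pairing_def
    by (rule sum.mono_neutral_left) (use that in \<open>auto simp: in_keys_iff\<close>)
  then show ?thesis
    using keys_add[of u w]
    by (simp add: Poly_Mapping.lookup_add distrib_right sum.distrib)
qed

lemma cring_dual_monoid: "cring (monoid_algebra (dual_monoid A \<sigma>) :: (_ \<Rightarrow>\<^sub>0 'k::field) ring)"
proof (rule cring_monoid_algebra)
  show "0 \<in> dual_monoid A \<sigma>"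
    by (simp add: dual_monoid_def M_tilde_def pairing_def)
  fix x y assume "x \<in> dual_monoid A \<sigma>" "y \<in> dual_monoid A \<sigma>"
  then show "x + y \<in> dual_monoid A \<sigma>"
    using keys_add[of x y] by (auto simp: dual_monoid_def M_tilde_def pairing_add)
qed

definition perp_lattice ::
  "'e arrangement \<Rightarrow> ('e \<times> sign \<Rightarrow>\<^sub>0 real) set \<Rightarrow> ('e \<times> sign \<Rightarrow>\<^sub>0 int) set" where
  "perp_lattice A \<sigma> = {u \<in> M_tilde A. \<forall>v\<in>\<sigma>. pairing u v = 0}"


section \<open>Lawrence toric varieties and hypertoric varieties\<close>

text \<open>The toric variety is glued from the charts \<open>U\<^sub>\<sigma> = Spec K[\<sigma>\<^sup>\<or> \<inter> M]\<close> along faces. It is the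
  disjoint union of the orbits \<open>O(\<sigma>)\<close>, and \<open>O(\<sigma>)\<close> is the closed subset of \<open>U\<^sub>\<sigma>\<close> on which all
  characters in \<open>\<sigma>\<^sup>\<or>\<close> outside \<open>\<sigma>\<^sup>\<bottom>\<close> vanish; a point of \<open>O(\<sigma>)\<close> is listed in the chart \<open>U\<^sub>\<sigma>\<close>.\<close>

definition lawrence_atlas ::
  "'e arrangement \<Rightarrow>
   (('e \<times> sign \<Rightarrow>\<^sub>0 real) set, 'e \<times> sign \<Rightarrow>\<^sub>0 int, 'k::field) atlas" where
  "lawrence_atlas A =
     \<lparr>charts = lawrence_fan A, sub = (face_of), mon = dual_monoid A, van = (\<lambda>_. {0}),
      pts = {(\<sigma>, q). \<sigma> \<in> lawrence_fan A \<and> primeideal q (monoid_algebra (dual_monoid A \<sigma>)) \<and>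
               (\<forall>u \<in> dual_monoid A \<sigma> - perp_lattice A \<sigma>. monomial u \<in> q)}\<rparr>"

definition orbit ::
  "'e arrangement \<Rightarrow> ('e \<times> sign \<Rightarrow>\<^sub>0 real) set \<Rightarrow>
   (('e \<times> sign \<Rightarrow>\<^sub>0 real) set \<times> (('e \<times> sign \<Rightarrow>\<^sub>0 int) \<Rightarrow>\<^sub>0 'k::field) set) set" where
  "orbit A \<sigma> = {x \<in> pts (lawrence_atlas A). fst x = \<sigma>}"

text \<open>\<open>\<Phi>\<^sup>* x\<^sub>e\<close> is the character of the functional taking the value 1 on \<open>\<rho>\<^sub>e\<^sup>+\<close> and \<open>\<rho>\<^sub>e\<^sup>-\<close> and 0 on the
  other generators, that is, the composite of the lattice map underlying \<open>\<Phi>\<close> with the \<open>e\<close>-th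
  coordinate.\<close>

definition Phi_pullback :: "'e \<Rightarrow> (('e \<times> sign \<Rightarrow>\<^sub>0 int) \<Rightarrow>\<^sub>0 'k::field)" where
  "Phi_pullback e = monomial (Poly_Mapping.single (e, Pos) 1 + Poly_Mapping.single (e, Neg) 1)"

definition hypertoric_ideal ::
  "'e arrangement \<Rightarrow> ('e \<times> sign \<Rightarrow>\<^sub>0 real) set \<Rightarrow> (('e \<times> sign \<Rightarrow>\<^sub>0 int) \<Rightarrow>\<^sub>0 'k::field) set" where
  "hypertoric_ideal A \<sigma> =
     genideal (monoid_algebra (dual_monoid A \<sigma>))
       {\<Sum>e\<in>idx A. of_int (Poly_Mapping.lookup c e) * Phi_pullback e | c. c \<in> relations A}"

definition hypertoric_atlas ::
  "'e arrangement \<Rightarrow>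
   (('e \<times> sign \<Rightarrow>\<^sub>0 real) set, 'e \<times> sign \<Rightarrow>\<^sub>0 int, 'k::field) atlas" where
  "hypertoric_atlas A = closed_subatlas (lawrence_atlas A) (hypertoric_ideal A)"

abbreviation hypertoric ::
  "'e arrangement \<Rightarrow>
   (('e \<times> sign \<Rightarrow>\<^sub>0 real) set \<times> (('e \<times> sign \<Rightarrow>\<^sub>0 int) \<Rightarrow>\<^sub>0 'k) set,
    ((('e \<times> sign \<Rightarrow>\<^sub>0 int) \<Rightarrow>\<^sub>0 'k) \<times> (('e \<times> sign \<Rightarrow>\<^sub>0 int) \<Rightarrow>\<^sub>0 'k)) set,
    'k::field) k_space" where
  "hypertoric A \<equiv> scheme_of (hypertoric_atlas A)"

end

theory Submission
  imports Defs "HOL-Computational_Algebra.Polynomial_Factorial"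
begin

text \<open>If the \<open>a\<^sub>e\<close> are linearly independent, they form a basis of \<open>N\<close>, the Lawrence fan consists of the
  faces of an orthant, and the hypertoric variety is affine space.

  Otherwise let \<open>n = |E| + d\<close> be the dimension of the Lawrence toric variety, and suppose that all orbits
  are met properly. The orbit of the cone of a vertex is a point, it lies on the hypertoric variety since
  all \<open>x\<^sub>e\<close> vanish there, and the cone has dimension \<open>n\<close>; hence the hypertoric variety has
  dimension \<open>n\<close>. The intersection with the dense torus is nonempty, so that it has dimension \<open>n\<close> as
  well. But it is the zero locus of a nonzero ideal of the coordinate ring of an \<open>n\<close>-dimensional torus,
  whose dimension is less than \<open>n\<close>: elements \<open>g\<^sub>i \<in> P\<^sub>i - P\<^sub>i\<^sub>-\<^sub>1\<close> taken from a chain of prime ideals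
  are algebraically independent, and counting monomials in a box shows that at most \<open>n\<close> Laurent
  polynomials in \<open>n\<close> variables are.\<close>

text \<open>The dimension of the hypertoric variety is never computed: properness at the fixed point
  of a vertex forces it to be n, and properness at the torus carries this value to a place where it
  can be refuted. Two arithmetic obstacles arise over a general field. K may be finite, so the
  intersection with the torus may have no K-rational point; since points are primes, a point with
  values in K(t) serves. And in characteristic p the coefficients of a relation may all vanish in K;
  primitivity of the normals and saturation of the group of relations repair this.

  In the affine case the difficulty lies in the shape of the scheme. Each point is listed once, in
  the chart of the cone of its orbit, so a prime of the polynomial ring must be sent to the right
  chart and localized there. The chart of the full orthant contains all points, and monomials that
  are units on a chart clear denominators, so primes, basic open sets and local fractions can all be
  compared with those of the polynomial ring.\<close>

abbreviation "keys \<equiv> Poly_Mapping.keys"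
abbreviation "lookup \<equiv> Poly_Mapping.lookup"
abbreviation "single \<equiv> Poly_Mapping.single"

section \<open>Monoid algebras\<close>

lemma poly_mapping_sum_single:
  "f = (\<Sum>u\<in>keys f. single u (lookup f u))"
proof (rule poly_mapping_eqI)
  fix k
  have "lookup (\<Sum>u\<in>keys f. single u (lookup f u)) k
      = (\<Sum>u\<in>keys f. if u = k then lookup f u else 0)"
    by (simp add: lookup_sum lookup_single when_def)
  also have "\<dots> = lookup f k"
    by (simp add: sum.delta in_keys_iff)
  finally show "lookup f k = lookup
      (\<Sum>u\<in>keys f. single u (lookup f u)) k" by simp
qed

text \<open>This is the universal property of the monoid algebra: for multiplicative
  \<open>s\<close> on coefficients and \<open>w\<close> on exponents the sum is a ring homomorphism.
  It serves for renaming variables, with values in another monoid algebra, and for evaluation at a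
  point, with values in a field of fractions.\<close>

definition lin_ext :: "('k::zero \<Rightarrow> 'r::comm_ring_1) \<Rightarrow> ('m \<Rightarrow> 'r) \<Rightarrow> ('m \<Rightarrow>\<^sub>0 'k) \<Rightarrow> 'r" where
  "lin_ext s w f = (\<Sum>u\<in>keys f. s (lookup f u) * w u)"

locale algebra_hom =
  fixes s :: "'k::field \<Rightarrow> 'r::comm_ring_1" and w :: "'m::comm_monoid_add \<Rightarrow> 'r"
  assumes s_0: "s 0 = 0" and s_1: "s 1 = 1" and s_add: "\<And>a b. s (a + b) = s a + s b"
    and s_mult: "\<And>a b. s (a * b) = s a * s b"
    and w_0: "w 0 = 1" and w_add: "\<And>u v. w (u + v) = w u * w v"
begin

lemma lin_ext_superset:
  assumes "finite Y" "keys f \<subseteq> Y"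
  shows "lin_ext s w f = (\<Sum>u\<in>Y. s (lookup f u) * w u)"
  unfolding lin_ext_def
  by (rule sum.mono_neutral_left) (use assms in \<open>auto simp: in_keys_iff s_0\<close>)

lemma lin_ext_add: "lin_ext s w (f + g) = lin_ext s w f + lin_ext s w g"
proof -
  let ?Y = "keys f \<union> keys g"
  have "finite ?Y" by simp
  then show ?thesis
    using keys_add[of f g]
    by (simp add: lin_ext_superset[of ?Y] lookup_add s_add distrib_right sum.distrib)
qed

lemma lin_ext_0: "lin_ext s w 0 = 0"
  by (simp add: lin_ext_def)

lemma lin_ext_single: "lin_ext s w (single u c) = s c * w u"
  by (simp add: lin_ext_def s_0)

lemma lin_ext_1: "lin_ext s w 1 = 1"
  using lin_ext_single[of 0 1] by (simp add: s_1 w_0)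

lemma lin_ext_sum: "lin_ext s w (sum f I) = (\<Sum>i\<in>I. lin_ext s w (f i))"
  by (induction I rule: infinite_finite_induct) (auto simp: lin_ext_0 lin_ext_add)

lemma lin_ext_mult: "lin_ext s w (f * g) = lin_ext s w f * lin_ext s w g"
proof -
  let ?f = "\<lambda>u. single u (lookup f u)"
  let ?g = "\<lambda>u. single u (lookup g u)"
  have "f * g = (\<Sum>u\<in>keys f. ?f u) * (\<Sum>v\<in>keys g. ?g v)"
    by (metis poly_mapping_sum_single)
  also have "\<dots> = (\<Sum>u\<in>keys f. \<Sum>v\<in>keys g.
      single (u + v) (lookup f u * lookup g v))"
    by (simp add: sum_product mult_single)
  finally have "lin_ext s w (f * g) = (\<Sum>u\<in>keys f. \<Sum>v\<in>keys g.
      s (lookup f u * lookup g v) * w (u + v))"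
    by (simp add: lin_ext_sum lin_ext_single)
  also have "\<dots> = lin_ext s w f * lin_ext s w g"
    by (simp add: lin_ext_def sum_product s_mult w_add mult_ac)
  finally show ?thesis .
qed

end

text \<open>Renames the variables of an exponent vector along \<open>\<beta>\<close> and changes the
  type of the exponents by \<open>h\<close>. Two cases occur: \<open>h = id\<close> into variables
  numbered by \<open>nat\<close>, and \<open>h = int\<close> from exponents of polynomials to
  exponents of Laurent polynomials.\<close>

definition reindex :: "('x \<Rightarrow> 'y) \<Rightarrow> 'x set \<Rightarrow> ('b::zero \<Rightarrow> 'c::comm_monoid_add) \<Rightarrow> ('x \<Rightarrow>\<^sub>0 'b) \<Rightarrow> ('y \<Rightarrow>\<^sub>0 'c)"
  where "reindex \<beta> X h u = (\<Sum>x\<in>X. single (\<beta> x) (h (lookup u x)))"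

lemma lookup_reindex:
  assumes "finite X" "inj_on \<beta> X"
  shows "x \<in> X \<Longrightarrow> lookup (reindex \<beta> X h u) (\<beta> x) = h (lookup u x)"
    and "y \<notin> \<beta> ` X \<Longrightarrow> lookup (reindex \<beta> X h u) y = 0"
proof -
  assume "x \<in> X"
  have "lookup (reindex \<beta> X h u) (\<beta> x)
      = (\<Sum>z\<in>X. if z = x then h (lookup u z) else 0)"
    unfolding reindex_def lookup_sum
    by (rule sum.cong) (use \<open>x \<in> X\<close> assms(2) in \<open>auto simp: lookup_single when_def inj_on_def\<close>)
  then show "lookup (reindex \<beta> X h u) (\<beta> x) = h (lookup u x)"
    using \<open>x \<in> X\<close> assms(1) by simp
next
  assume "y \<notin> \<beta> ` X"
  then show "lookup (reindex \<beta> X h u) y = 0"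
    unfolding reindex_def lookup_sum
    by (intro sum.neutral) (auto simp: lookup_single when_def)
qed

lemma algebra_hom_reindex:
  assumes "h 0 = 0" "\<And>a b. h (a + b) = h a + h b"
  shows "algebra_hom (single 0 :: 'k::field \<Rightarrow> _)
    (\<lambda>u. monomial (reindex \<beta> X (h :: 'b::comm_monoid_add \<Rightarrow> 'c::comm_monoid_add) u))"
proof
  fix u v
  have "reindex \<beta> X h (u + v) = reindex \<beta> X h u + reindex \<beta> X h v"
    unfolding reindex_def by (simp add: lookup_add assms single_add sum.distrib)
  then show "monomial (reindex \<beta> X h (u + v)) =
      monomial (reindex \<beta> X h u) * (monomial (reindex \<beta> X h v) :: _ \<Rightarrow>\<^sub>0 'k)"
    by (simp add: mult_single)
qed (auto simp: single_add mult_single reindex_def assms)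

lemma lookup_lin_ext_monomial:
  assumes "inj_on r S" "keys f \<subseteq> S" "u \<in> S"
  shows "lookup (lin_ext (single 0) (\<lambda>u. monomial (r u)) f) (r u)
     = lookup (f :: _ \<Rightarrow>\<^sub>0 'k::field) u"
proof -
  have "lookup (lin_ext (single 0) (\<lambda>u. monomial (r u)) f) (r u)
     = (\<Sum>z\<in>keys f. if z = u then lookup f z else 0)"
    unfolding lin_ext_def lookup_sum
    by (rule sum.cong) (use assms in \<open>auto simp: mult_single lookup_single when_def inj_on_def\<close>)
  then show ?thesis by (simp add: in_keys_iff)
qed

text \<open>Distinct exponents go to distinct monomials, so no coefficients merge and each can be
  read off again.\<close>

lemma inj_on_lin_ext_monomial:
  assumes "inj_on r S"
  shows "inj_on (lin_ext (single (0::'n::comm_monoid_add)) (\<lambda>u. monomial (r u)) :: _ \<Rightarrow> (_ \<Rightarrow>\<^sub>0 'k::field))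
     {f. keys f \<subseteq> S}"
proof (rule inj_onI, rule poly_mapping_eqI)
  fix f g :: "_ \<Rightarrow>\<^sub>0 'k" and u
  assume fg: "f \<in> {f. keys f \<subseteq> S}" "g \<in> {f. keys f \<subseteq> S}"
    and eq: "lin_ext (single (0::'n)) (\<lambda>u. monomial (r u)) f
          = lin_ext (single 0) (\<lambda>u. monomial (r u)) g"
  show "lookup f u = lookup g u"
  proof (cases "u \<in> S")
    case True
    then show ?thesis
      using lookup_lin_ext_monomial[OF assms] fg eq by (metis mem_Collect_eq)
  next
    case False
    then show ?thesis using fg by (metis in_keys_iff mem_Collect_eq subsetD)
  qed
qed

lemma inj_on_reindex:
  assumes "finite X" "inj_on \<beta> X" "inj h"
  shows "inj_on (reindex \<beta> X h) {u. keys u \<subseteq> X}"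
proof (rule inj_onI, rule poly_mapping_eqI)
  fix u v x
  assume uv: "u \<in> {u. keys u \<subseteq> X}" "v \<in> {u. keys u \<subseteq> X}"
    and eq: "reindex \<beta> X h u = reindex \<beta> X h v"
  show "lookup u x = lookup v x"
  proof (cases "x \<in> X")
    case True
    then show ?thesis
      using lookup_reindex(1)[OF assms(1,2)] eq assms(3) by (metis injD)
  next
    case False
    then show ?thesis using uv by (metis in_keys_iff mem_Collect_eq subsetD)
  qed
qed

text \<open>Numbering the finitely many variables makes the exponents linearly ordered, and then the
  product of the leading terms cannot cancel.\<close>

lemma group_algebra_no_zero_divisors:
  fixes f g :: "('x \<Rightarrow>\<^sub>0 int) \<Rightarrow>\<^sub>0 'k::field"
  assumes "finite X"
    and "\<And>u. u \<in> keys f \<Longrightarrow> keys u \<subseteq> X"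
    and "\<And>u. u \<in> keys g \<Longrightarrow> keys u \<subseteq> X"
    and "f * g = 0"
  shows "f = 0 \<or> g = 0"
proof -
  obtain \<beta> :: "'x \<Rightarrow> nat" where \<beta>: "inj_on \<beta> X"
    using finite_imp_inj_to_nat_seg[OF assms(1)] by blast
  let ?w = "\<lambda>u. monomial (reindex \<beta> X id u) :: (nat \<Rightarrow>\<^sub>0 int) \<Rightarrow>\<^sub>0 'k"
  interpret algebra_hom "single 0" ?w
    by (rule algebra_hom_reindex) auto
  let ?H = "lin_ext (single 0) ?w"
  have inj: "inj_on ?H {f. keys f \<subseteq> {u. keys u \<subseteq> X}}"
    by (rule inj_on_lin_ext_monomial[OF inj_on_reindex]) (use assms \<beta> in auto)
  have "?H f * ?H g = 0"
    using assms(4) lin_ext_mult[of f g] by (simp add: lin_ext_0)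
  then have "?H f = ?H 0 \<or> ?H g = ?H 0"
    by (simp add: lin_ext_0)
  then show ?thesis
    using inj_onD[OF inj, of f 0] inj_onD[OF inj, of g 0] assms(2,3) by auto
qed

section \<open>Prime ideals\<close>

definition add_submonoid :: "'m::comm_monoid_add set \<Rightarrow> bool" where
  "add_submonoid S \<longleftrightarrow> 0 \<in> S \<and> (\<forall>x\<in>S. \<forall>y\<in>S. x + y \<in> S)"

lemma carrier_monoid_algebra: "f \<in> carrier (monoid_algebra S) \<longleftrightarrow> keys f \<subseteq> S"
  by (simp add: monoid_algebra_def)

lemma monoid_algebra_mult_closed:
  assumes "add_submonoid S" "keys f \<subseteq> S" "keys g \<subseteq> S"
  shows "keys (f * g :: _ \<Rightarrow>\<^sub>0 'k::field) \<subseteq> S"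
  using keys_mult[of f g] assms unfolding add_submonoid_def by blast

lemma monoid_algebra_add_closed:
  assumes "keys f \<subseteq> S" "keys g \<subseteq> S"
  shows "keys (f + g :: _ \<Rightarrow>\<^sub>0 'k::field) \<subseteq> S"
  using keys_add[of f g] assms by blast

lemma cring_add_submonoid: "add_submonoid S \<Longrightarrow> cring (monoid_algebra S :: (_ \<Rightarrow>\<^sub>0 'k::field) ring)"
  unfolding add_submonoid_def by (rule cring_monoid_algebra) auto

lemma ideal_monoid_algebraI:
  fixes q :: "('m::comm_monoid_add \<Rightarrow>\<^sub>0 'k::field) set"
  assumes S: "add_submonoid S" and sub: "\<And>f. f \<in> q \<Longrightarrow> keys f \<subseteq> S" and "0 \<in> q"
    and add: "\<And>f g. f \<in> q \<Longrightarrow> g \<in> q \<Longrightarrow> f + g \<in> q"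
    and mult: "\<And>f g. f \<in> q \<Longrightarrow> keys g \<subseteq> S \<Longrightarrow> g * f \<in> q"
  shows "ideal q (monoid_algebra S)"
proof -
  interpret cring "monoid_algebra S :: ('m \<Rightarrow>\<^sub>0 'k) ring" by (rule cring_add_submonoid[OF S])
  have minus: "- f \<in> q" if "f \<in> q" for f
    using mult[OF that, of "-1"] S by (simp add: add_submonoid_def)
  show ?thesis
  proof (rule idealI)
    show "ring (monoid_algebra S :: ('m \<Rightarrow>\<^sub>0 'k) ring)" by (rule ring_axioms)
    show "subgroup q (add_monoid (monoid_algebra S))"
    proof (rule add.subgroupI)
      fix f assume f: "f \<in> q"
      then have "\<ominus>\<^bsub>monoid_algebra S\<^esub> f = - f"
        by (intro minus_equality) (use f sub minus in \<open>auto simp: monoid_algebra_def\<close>)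
      then show "\<ominus>\<^bsub>monoid_algebra S\<^esub> f \<in> q" using minus f by simp
    qed (use assms in \<open>auto simp: monoid_algebra_def\<close>)
  qed (use mult in \<open>simp_all add: monoid_algebra_def mult.commute\<close>)
qed

lemma primeideal_monoid_algebraI:
  fixes q :: "('m::comm_monoid_add \<Rightarrow>\<^sub>0 'k::field) set"
  assumes S: "add_submonoid S" and sub: "\<And>f. f \<in> q \<Longrightarrow> keys f \<subseteq> S" and "0 \<in> q"
    and add: "\<And>f g. f \<in> q \<Longrightarrow> g \<in> q \<Longrightarrow> f + g \<in> q"
    and mult: "\<And>f g. f \<in> q \<Longrightarrow> keys g \<subseteq> S \<Longrightarrow> g * f \<in> q"
    and one: "1 \<notin> q"
    and prime: "\<And>f g. keys f \<subseteq> S \<Longrightarrow> keys g \<subseteq> S \<Longrightarrow> f * g \<in> q \<Longrightarrow>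
       f \<in> q \<or> g \<in> q"
  shows "primeideal q (monoid_algebra S)"
proof (rule primeidealI[OF ideal_monoid_algebraI cring_add_submonoid])
  show "carrier (monoid_algebra S) \<noteq> q"
    using one S by (auto simp: monoid_algebra_def add_submonoid_def)
qed (use assms in \<open>auto simp: monoid_algebra_def\<close>)

lemma ideal_monoid_algebraD:
  fixes q :: "('m::comm_monoid_add \<Rightarrow>\<^sub>0 'k::field) set"
  assumes "ideal q (monoid_algebra S)"
  shows "f \<in> q \<Longrightarrow> keys f \<subseteq> S" and "0 \<in> q"
    and "f \<in> q \<Longrightarrow> g \<in> q \<Longrightarrow> f + g \<in> q"
    and "f \<in> q \<Longrightarrow> keys g \<subseteq> S \<Longrightarrow> g * f \<in> q"
proof -
  interpret ideal q "monoid_algebra S" by fact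
  show "f \<in> q \<Longrightarrow> keys f \<subseteq> S"
    using a_subset by (auto simp: monoid_algebra_def)
  show "0 \<in> q" using additive_subgroup.zero_closed[OF is_additive_subgroup] by (simp add: monoid_algebra_def)
  show "f \<in> q \<Longrightarrow> g \<in> q \<Longrightarrow> f + g \<in> q"
    using additive_subgroup.a_closed[OF is_additive_subgroup, of f g] by (simp add: monoid_algebra_def)
  show "f \<in> q \<Longrightarrow> keys g \<subseteq> S \<Longrightarrow> g * f \<in> q"
    using I_l_closed[of f g] by (simp add: monoid_algebra_def)
qed

lemma primeideal_monoid_algebraD:
  fixes q :: "('m::comm_monoid_add \<Rightarrow>\<^sub>0 'k::field) set"
  assumes "primeideal q (monoid_algebra S)"
  shows "ideal q (monoid_algebra S)" and "1 \<notin> q"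
    and "keys f \<subseteq> S \<Longrightarrow> keys g \<subseteq> S \<Longrightarrow> f * g \<in> q \<longleftrightarrow> f \<in> q \<or> g \<in> q"
proof -
  interpret primeideal q "monoid_algebra S" by fact
  show id: "ideal q (monoid_algebra S)" by unfold_locales
  show "1 \<notin> q"
    using I_notcarr one_imp_carrier by (auto simp: monoid_algebra_def)
  show "keys f \<subseteq> S \<Longrightarrow> keys g \<subseteq> S \<Longrightarrow> f * g \<in> q \<longleftrightarrow> f \<in> q \<or> g \<in> q"
    using I_prime[of f g] ideal_monoid_algebraD(4)[OF id, of f g] ideal_monoid_algebraD(4)[OF id, of g f]
    by (auto simp: monoid_algebra_def mult.commute[of g f])
qed

lemma genideal_subset_iff:
  assumes "ideal q R"
  shows "Idl\<^bsub>R\<^esub> G \<subseteq> q \<longleftrightarrow> G \<subseteq> q"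
  using assms unfolding genideal_def by blast

text \<open>The quotient embeds into the domain \<open>'r\<close>. Evaluation in an extension field
  of K gives a point of the scheme in this way.\<close>

lemma primeideal_kernel:
  fixes w :: "'m::comm_monoid_add \<Rightarrow> 'r::idom" and s :: "'k::field \<Rightarrow> 'r"
  assumes "algebra_hom s w" "add_submonoid S"
  shows "primeideal {f. keys f \<subseteq> S \<and> lin_ext s w f = 0} (monoid_algebra S)"
proof -
  interpret algebra_hom s w by fact
  show ?thesis
    by (rule primeideal_monoid_algebraI[OF assms(2)])
      (simp_all add: lin_ext_0 lin_ext_1 lin_ext_add lin_ext_mult
        monoid_algebra_mult_closed[OF assms(2)] monoid_algebra_add_closed)
qed

section \<open>Chains of prime ideals\<close>

definition power_product :: "'a::comm_ring_1 list \<Rightarrow> nat list \<Rightarrow> 'a" where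
  "power_product gs as = prod_list (map2 (^) gs as)"

definition exponents :: "nat \<Rightarrow> nat \<Rightarrow> nat list set" where
  "exponents D m = {as. set as \<subseteq> {..<D} \<and> length as = m}"

lemma finite_exponents: "finite (exponents D m)" and card_exponents: "card (exponents D m) = D ^ m"
  unfolding exponents_def
  by (simp_all add: finite_lists_length_eq card_lists_length_eq)

lemma exponents_0: "exponents D 0 = {[]}"
  by (auto simp: exponents_def)

lemma sum_exponents_Suc:
  "(\<Sum>as\<in>exponents D (Suc m). F as) = (\<Sum>a<D. \<Sum>as\<in>exponents D m. F (a # as))"
proof -
  have "exponents D (Suc m) = (\<lambda>(a, as). a # as) ` ({..<D} \<times> exponents D m)"
    by (auto simp: exponents_def length_Suc_conv image_iff)
  moreover have "inj_on (\<lambda>(a, as). a # as) ({..<D} \<times> exponents D m)"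
    by (auto simp: inj_on_def)
  ultimately show ?thesis
    by (simp add: sum.reindex sum.cartesian_product case_prod_unfold)
qed

text \<open>A list of length m certifies m strict inclusions of primes starting at \<open>P\<close>:
  each entry witnesses one inclusion, while the larger primes are hidden in the existential. This
  allows induction on the list with \<open>P\<close> varying.\<close>

fun prime_chain :: "'m::comm_monoid_add set \<Rightarrow> ('m \<Rightarrow>\<^sub>0 'k::field) set \<Rightarrow> ('m \<Rightarrow>\<^sub>0 'k) list \<Rightarrow> bool" where
  "prime_chain S P [] \<longleftrightarrow> primeideal P (monoid_algebra S)"
| "prime_chain S P (g # gs) \<longleftrightarrow> primeideal P (monoid_algebra S) \<and> keys g \<subseteq> S \<and> g \<notin> P \<and>
     (\<exists>Q. P \<subseteq> Q \<and> g \<in> Q \<and> prime_chain S Q gs)"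

lemma prime_chain_prime: "prime_chain S P gs \<Longrightarrow> primeideal P (monoid_algebra S)"
  by (cases gs) auto

lemma prime_chain_carrier: "prime_chain S P gs \<Longrightarrow> g \<in> set gs \<Longrightarrow> keys g \<subseteq> S"
  by (induction gs arbitrary: P) auto

lemma keys_power_subset:
  assumes "add_submonoid S" "keys (g :: _ \<Rightarrow>\<^sub>0 'k::field) \<subseteq> S"
  shows "keys (g ^ n) \<subseteq> S"
proof (induction n)
  case 0
  then show ?case using assms(1) by (simp add: add_submonoid_def)
next
  case (Suc n)
  then show ?case using monoid_algebra_mult_closed[OF assms] by simp
qed

lemma keys_single0_subset:
  assumes "add_submonoid S"
  shows "keys (single 0 c :: _ \<Rightarrow>\<^sub>0 'k::field) \<subseteq> S"
  using assms by (simp add: add_submonoid_def)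

lemma keys_sum_subset:
  assumes "\<And>i. i \<in> I \<Longrightarrow> keys (F i :: _ \<Rightarrow>\<^sub>0 'k::field) \<subseteq> S"
  shows "keys (sum F I) \<subseteq> S"
  using assms
proof (induction I rule: infinite_finite_induct)
  case (insert x I)
  then show ?case by (simp add: monoid_algebra_add_closed)
qed auto

lemma keys_power_product_subset:
  assumes "add_submonoid S" "\<And>g. g \<in> set gs \<Longrightarrow> keys (g :: _ \<Rightarrow>\<^sub>0 'k::field) \<subseteq> S"
  shows "keys (power_product gs as) \<subseteq> S"
  using assms(2)
proof (induction gs arbitrary: as)
  case Nil
  then show ?case using assms(1) by (simp add: power_product_def add_submonoid_def)
next
  case (Cons g gs)
  show ?case
  proof (cases as)
    case Nil
    then show ?thesis using assms(1) by (simp add: power_product_def add_submonoid_def)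
  next
    case [simp]: (Cons b bs)
    show ?thesis
      using monoid_algebra_mult_closed[OF assms(1) keys_power_subset[OF assms(1), of g b] Cons.IH[of bs]]
        Cons.prems by (simp add: power_product_def)
  qed
qed

text \<open>In a relation among the products of powers, divide by the highest possible power of the
  first element and reduce modulo the next prime of the chain.\<close>

lemma prime_chain_independent:
  fixes c :: "nat list \<Rightarrow> 'k::field"
  assumes "add_submonoid S" "prime_chain S P gs"
    and "(\<Sum>as\<in>exponents D (length gs). single 0 (c as) * power_product gs as) \<in> P"
    and "as \<in> exponents D (length gs)"
  shows "c as = 0"
  using assms(2-)
proof (induction gs arbitrary: P c as)
  case Nil
  have P: "primeideal P (monoid_algebra S)" using Nil by simp
  note id = primeideal_monoid_algebraD(1)[OF P]
  have "single 0 (c []) \<in> P"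
    using Nil by (simp add: exponents_0 power_product_def)
  from ideal_monoid_algebraD(4)[OF id this keys_single0_subset[OF assms(1), of "inverse (c [])"]]
  have "single 0 (inverse (c []) * c []) \<in> P"
    by (simp add: mult_single)
  then have "c [] = 0"
    using primeideal_monoid_algebraD(2)[OF P] by (cases "c [] = 0") auto
  then show ?case using Nil by (simp add: exponents_0)
next
  case (Cons g gs)
  let ?m = "length gs"
  define h where "h a = (\<Sum>as\<in>exponents D ?m. single 0 (c (a # as)) * power_product gs as)" for a
  from Cons.prems obtain Q where P: "primeideal P (monoid_algebra S)" and g: "keys g \<subseteq> S" "g \<notin> P"
    and Q: "P \<subseteq> Q" "g \<in> Q" "prime_chain S Q gs" by auto
  note idP = primeideal_monoid_algebraD(1)[OF P]
  note idQ = primeideal_monoid_algebraD(1)[OF prime_chain_prime[OF Q(3)]]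
  have keys_h: "keys (h a) \<subseteq> S" for a
    unfolding h_def
    by (intro keys_sum_subset monoid_algebra_mult_closed keys_single0_subset keys_power_product_subset
        assms(1) prime_chain_carrier[OF Q(3)])
  have sumP: "(\<Sum>a<D. g ^ a * h a) \<in> P"
    using Cons.prems(2)
    by (simp add: sum_exponents_Suc h_def power_product_def sum_distrib_left mult_ac)
  obtain a0 bs where as: "as = a0 # bs" "a0 < D" "bs \<in> exponents D ?m"
    using Cons.prems(3) by (auto simp: exponents_def length_Suc_conv)
  have "\<forall>bs\<in>exponents D ?m. c (a # bs) = 0" if "a < D" for a
    using that
  proof (induction a rule: less_induct)
    case (less a)
    have h0: "h b = 0" if "b < a" for b
      using less.IH[of b] that less.prems by (simp add: h_def)
    define r where "r = (\<Sum>b\<in>{Suc a..<D}. g ^ (b - Suc a) * h b)"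
    have "(\<Sum>b<D. g ^ b * h b) = (\<Sum>b\<in>{a..<D}. g ^ b * h b)"
      by (rule sum.mono_neutral_right) (use h0 in \<open>auto simp: not_le\<close>)
    also have "\<dots> = g ^ a * h a + (\<Sum>b\<in>{Suc a..<D}. g ^ b * h b)"
      using less.prems by (simp add: sum.atLeast_Suc_lessThan)
    also have "(\<Sum>b\<in>{Suc a..<D}. g ^ b * h b) = g ^ a * (g * r)"
      unfolding r_def sum_distrib_left
    proof (rule sum.cong)
      fix b assume "b \<in> {Suc a..<D}"
      then have "g ^ b = g ^ a * (g * g ^ (b - Suc a))"
        by (simp flip: power_Suc power_add)
      then show "g ^ b * h b = g ^ a * (g * (g ^ (b - Suc a) * h b))" by (simp add: mult.assoc)
    qed simp
    finally have *: "g ^ a * (h a + g * r) \<in> P"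
      using sumP by (simp add: distrib_left)
    have keys_r: "keys r \<subseteq> S"
      unfolding r_def
      by (intro keys_sum_subset monoid_algebra_mult_closed keys_power_subset keys_h assms(1) g)
    have "g ^ n \<notin> P" for n
      by (induction n)
        (use primeideal_monoid_algebraD(2,3)[OF P] g keys_power_subset[OF assms(1) g(1)] in auto)
    then have "h a + g * r \<in> P"
      using * primeideal_monoid_algebraD(3)[OF P keys_power_subset[OF assms(1) g(1)],
          of "h a + g * r" a] monoid_algebra_add_closed[OF keys_h monoid_algebra_mult_closed[OF assms(1) g(1) keys_r]]
      by blast
    moreover have "- (g * r) \<in> Q"
      using ideal_monoid_algebraD(4)[OF idQ Q(2), of "- r"] keys_r by (simp add: mult.commute)
    ultimately have "h a \<in> Q"
      using ideal_monoid_algebraD(3)[OF idQ, of "h a + g * r" "- (g * r)"] Q(1) by auto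
    then show ?case
      using Cons.IH[OF Q(3), of "\<lambda>bs. c (a # bs)"] unfolding h_def by blast
  qed
  then show ?case using as by blast
qed

text \<open>\<open>J\<close> is a set of coordinates that already determines the elements of
  \<open>S\<close>. Since \<open>S\<close> will be a sublattice of all exponents, the count has to
  be governed by \<open>card J\<close> and not by the number of all coordinates.\<close>

lemma card_box_le:
  fixes S :: "('x \<Rightarrow>\<^sub>0 int) set"
  assumes "finite J" and inj: "\<And>u v. u \<in> S \<Longrightarrow> v \<in> S \<Longrightarrow>
      (\<And>x. x \<in> J \<Longrightarrow> lookup u x = lookup v x) \<Longrightarrow> u = v"
  shows "finite {u \<in> S. \<forall>x\<in>J. \<bar>lookup u x\<bar> \<le> int N}"
    and "card {u \<in> S. \<forall>x\<in>J. \<bar>lookup u x\<bar> \<le> int N} \<le> (2 * N + 1) ^ card J"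
proof -
  let ?B = "{u \<in> S. \<forall>x\<in>J. \<bar>lookup u x\<bar> \<le> int N}"
  let ?r = "\<lambda>u. restrict (lookup u) J"
  let ?T = "J \<rightarrow>\<^sub>E {- int N..int N}"
  have fin: "finite ?T" using assms(1) by (simp add: finite_PiE)
  have "inj_on ?r ?B"
  proof (rule inj_onI, rule inj)
    fix u v x assume "?r u = ?r v" "x \<in> J"
    then show "lookup u x = lookup v x" by (metis restrict_apply')
  qed auto
  moreover have "?r ` ?B \<subseteq> ?T" by (auto simp: abs_le_iff)
  ultimately show "finite ?B" "card ?B \<le> (2 * N + 1) ^ card J"
    using fin inj_on_finite[of ?r ?B ?T] card_inj_on_le[of ?r ?B ?T] assms(1)
    by (auto simp: card_PiE nat_add_distrib nat_mult_distrib)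
qed

text \<open>Exponents add under multiplication, so each of at most \<open>sum_list as\<close>
  factors moves a coordinate by at most \<open>B\<close>.\<close>

lemma keys_power_product_box:
  fixes gs :: "(('x \<Rightarrow>\<^sub>0 int) \<Rightarrow>\<^sub>0 'k::field) list"
  assumes "\<And>g u x. g \<in> set gs \<Longrightarrow> u \<in> keys g \<Longrightarrow> x \<in> J \<Longrightarrow> \<bar>lookup u x\<bar> \<le> int B"
    and "u \<in> keys (power_product gs as)" "x \<in> J"
  shows "\<bar>lookup u x\<bar> \<le> int (B * sum_list as)"
  using assms
proof (induction gs arbitrary: as u)
  case Nil
  then show ?case by (simp add: power_product_def)
next
  case (Cons g gs)
  show ?case
  proof (cases as)
    case Nil
    then show ?thesis using Cons.prems by (simp add: power_product_def)
  next
    case [simp]: (Cons b bs)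
    have pow: "\<bar>lookup v x\<bar> \<le> int (B * n)" if "v \<in> keys (g ^ n)" for n v
      using that
    proof (induction n arbitrary: v)
      case (Suc n)
      then obtain v1 v2 where "v = v1 + v2" "v1 \<in> keys g" "v2 \<in> keys (g ^ n)"
        using keys_mult[of g "g ^ n"] by auto
      then show ?case
        using Suc.IH[of v2] Cons.prems(1)[of g v1 x] Cons.prems(3) by (simp add: lookup_add)
    qed simp
    obtain v1 v2 where "u = v1 + v2" "v1 \<in> keys (g ^ b)" "v2 \<in> keys (power_product gs bs)"
      using Cons.prems(2) keys_mult[of "g ^ b" "power_product gs bs"] by (auto simp: power_product_def)
    moreover have "\<bar>lookup v2 x\<bar> \<le> int (B * sum_list bs)"
      by (rule Cons.IH) (use Cons.prems \<open>v2 \<in> _\<close> in auto)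
    ultimately show ?thesis
      using pow[of v1 b] by (auto simp: lookup_add algebra_simps)
  qed
qed

text \<open>Scaling is multiplication by constants; this makes independence and span over the field
  available for the counting argument.\<close>

lemma vector_space_poly_mapping:
  "vector_space (\<lambda>c (f :: 'm::comm_monoid_add \<Rightarrow>\<^sub>0 'k::field). single 0 c * f)"
  by unfold_locales (simp_all add: distrib_left distrib_right single_add mult_single flip: mult.assoc)

text \<open>With m witnesses and n = \<open>card J\<close>, the D^m products with exponents below D
  are independent and lie in the span of at most (C D)^n monomials, where C does not depend on D.
  For large D this forces m \<le> n.\<close>

lemma prime_chain_length_le:
  fixes gs :: "(('x \<Rightarrow>\<^sub>0 int) \<Rightarrow>\<^sub>0 'k::field) list"
  assumes S: "add_submonoid S" and chain: "prime_chain S P gs" and "finite J"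
    and inj: "\<And>u v. u \<in> S \<Longrightarrow> v \<in> S \<Longrightarrow>
      (\<And>x. x \<in> J \<Longrightarrow> lookup u x = lookup v x) \<Longrightarrow> u = v"
  shows "length gs \<le> card J"
proof -
  interpret vector_space "\<lambda>c (f :: ('x \<Rightarrow>\<^sub>0 int) \<Rightarrow>\<^sub>0 'k). single 0 c * f"
    by (rule vector_space_poly_mapping)
  let ?m = "length gs" and ?n = "card J"
  \<comment> \<open>All absolute values of exponents in the witnesses; \<open>insert 0\<close> in
    the next line keeps \<open>Max\<close> meaningful when there are none.\<close>
  define V where "V = (\<lambda>(g, u, x). nat \<bar>lookup u x\<bar>) `
     (SIGMA g:set gs. keys g \<times> J)"
  define B where "B = Max (insert 0 V)"
  have "finite V" unfolding V_def using \<open>finite J\<close> by (intro finite_imageI finite_SigmaI finite_cartesian_product) auto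
  have B: "\<bar>lookup u x\<bar> \<le> int B" if "g \<in> set gs" "u \<in> keys g" "x \<in> J" for g u x
  proof -
    have "nat \<bar>lookup u x\<bar> \<in> V" unfolding V_def using that by force
    then have "nat \<bar>lookup u x\<bar> \<le> B" unfolding B_def using \<open>finite V\<close> by simp
    then show ?thesis by linarith
  qed
  \<comment> \<open>Chosen so that the side length \<open>2 * (B * (?m * D)) + 1\<close> of the box
    is at most \<open>C * D\<close> for every positive D.\<close>
  define C where "C = 2 * (B * ?m) + 1"
  have bound: "D ^ ?m \<le> (C * D) ^ ?n" if "D > 0" for D
  proof -
    let ?E = "exponents D ?m" and ?F = "power_product gs"
    let ?N = "B * (?m * D)"
    let ?box = "{u \<in> S. \<forall>x\<in>J. \<bar>lookup u x\<bar> \<le> int ?N}"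
    let ?A = "?F ` ?E"
    have zero: "c as = 0" if "(\<Sum>as\<in>?E. single 0 (c as) * ?F as) = 0" "as \<in> ?E" for c as
      using prime_chain_independent[OF S chain, of c D as] that
        ideal_monoid_algebraD(2)[OF primeideal_monoid_algebraD(1)[OF prime_chain_prime[OF chain]]] by simp
    \<comment> \<open>Two equal products would give a relation with coefficients 1 and -1.
      Injectivity ensures that the set of products really has D^m elements.\<close>
    have inj_F: "inj_on ?F ?E"
    proof (rule inj_onI, rule ccontr)
      fix as bs assume *: "as \<in> ?E" "bs \<in> ?E" "?F as = ?F bs" "as \<noteq> bs"
      let ?c = "\<lambda>cs. if cs = as then 1 else if cs = bs then - 1 else (0::'k)"
      have "(\<Sum>cs\<in>?E. single 0 (?c cs) * ?F cs)
          = (\<Sum>cs\<in>{as, bs}. single 0 (?c cs) * ?F cs)"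
        by (rule sum.mono_neutral_right) (use * finite_exponents in auto)
      also have "\<dots> = 0" using * by (simp add: single_uminus)
      finally have "?c as = 0" by (rule zero) (use * in simp)
      then show False by simp
    qed
    have indep: "independent ?A"
    proof (rule independent_if_scalars_zero)
      show "finite ?A" by (simp add: finite_exponents)
      fix c x assume s: "(\<Sum>x\<in>?A. single 0 (c x) * x) = 0" and x: "x \<in> ?A"
      then have "(\<Sum>as\<in>?E. single 0 (c (?F as)) * ?F as) = 0"
        by (simp add: sum.reindex[OF inj_F])
      then show "c x = 0" using zero[of "\<lambda>as. c (?F as)"] x by blast
    qed
    have fin: "finite ?box" and card_box: "card ?box \<le> (2 * ?N + 1) ^ ?n"
      by (rule card_box_le[OF \<open>finite J\<close>]; use inj in blast)+
    have in_span: "f \<in> span (monomial ` ?box)" if "keys f \<subseteq> ?box" for f :: "('x \<Rightarrow>\<^sub>0 int) \<Rightarrow>\<^sub>0 'k"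
    proof -
      have "(\<Sum>u\<in>keys f. single 0 (lookup f u) * monomial u)
        \<in> span (monomial ` ?box)"
        by (intro span_sum span_scale span_base) (use that in auto)
      then show ?thesis by (simp add: mult_single flip: poly_mapping_sum_single)
    qed
    have "?A \<subseteq> span (monomial ` ?box)"
    proof
      fix f assume "f \<in> ?A"
      then obtain as where as: "as \<in> ?E" and f: "f = ?F as" by blast
      have "sum_list as \<le> sum_list (map (\<lambda>_. D) as)"
        using sum_list_mono[of as "\<lambda>a. a" "\<lambda>_. D"] as by (force simp: exponents_def)
      then have sl: "sum_list as \<le> ?m * D" using as by (simp add: sum_list_triv exponents_def)
      have "keys f \<subseteq> ?box"
      proof (intro subsetI CollectI conjI ballI)
        fix u assume u: "u \<in> keys f"
        then show "u \<in> S"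
          using keys_power_product_subset[OF S prime_chain_carrier[OF chain], of gs as] f by blast
        fix x assume "x \<in> J"
        then have "\<bar>lookup u x\<bar> \<le> int (B * sum_list as)"
          using keys_power_product_box[of gs J B u as x] B u f by blast
        also have "\<dots> \<le> int ?N" using sl by (intro of_nat_mono mult_le_mono2)
        finally show "\<bar>lookup u x\<bar> \<le> int ?N" .
      qed
      then show "f \<in> span (monomial ` ?box)" by (rule in_span)
    qed
    from independent_span_bound[OF finite_imageI[OF fin] indep this]
    have "card ?A \<le> card (monomial ` ?box :: (('x \<Rightarrow>\<^sub>0 int) \<Rightarrow>\<^sub>0 'k) set)" by blast
    also have "\<dots> \<le> card ?box" by (rule card_image_le[OF fin])
    also have "\<dots> \<le> (2 * ?N + 1) ^ ?n" by (rule card_box)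
    also have "\<dots> \<le> (C * D) ^ ?n"
      by (rule power_mono) (use that in \<open>auto simp: C_def algebra_simps\<close>)
    finally show ?thesis
      using card_image[OF inj_F] by (simp add: card_exponents)
  qed
  show ?thesis
  proof (rule ccontr)
    assume "\<not> ?thesis"
    then have le: "Suc ?n \<le> ?m" by simp
    \<comment> \<open>Any D above \<open>C ^ ?n\<close> works: if m > n, the left side of
      \<open>bound\<close> has an additional factor D over \<open>D ^ ?n\<close>, the right side
      only the factor \<open>C ^ ?n\<close>.\<close>
    let ?D = "C ^ ?n + 1"
    have "?D * ?D ^ ?n \<le> ?D ^ ?m"
      using power_increasing[OF le, of ?D] by simp
    also have "\<dots> \<le> C ^ ?n * ?D ^ ?n"
      using bound[of ?D] by (simp only: power_mult_distrib)
    finally show False by simp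
  qed
qed

section \<open>Krull dimension\<close>

text \<open>Otherwise the complements of \<open>U\<close> and \<open>V\<close> in \<open>Z\<close>
  would be closed and cover \<open>Z\<close>, so that one of them would be all of
  \<open>Z\<close>.\<close>

lemma irreducible_closed_meets:
  assumes "irreducible_closed X Z" "openin X U" "openin X V" "Z \<inter> U \<noteq> {}" "Z \<inter> V \<noteq> {}"
  shows "Z \<inter> U \<inter> V \<noteq> {}"
proof
  assume "Z \<inter> U \<inter> V = {}"
  then have "Z = (Z - U) \<union> (Z - V)" by blast
  moreover have "closedin X (Z - U)" "closedin X (Z - V)"
    using assms unfolding irreducible_closed_def by (auto intro: closedin_diff)
  ultimately have "Z = Z - U \<or> Z = Z - V"
    using assms(1) unfolding irreducible_closed_def by blast
  then show False using assms by blast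
qed

lemma krull_dim_le:
  assumes "\<And>n Z. (\<And>i. i \<le> n \<Longrightarrow> irreducible_closed X (Z i)) \<Longrightarrow> (\<And>i. i < n \<Longrightarrow> Z i \<subset> Z (Suc i)) \<Longrightarrow> n \<le> N"
  shows "krull_dim X \<le> enat N"
  unfolding krull_dim_def by (rule Sup_least) (use assms in \<open>auto, blast\<close>)

lemma krull_dim_singleton:
  assumes "topspace X \<subseteq> {x}"
  shows "krull_dim X = 0"
proof -
  have "krull_dim X \<le> enat 0"
  proof (rule krull_dim_le, rule ccontr)
    fix n and Z :: "nat \<Rightarrow> 'a set"
    assume ir: "\<And>i. i \<le> n \<Longrightarrow> irreducible_closed X (Z i)" and *: "\<And>i. i < n \<Longrightarrow> Z i \<subset> Z (Suc i)" and "\<not> n \<le> 0"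
    then have "Z 0 \<subset> Z 1" by simp
    moreover have "Z 0 \<noteq> {}"
      using ir[of 0] unfolding irreducible_closed_def by simp
    moreover have "closedin X (Z 1)"
      using ir[of 1] \<open>\<not> n \<le> 0\<close> unfolding irreducible_closed_def by simp
    then have "Z 1 \<subseteq> {x}"
      using assms closedin_subset by (metis subset_trans)
    ultimately show False by blast
  qed
  then show ?thesis by (simp flip: zero_enat_def)
qed

text \<open>Vanishing ideals turn a chain of irreducible closed sets into a chain of primes, strict
  because by \<open>sep\<close> a function detects a point outside a closed set. As \<open>g\<close>
  vanishes everywhere, the zero ideal lies strictly below all of them and supplies one step more
  than the chain of sets has. The space need not be a whole spectrum: it enters only through the map
  \<open>p\<close> and the basic open sets.\<close>

lemma krull_dim_spectrum_less:
  fixes p :: "'p \<Rightarrow> (('x \<Rightarrow>\<^sub>0 int) \<Rightarrow>\<^sub>0 'k::field) set"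
  assumes S: "add_submonoid S" and "finite J"
    and coords: "\<And>u v. u \<in> S \<Longrightarrow> v \<in> S \<Longrightarrow>
      (\<And>x. x \<in> J \<Longrightarrow> lookup u x = lookup v x) \<Longrightarrow> u = v"
    and "finite Y" and SY: "\<And>u. u \<in> S \<Longrightarrow> keys u \<subseteq> Y"
    and prime: "\<And>x. x \<in> topspace X \<Longrightarrow> primeideal (p x) (monoid_algebra S)"
    and opn: "\<And>f. keys f \<subseteq> S \<Longrightarrow> openin X {x \<in> topspace X. f \<notin> p x}"
    and sep: "\<And>W y. openin X W \<Longrightarrow> y \<in> W \<Longrightarrow>
      \<exists>f. keys f \<subseteq> S \<and> f \<notin> p y \<and> (\<forall>x\<in>topspace X. f \<notin> p x \<longrightarrow> x \<in> W)"
    and g: "g \<noteq> 0" "keys g \<subseteq> S" "\<And>x. x \<in> topspace X \<Longrightarrow> g \<in> p x"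
  shows "krull_dim X \<le> enat (card J - 1)"
proof (rule krull_dim_le)
  fix n and Z :: "nat \<Rightarrow> 'p set"
  assume ir: "\<And>i. i \<le> n \<Longrightarrow> irreducible_closed X (Z i)" and less: "\<And>i. i < n \<Longrightarrow> Z i \<subset> Z (Suc i)"
  have sub: "Z i \<subseteq> topspace X" "Z i \<noteq> {}" if "i \<le> n" for i
    using ir[OF that] closedin_subset unfolding irreducible_closed_def by blast+
  define I where "I i = {f. keys f \<subseteq> S \<and> (\<forall>x\<in>Z i. f \<in> p x)}" for i
  have prime_I: "primeideal (I i) (monoid_algebra S)" if i: "i \<le> n" for i
  proof (rule primeideal_monoid_algebraI[OF S])
    have id: "ideal (p x) (monoid_algebra S)" if "x \<in> Z i" for x
      using prime primeideal_monoid_algebraD(1) sub[OF i] that by blast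
    show "0 \<in> I i" using ideal_monoid_algebraD(2)[OF id] by (simp add: I_def)
    fix f g
    show "f + g \<in> I i" if "f \<in> I i" "g \<in> I i"
      using that ideal_monoid_algebraD(3)[OF id] monoid_algebra_add_closed unfolding I_def by blast
    show "g * f \<in> I i" if "f \<in> I i" "keys g \<subseteq> S"
      using that ideal_monoid_algebraD(4)[OF id] monoid_algebra_mult_closed[OF S] unfolding I_def by blast
    show "1 \<notin> I i"
      using sub[OF i] prime primeideal_monoid_algebraD(2) unfolding I_def by fastforce
    show "keys f \<subseteq> S" if "f \<in> I i" using that by (simp add: I_def)
    assume f: "keys f \<subseteq> S" and g: "keys g \<subseteq> S" and fg: "f * g \<in> I i"
    show "f \<in> I i \<or> g \<in> I i"
    \<comment> \<open>If neither function vanishes on \<open>Z i\<close>, their nonvanishing loci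
      are open and meet inside \<open>Z i\<close>; at a common point the product would lie in a
      prime that contains neither factor.\<close>
    proof (rule ccontr)
      assume "\<not> ?thesis"
      then have "Z i \<inter> {x \<in> topspace X. f \<notin> p x} \<inter> {x \<in> topspace X. g \<notin> p x} \<noteq> {}"
        by (intro irreducible_closed_meets[OF ir[OF i]] opn f g)
          (use f g sub[OF i] in \<open>auto simp: I_def\<close>)
      then show False
        using fg primeideal_monoid_algebraD(3)[OF prime f g] unfolding I_def by blast
    qed
  qed
  \<comment> \<open>Vanishing ideals reverse inclusions, so the list is built from the smallest set
    upwards and each new witness is put in front.\<close>
  have "\<exists>gs. prime_chain S (I m) gs \<and> length gs = m" if "m \<le> n" for m
    using that
  proof (induction m)
    case 0
    then show ?case using prime_I by (intro exI[of _ "[]"]) simp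
  next
    case (Suc m)
    then obtain gs where gs: "prime_chain S (I m) gs" "length gs = m" by auto
    have "Z m \<subset> Z (Suc m)" using less Suc.prems by simp
    then obtain y where y: "y \<in> Z (Suc m)" "y \<notin> Z m" by blast
    have "openin X (topspace X - Z m)"
      using ir[of m] Suc.prems unfolding irreducible_closed_def by auto
    from sep[OF this, of y] obtain f where f: "keys f \<subseteq> S" "f \<notin> p y"
      "\<And>x. x \<in> topspace X \<Longrightarrow> f \<notin> p x \<Longrightarrow> x \<notin> Z m"
      using y sub[of "Suc m"] Suc.prems by blast
    have "f \<in> I m" using f sub(1)[of m] Suc.prems unfolding I_def by auto
    moreover have "f \<notin> I (Suc m)" using f y unfolding I_def by blast
    moreover have "I (Suc m) \<subseteq> I m" using \<open>Z m \<subset> Z (Suc m)\<close> unfolding I_def by blast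
    ultimately show ?case
      using gs prime_I[OF Suc.prems] f by (intro exI[of _ "f # gs"]) auto
  qed
  then obtain gs where gs: "prime_chain S (I n) gs" "length gs = n" by blast
  have "primeideal {0 :: ('x \<Rightarrow>\<^sub>0 int) \<Rightarrow>\<^sub>0 'k} (monoid_algebra S)"
  proof (rule primeideal_monoid_algebraI[OF S])
    fix f h :: "('x \<Rightarrow>\<^sub>0 int) \<Rightarrow>\<^sub>0 'k"
    assume "keys f \<subseteq> S" "keys h \<subseteq> S" "f * h \<in> {0}"
    then show "f \<in> {0} \<or> h \<in> {0}"
      using group_algebra_no_zero_divisors[OF \<open>finite Y\<close>, of f h] SY by auto
  qed auto
  moreover have "g \<in> I n" using g sub[of n] by (auto simp: I_def)
  moreover have "0 \<in> I n"
    using ideal_monoid_algebraD(2)[OF primeideal_monoid_algebraD(1)[OF prime_I]] by blast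
  ultimately have "prime_chain S {0} (g # gs)"
    using g gs by auto
  then have "length (g # gs) \<le> card J"
    by (rule prime_chain_length_le[OF S _ \<open>finite J\<close>]) (use coords in blast)
  then show "n \<le> card J - 1"
    using gs by simp
qed

section \<open>Arrangements and the Lawrence fan\<close>

definition slope :: "'e arrangement \<Rightarrow> 'e \<Rightarrow> (nat \<Rightarrow> real) \<Rightarrow> real" where
  "slope A e m = (\<Sum>i<rk A. m i * real_of_int (normal A e i))"

lemma aff_slope: "aff A e m = slope A e m + real_of_int (shift A e)"
  by (simp add: aff_def slope_def)

lemma slope_linear: "slope A e (\<lambda>i. m i + t * m' i) = slope A e m + t * slope A e m'"
  by (simp add: slope_def distrib_right sum.distrib sum_distrib_left mult.assoc)

lemma slope_diff: "slope A e (\<lambda>i. m i - m' i) = slope A e m - slope A e m'"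
  by (simp add: slope_def left_diff_distrib sum_subtractf)

definition poly_mapping_on :: "'e set \<Rightarrow> ('e \<Rightarrow> 'b::comm_monoid_add) \<Rightarrow> ('e \<Rightarrow>\<^sub>0 'b)" where
  "poly_mapping_on E h = (\<Sum>e\<in>E. single e (h e))"

lemma lookup_poly_mapping_on:
  assumes "finite E"
  shows "lookup (poly_mapping_on E h) e = (if e \<in> E then h e else 0)"
  using assms by (simp add: poly_mapping_on_def lookup_sum lookup_single when_def)

lemma keys_poly_mapping_on: "finite E \<Longrightarrow> keys (poly_mapping_on E h) \<subseteq> E"
  by (auto simp: in_keys_iff lookup_poly_mapping_on split: if_splits)

lemma UNIV_sign: "UNIV = {Pos, Neg}"
  using sign.exhaust by blast

lemma finite_sign [simp]: "finite (UNIV :: sign set)"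
  by (subst UNIV_sign) simp

lemma sum_sign: "(\<Sum>x\<in>E \<times> (UNIV :: sign set). F x) = (\<Sum>e\<in>E. F (e, Pos) + F (e, Neg))"
proof -
  have "(\<Sum>s\<in>UNIV. F (e, s)) = F (e, Pos) + F (e, Neg)" for e
    by (subst UNIV_sign) simp
  then show ?thesis
    using sum.cartesian_product[of "\<lambda>e s. F (e, s)" UNIV E] by simp
qed

lemma pairing_superset:
  assumes "finite Y" "keys u \<subseteq> Y"
  shows "pairing u v = (\<Sum>x\<in>Y. real_of_int (lookup u x) * lookup v x)"
  unfolding pairing_def
  by (rule sum.mono_neutral_left) (use assms in \<open>auto simp: in_keys_iff\<close>)

lemma lookup_scaleR [simp]: "lookup (c *\<^sub>R v) x = c *\<^sub>R lookup v x"
  by (simp add: scaleR_poly_mapping_def Poly_Mapping.map.rep_eq when_def)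

lemma linear_pairing: "linear (pairing u)"
  by (rule linearI) (simp_all add: pairing_def lookup_add distrib_left sum.distrib sum_distrib_left mult_ac)

lemma pairing_single: "pairing u (single x 1) = real_of_int (lookup u x)"
proof -
  have "pairing u (single x 1)
     = (\<Sum>z\<in>keys u. if z = x then real_of_int (lookup u x) else 0)"
    unfolding pairing_def by (rule sum.cong) (auto simp: lookup_single when_def)
  then show ?thesis by (simp add: in_keys_iff)
qed

text \<open>A basis of the span, extended by \<open>x\<close>, is independent, so the values 0 and 1
  can be prescribed on it.\<close>

lemma exists_separating_functional:
  fixes x :: "'a::real_vector"
  assumes "x \<notin> span C"
  shows "\<exists>f :: 'a \<Rightarrow> real. linear f \<and> (\<forall>v\<in>span C. f v = 0) \<and> f x = 1"
proof -
  obtain D where D: "D \<subseteq> span C" "independent D" "span C \<subseteq> span D"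
    by (rule basis_exists[of "span C"])
  have span_D: "span D = span C"
    using D(3) span_mono[OF D(1)] unfolding span_span by (rule subset_antisym[rotated])
  have "independent (insert x D)"
    using D(2) assms span_D by (simp add: independent_insertI)
  from linear_independent_extend[OF this, of "\<lambda>y. if y = x then 1 else 0"]
  obtain f :: "'a \<Rightarrow> real" where f: "linear f" "\<forall>y\<in>insert x D. f y = (if y = x then 1 else 0)"
    by blast
  have "x \<notin> D" using assms D(1) by blast
  then have "f y = 0" if "y \<in> D" for y using f(2) that by auto
  then have "f v = 0" if "v \<in> span C" for v
    using linear_eq_0_on_span[OF f(1), of D v] that span_D by blast
  then show ?thesis using f by auto
qed

section \<open>Linear algebra of the normals, and vertices of the arrangement\<close>

locale spanning_arrangement =
  fixes A :: "'e arrangement"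
  assumes primitive_spanning: "primitive_spanning A"
begin

abbreviation "E \<equiv> idx A"
abbreviation "d \<equiv> rk A"

lemma finite_E [simp]: "finite E"
  using primitive_spanning by (simp add: primitive_spanning_def)

lemma finite_EU [simp]: "finite (E \<times> (UNIV :: sign set))"
  by simp

lemma normal_beyond: "e \<in> E \<Longrightarrow> j \<ge> d \<Longrightarrow> normal A e j = 0"
  using primitive_spanning
  by (auto simp: primitive_spanning_def primitive_vector_def coord_space_def)

text \<open>A section of the surjection from Z^E onto N, given on the unit vectors.\<close>

lemma unit_lifts:
  obtains c :: "nat \<Rightarrow> 'e \<Rightarrow> int" where
    "\<And>i j. i < d \<Longrightarrow> (\<Sum>e\<in>E. c i e * normal A e j) = (if j = i then 1 else 0)"
proof -
  have "\<exists>c. \<forall>j. (\<Sum>e\<in>E. c e * normal A e j) = (if j = i then 1 else 0)" if "i < d" for i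
  proof -
    have "(\<lambda>j. if j = i then 1 else 0 :: int) \<in> coord_space d"
      using that by (auto simp: coord_space_def)
    then obtain c :: "'e \<Rightarrow> int" where "(\<lambda>j. if j = i then 1 else 0) = (\<lambda>j. \<Sum>e\<in>E. c e * normal A e j)"
      using primitive_spanning unfolding primitive_spanning_def by blast
    then show ?thesis by metis
  qed
  then have "\<exists>c. \<forall>i<d. \<forall>j. (\<Sum>e\<in>E. c i e * normal A e j) = (if j = i then 1 else 0)"
    by metis
  then show thesis using that by blast
qed

lemma slope_eq_0_imp:
  assumes m: "m \<in> coord_space d" and zero: "\<And>e. e \<in> E \<Longrightarrow> slope A e m = 0"
  shows "m = (\<lambda>_. 0)"
proof
  fix i
  obtain c :: "nat \<Rightarrow> 'e \<Rightarrow> int" where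
    c: "\<And>i j. i < d \<Longrightarrow> (\<Sum>e\<in>E. c i e * normal A e j) = (if j = i then 1 else 0)"
    using unit_lifts by blast
  show "m i = 0"
  proof (cases "i < d")
    case True
    have "m i = (\<Sum>j<d. m j * real_of_int (if j = i then 1 else 0))"
      using True by (simp add: if_distrib[of real_of_int] if_distrib[of "(*) _"] cong: if_cong)
    also have "\<dots> = (\<Sum>j<d. m j * real_of_int (\<Sum>e\<in>E. c i e * normal A e j))"
      using c[OF True] by simp
    also have "\<dots> = (\<Sum>e\<in>E. real_of_int (c i e) * slope A e m)"
      unfolding slope_def by (simp add: sum_distrib_left mult_ac) (rule sum.swap)
    finally show ?thesis using zero by simp
  next
    case False
    then show ?thesis using m by (simp add: coord_space_def)
  qed
qed

text \<open>Both delta_e0 and the section applied to a_e0 map to a_e0 in N, so their difference is a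
  relation.\<close>

lemma unit_relation:
  assumes c: "\<And>i j. i < d \<Longrightarrow> (\<Sum>e\<in>E. c i e * normal A e j) = (if j = i then 1 else 0 :: int)"
    and "e0 \<in> E"
  shows "poly_mapping_on E (\<lambda>e. (if e = e0 then 1 else 0) - (\<Sum>i<d. normal A e0 i * c i e)) \<in> relations A"
    (is "poly_mapping_on E ?h \<in> _")
proof -
  have "(\<Sum>e\<in>E. ?h e * normal A e j) = 0" for j
  proof -
    have "(\<Sum>e\<in>E. ?h e * normal A e j) = (\<Sum>e\<in>E. if e = e0 then normal A e j else 0)
        - (\<Sum>e\<in>E. \<Sum>i<d. normal A e0 i * (c i e * normal A e j))"
      unfolding sum_subtractf[symmetric]
      by (rule sum.cong) (auto simp: left_diff_distrib sum_distrib_right mult.assoc)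
    also have "(\<Sum>e\<in>E. \<Sum>i<d. normal A e0 i * (c i e * normal A e j))
        = (\<Sum>i<d. normal A e0 i * (\<Sum>e\<in>E. c i e * normal A e j))"
      by (subst sum.swap) (simp add: sum_distrib_left)
    also have "\<dots> = (\<Sum>i<d. if i = j then normal A e0 i else 0)"
      by (rule sum.cong) (auto simp: c)
    also have "\<dots> = normal A e0 j"
      using normal_beyond[OF assms(2), of j] by auto
    finally show ?thesis using assms(2) by simp
  qed
  then show ?thesis
    unfolding relations_def by (auto simp: lookup_poly_mapping_on keys_poly_mapping_on[THEN subsetD])
qed

text \<open>A functional on R^E that kills all relations factors through N_R, and \<open>m\<close>
  is its composition with the section from \<open>unit_lifts\<close>. The relations of
  \<open>unit_relation\<close> are enough to see this.\<close>

lemma functional_from_slope: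
  assumes "\<And>c. c \<in> relations A \<Longrightarrow> (\<Sum>e\<in>E. real_of_int (lookup c e) * w e) = 0"
  obtains m where "m \<in> coord_space d" "\<And>e. e \<in> E \<Longrightarrow> w e = slope A e m"
proof -
  obtain c :: "nat \<Rightarrow> 'e \<Rightarrow> int" where
    c: "\<And>i j. i < d \<Longrightarrow> (\<Sum>e\<in>E. c i e * normal A e j) = (if j = i then 1 else 0)"
    using unit_lifts by blast
  define m where "m i = (if i < d then \<Sum>e\<in>E. real_of_int (c i e) * w e else 0)" for i
  have "w e0 = slope A e0 m" if e0: "e0 \<in> E" for e0
  proof -
    have "(\<Sum>e\<in>E. real_of_int ((if e = e0 then 1 else 0) - (\<Sum>i<d. normal A e0 i * c i e)) * w e) = 0"
      using assms[OF unit_relation[OF c e0]] by (simp add: lookup_poly_mapping_on)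
    also have "(\<Sum>e\<in>E. real_of_int ((if e = e0 then 1 else 0) - (\<Sum>i<d. normal A e0 i * c i e)) * w e)
       = (\<Sum>e\<in>E. if e = e0 then w e else 0) -
         (\<Sum>e\<in>E. \<Sum>i<d. real_of_int (normal A e0 i) * (real_of_int (c i e) * w e))"
      unfolding sum_subtractf[symmetric]
      by (rule sum.cong) (auto simp: left_diff_distrib sum_distrib_right mult.assoc)
    also have "(\<Sum>e\<in>E. \<Sum>i<d. real_of_int (normal A e0 i) * (real_of_int (c i e) * w e)) = slope A e0 m"
      by (subst sum.swap) (simp add: slope_def m_def sum_distrib_left sum_distrib_right mult_ac)
    finally show ?thesis using e0 by simp
  qed
  moreover have "m \<in> coord_space d" by (simp add: m_def coord_space_def)
  ultimately show thesis using that by blast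
qed

text \<open>A real basis chosen among the normals, in dual form: trivial common kernel means that
  the normals in \<open>B\<close> span, and a functional that is nonzero on \<open>b\<close> alone
  for each \<open>b\<close> means that they are independent. Both can be applied directly to
  \<open>slope\<close>.\<close>

definition is_basis :: "'e set \<Rightarrow> bool" where
  "is_basis B \<longleftrightarrow> B \<subseteq> E \<and>
     (\<forall>m\<in>coord_space d. (\<forall>e\<in>B. slope A e m = 0) \<longrightarrow> m = (\<lambda>_. 0)) \<and>
     (\<forall>b\<in>B. \<exists>m. slope A b m \<noteq> 0 \<and> (\<forall>e\<in>B - {b}. slope A e m = 0))"

text \<open>A smallest set of normals with trivial common kernel works: if some \<open>b\<close> had
  no functional of its own, the kernel would remain trivial without \<open>b\<close>.\<close>

lemma is_basis_exists: "\<exists>B. is_basis B"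
proof -
  let ?P = "\<lambda>B. B \<subseteq> E \<and> (\<forall>m\<in>coord_space d. (\<forall>e\<in>B. slope A e m = 0) \<longrightarrow> m = (\<lambda>_. 0))"
  have "?P E" using slope_eq_0_imp by blast
  then obtain B where B: "?P B" and min: "\<And>B'. ?P B' \<Longrightarrow> card B \<le> card B'"
    using ex_has_least_nat[of ?P E card] by blast
  have "\<exists>m. slope A b m \<noteq> 0 \<and> (\<forall>e\<in>B - {b}. slope A e m = 0)" if "b \<in> B" for b
  proof (rule ccontr)
    assume *: "\<not> ?thesis"
    have "?P (B - {b})" using B * by blast
    from min[OF this] have "card B \<le> card (B - {b})" .
    moreover have "finite B" using B finite_subset[OF _ finite_E] by blast
    ultimately show False using that card_Diff1_less by (metis leD)
  qed
  then show ?thesis using B unfolding is_basis_def by blast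
qed

text \<open>Evaluating the combination at the functional that belongs to \<open>e\<close> isolates
  the coefficient of \<open>e\<close>.\<close>

lemma basis_independent:
  assumes "is_basis B" and "\<And>e. e \<notin> B \<Longrightarrow> c e = (0::real)"
    and zero: "\<And>i. (\<Sum>e\<in>E. c e * real_of_int (normal A e i)) = 0"
  shows "c e = 0"
proof (cases "e \<in> B")
  case True
  then obtain m where m: "slope A e m \<noteq> 0" "\<And>e'. e' \<in> B - {e} \<Longrightarrow> slope A e' m = 0"
    using assms(1) unfolding is_basis_def by blast
  have "(\<Sum>e'\<in>E. c e' * slope A e' m) = (\<Sum>i<d. m i * (\<Sum>e'\<in>E. c e' * real_of_int (normal A e' i)))"
    unfolding slope_def sum_distrib_left by (subst sum.swap) (simp add: mult_ac)
  then have "0 = (\<Sum>e'\<in>E. c e' * slope A e' m)" by (simp add: zero)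
  also have "\<dots> = (\<Sum>e'\<in>E. if e' = e then c e * slope A e m else 0)"
    by (rule sum.cong) (use m assms(2) in auto)
  also have "\<dots> = c e * slope A e m"
    using True assms(1) by (auto simp: is_basis_def)
  finally show ?thesis using m(1) by simp
qed (use assms in simp)

text \<open>A point on as many hyperplanes as possible works. Another point with the same signs
  would lie on the same hyperplanes, and the line through both would meet a further hyperplane
  without leaving these.\<close>

lemma vertex_exists: "vertices A \<noteq> {}"
proof -
  let ?Z = "\<lambda>m. {e \<in> E. aff A e m = 0}"
  have "(\<lambda>_. 0) \<in> (coord_space d :: (nat \<Rightarrow> real) set)" by (simp add: coord_space_def)
  moreover have "\<forall>m. m \<in> coord_space d \<longrightarrow> card (?Z m) < Suc (card E)"
    by (intro allI impI le_imp_less_Suc card_mono) auto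
  ultimately have "\<exists>\<xi>. \<xi> \<in> coord_space d \<and> (\<forall>m. m \<in> coord_space d \<longrightarrow> card (?Z m) \<le> card (?Z \<xi>))"
    by (rule Lattices_Big.ex_has_greatest_nat[where P = "\<lambda>m. m \<in> coord_space d" and f = "\<lambda>m. card (?Z m)"])
  then obtain \<xi> where \<xi>: "\<xi> \<in> coord_space d" and max: "\<And>m. m \<in> coord_space d \<Longrightarrow> card (?Z m) \<le> card (?Z \<xi>)"
    by auto
  have "m = \<xi>" if m: "m \<in> coord_space d" and sg: "sign_vector A m = sign_vector A \<xi>" for m
  proof (rule ccontr)
    assume "m \<noteq> \<xi>"
    let ?w = "\<lambda>i. m i - \<xi> i"
    have "?w \<noteq> (\<lambda>_. 0)" using \<open>m \<noteq> \<xi>\<close> by (auto simp: fun_eq_iff)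
    moreover have w: "?w \<in> coord_space d" using m \<xi> by (simp add: coord_space_def)
    ultimately obtain e where e: "e \<in> E" "slope A e ?w \<noteq> 0" using slope_eq_0_imp by blast
    have wz: "slope A f ?w = 0" if "f \<in> ?Z \<xi>" for f
    proof -
      have "sgn (aff A f m) = sgn (aff A f \<xi>)"
        using fun_cong[OF sg, of f] that by (simp add: sign_vector_def)
      then have "aff A f m = 0" using that by (simp add: sgn_zero_iff)
      then show ?thesis using that by (simp add: slope_diff aff_slope)
    qed
    \<comment> \<open>The parameter at which the line from \<xi> in direction \<open>?w\<close>
      crosses the hyperplane of \<open>e\<close>.\<close>
    define t where "t = - aff A e \<xi> / slope A e ?w"
    let ?m = "\<lambda>i. \<xi> i + t * ?w i"
    have aff: "aff A f ?m = aff A f \<xi> + t * slope A f ?w" for f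
      unfolding aff_slope slope_linear by simp
    have "?m \<in> coord_space d" using w \<xi> by (simp add: coord_space_def)
    then have "card (?Z ?m) \<le> card (?Z \<xi>)" by (rule max)
    moreover have "insert e (?Z \<xi>) \<subseteq> ?Z ?m"
    proof
      fix f assume "f \<in> insert e (?Z \<xi>)"
      then consider "f = e" | "f \<in> ?Z \<xi>" by blast
      then show "f \<in> ?Z ?m"
      proof cases
        case 1
        then show ?thesis unfolding mem_Collect_eq aff using e by (simp add: t_def)
      next
        case 2
        then show ?thesis unfolding mem_Collect_eq aff using wz[OF 2] by simp
      qed
    qed
    moreover have "e \<notin> ?Z \<xi>" using wz e by blast
    ultimately show False
      using card_mono[of "?Z ?m" "insert e (?Z \<xi>)"] by simp
  qed
  then have "\<xi> \<in> vertices A" using \<xi> unfolding vertices_def by blast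
  then show ?thesis by blast
qed

text \<open>The normals of the hyperplanes through a vertex span: along a nonzero direction in all
  these hyperplanes one could move a little without changing any sign.\<close>

lemma vertex_slope_eq_0_imp:
  assumes \<xi>: "\<xi> \<in> vertices A" and m: "m \<in> coord_space d"
    and zero: "\<And>e. e \<in> E \<Longrightarrow> aff A e \<xi> = 0 \<Longrightarrow> slope A e m = 0"
  shows "m = (\<lambda>_. 0)"
proof -
  have fib: "{m \<in> coord_space d. sign_vector A m = sign_vector A \<xi>} = {\<xi>}"
    using \<xi> by (simp add: vertices_def)
  \<comment> \<open>Small enough that no nonzero value of \<open>aff\<close> changes sign. The
    summand 1 in the denominator avoids division by zero and makes the estimate strict;
    \<open>insert 1\<close> covers the case that all hyperplanes pass through \<xi>.\<close>
  define \<epsilon> where "\<epsilon> = Min (insert 1 ((\<lambda>e. \<bar>aff A e \<xi>\<bar> / (\<bar>slope A e m\<bar> + 1)) ` {e \<in> E. aff A e \<xi> \<noteq> 0}))"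
  have \<epsilon>: "\<epsilon> > 0" unfolding \<epsilon>_def by (subst Min_gr_iff) auto
  have small: "\<epsilon> * \<bar>slope A e m\<bar> < \<bar>aff A e \<xi>\<bar>" if "e \<in> E" "aff A e \<xi> \<noteq> 0" for e
  proof -
    have "\<epsilon> \<le> \<bar>aff A e \<xi>\<bar> / (\<bar>slope A e m\<bar> + 1)"
      unfolding \<epsilon>_def by (rule Min_le) (use that in auto)
    then have "\<epsilon> * (\<bar>slope A e m\<bar> + 1) \<le> \<bar>aff A e \<xi>\<bar>" by (simp add: pos_le_divide_eq)
    then show ?thesis using \<epsilon> by (simp add: algebra_simps)
  qed
  let ?m = "\<lambda>i. \<xi> i + \<epsilon> * m i"
  have aff: "aff A e ?m = aff A e \<xi> + \<epsilon> * slope A e m" for e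
    unfolding aff_slope slope_linear by simp
  have "sgn (aff A e ?m) = sgn (aff A e \<xi>)" if "e \<in> E" for e
  proof (cases "aff A e \<xi> = 0")
    case True
    then show ?thesis using zero that by (simp add: aff)
  next
    case False
    have "\<bar>\<epsilon> * slope A e m\<bar> < \<bar>aff A e \<xi>\<bar>" using small[OF that False] \<epsilon> by (simp add: abs_mult)
    then show ?thesis unfolding aff by (auto simp: sgn_if)
  qed
  then have "sign_vector A ?m = sign_vector A \<xi>"
    unfolding sign_vector_def by (intro restrict_ext) simp
  moreover have "\<xi> \<in> coord_space d" using fib by blast
  then have "?m \<in> coord_space d" using m by (simp add: coord_space_def)
  ultimately have "?m = \<xi>" using fib by blast
  then have "\<epsilon> * m i = 0" for i by (metis add_cancel_left_right)
  then show ?thesis using \<epsilon> by (auto simp: fun_eq_iff)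
qed

section \<open>The lattice of relations and the dual lattice\<close>

lemma lookup_relation_vec:
  "lookup (relation_vec A c) (e, s) =
     (if e \<in> E then (case s of Pos \<Rightarrow> real_of_int (lookup c e) | Neg \<Rightarrow> - real_of_int (lookup c e)) else 0)"
proof -
  have "lookup (relation_vec A c) (e, s) = (\<Sum>f\<in>E. if f = e then
      (case s of Pos \<Rightarrow> real_of_int (lookup c e) | Neg \<Rightarrow> - real_of_int (lookup c e)) else 0)"
    unfolding relation_vec_def lookup_sum
    by (rule sum.cong; cases s) (auto simp: lookup_minus lookup_single when_def)
  then show ?thesis by simp
qed

text \<open>All three conditions are linear and hold on the vectors \<open>relation_vec A c\<close>;
  the third is the defining equation of a relation, with real coefficients.\<close>

lemma Lam_realD:
  assumes "v \<in> Lam_real A"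
  shows "keys v \<subseteq> E \<times> UNIV"
    and "lookup v (e, Neg) = - lookup v (e, Pos)"
    and "(\<Sum>e\<in>E. lookup v (e, Pos) * real_of_int (normal A e i)) = 0"
proof -
  let ?T = "{v :: 'e \<times> sign \<Rightarrow>\<^sub>0 real. (\<forall>e s. e \<notin> E \<longrightarrow> lookup v (e, s) = 0) \<and>
     (\<forall>e. lookup v (e, Neg) = - lookup v (e, Pos)) \<and>
     (\<forall>i. (\<Sum>e\<in>E. lookup v (e, Pos) * real_of_int (normal A e i)) = 0)}"
  have "subspace ?T"
    by (rule subspaceI)
      (simp_all add: lookup_add distrib_right sum.distrib mult.assoc flip: sum_distrib_left)
  moreover have "relation_vec A ` relations A \<subseteq> ?T"
  proof (clarsimp simp: lookup_relation_vec)
    fix c i assume "c \<in> relations A"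
    then have "(\<Sum>e\<in>E. lookup c e * normal A e i) = 0" by (simp add: relations_def)
    then have "real_of_int (\<Sum>e\<in>E. lookup c e * normal A e i) = 0" by simp
    then show "(\<Sum>e\<in>E. real_of_int (lookup c e) * real_of_int (normal A e i)) = 0"
      by simp
  qed
  ultimately have "Lam_real A \<subseteq> ?T"
    unfolding Lam_real_def by (intro span_minimal)
  then have "v \<in> ?T" using assms by (rule subsetD)
  then show "keys v \<subseteq> E \<times> UNIV"
    "lookup v (e, Neg) = - lookup v (e, Pos)"
    "(\<Sum>e\<in>E. lookup v (e, Pos) * real_of_int (normal A e i)) = 0"
    by (auto simp: in_keys_iff)
qed

lemma pairing_Lam_real:
  assumes "u \<in> M_tilde A" "v \<in> Lam_real A"
  shows "pairing u v = 0"
  using linear_eq_0_on_span[OF linear_pairing, of "relation_vec A ` relations A" u v] assms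
  by (auto simp: M_tilde_def Lam_real_def)

text \<open>Pairing \<open>u\<close> with a relation multiplies its coefficients by the differences
  of the two entries of \<open>u\<close> at each index. So these differences are a functional that
  kills all relations.\<close>

lemma M_tilde_slope:
  assumes "u \<in> M_tilde A"
  obtains m where "m \<in> coord_space d"
    "\<And>e. e \<in> E \<Longrightarrow> real_of_int (lookup u (e, Pos) - lookup u (e, Neg)) = slope A e m"
proof (rule functional_from_slope)
  fix c assume c: "c \<in> relations A"
  have "0 = pairing u (relation_vec A c)" using assms c by (simp add: M_tilde_def)
  also have "\<dots> = (\<Sum>x\<in>E \<times> UNIV. real_of_int (lookup u x) * lookup (relation_vec A c) x)"
    by (rule pairing_superset) (use assms in \<open>auto simp: M_tilde_def\<close>)
  also have "\<dots> = (\<Sum>e\<in>E. real_of_int (lookup c e) *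
      real_of_int (lookup u (e, Pos) - lookup u (e, Neg)))"
    unfolding sum_sign by (rule sum.cong) (auto simp: lookup_relation_vec algebra_simps)
  finally show "(\<Sum>e\<in>E. real_of_int (lookup c e) *
      real_of_int (lookup u (e, Pos) - lookup u (e, Neg))) = 0" by simp
qed (use that in blast)

text \<open>A set of coordinates that determines an element of \<open>M_tilde A\<close>. Its
  cardinality stands for n: it is an upper bound for chains of primes on the torus and a lower bound
  for the dimension of the cone of a vertex.\<close>

definition coords :: "'e set \<Rightarrow> ('e \<times> sign) set" where
  "coords B = B \<times> {Pos} \<union> E \<times> {Neg}"

lemma coords_subset: "is_basis B \<Longrightarrow> coords B \<subseteq> E \<times> UNIV"
  by (auto simp: coords_def is_basis_def)

lemma finite_coords: "is_basis B \<Longrightarrow> finite (coords B)"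
  using coords_subset finite_subset finite_EU by blast

text \<open>The \<open>Neg\<close> entries agree, so on \<open>B\<close> the differences of entries
  agree; then the underlying points of M_R coincide because \<open>B\<close> separates them, and the
  remaining \<open>Pos\<close> entries follow.\<close>

lemma coords_injective:
  assumes B: "is_basis B" and u: "u \<in> M_tilde A" and v: "v \<in> M_tilde A"
    and eq: "\<And>x. x \<in> coords B \<Longrightarrow> lookup u x = lookup v x"
  shows "u = v"
proof -
  obtain m where m: "m \<in> coord_space d"
    "\<And>e. e \<in> E \<Longrightarrow> real_of_int (lookup u (e, Pos) - lookup u (e, Neg)) = slope A e m"
    using M_tilde_slope[OF u] by blast
  obtain m' where m': "m' \<in> coord_space d"
    "\<And>e. e \<in> E \<Longrightarrow> real_of_int (lookup v (e, Pos) - lookup v (e, Neg)) = slope A e m'"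
    using M_tilde_slope[OF v] by blast
  have "(\<lambda>i. m i - m' i) \<in> coord_space d" using m m' by (simp add: coord_space_def)
  moreover have "slope A e (\<lambda>i. m i - m' i) = 0" if "e \<in> B" for e
  proof -
    have "e \<in> E" using B that by (auto simp: is_basis_def)
    then show ?thesis
      using that eq[of "(e, Pos)"] eq[of "(e, Neg)"] m(2)[of e] m'(2)[of e]
      by (simp add: slope_diff coords_def)
  qed
  ultimately have "(\<lambda>i. m i - m' i) = (\<lambda>_. 0)" using B unfolding is_basis_def by blast
  then have "m = m'" by (auto simp: fun_eq_iff)
  show ?thesis
  proof (rule poly_mapping_eqI)
    fix x :: "'e \<times> sign"
    obtain e s where x: "x = (e, s)" by (cases x)
    show "lookup u x = lookup v x"
    proof (cases "e \<in> E")
      case True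
      then show ?thesis
        using eq[of "(e, Neg)"] m(2)[of e] m'(2)[of e] \<open>m = m'\<close> x
        by (cases s) (auto simp: coords_def)
    next
      case False
      then have "x \<notin> keys u" "x \<notin> keys v"
        using u v x by (auto simp: M_tilde_def)
      then show ?thesis by (simp add: in_keys_iff)
    qed
  qed
qed

section \<open>Cones of vertices\<close>

definition generators :: "(nat \<Rightarrow> real) \<Rightarrow> ('e \<times> sign) set" where
  "generators \<xi> = E_pos A \<xi> \<times> {Pos} \<union> E_neg A \<xi> \<times> {Neg}"

lemma generators_subset: "generators \<xi> \<subseteq> E \<times> UNIV"
  by (auto simp: generators_def E_pos_def E_neg_def)

lemma vertex_cone_generators:
  "vertex_cone A \<xi> = convex_cone hull ((\<lambda>x. single x 1) ` generators \<xi> \<union> Lam_real A)"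
proof -
  have "(\<lambda>e. single (e, Pos) (1::real)) ` E_pos A \<xi> \<union> (\<lambda>e. single (e, Neg) 1) ` E_neg A \<xi>
     = (\<lambda>x. single x 1) ` generators \<xi>"
    by (auto simp: generators_def)
  then show ?thesis unfolding vertex_cone_def by simp
qed

lemma single_in_vertex_cone: "x \<in> generators \<xi> \<Longrightarrow> single x 1 \<in> vertex_cone A \<xi>"
  unfolding vertex_cone_generators by (rule hull_inc) auto

lemma Lam_real_subset_vertex_cone: "Lam_real A \<subseteq> vertex_cone A \<xi>"
  unfolding vertex_cone_generators by (rule order_trans[OF _ hull_subset]) simp

text \<open>The sums of this shape form a convex cone that contains the generators and Lambda_R, so
  they contain the hull.\<close>

lemma vertex_cone_decompose:
  assumes "v \<in> vertex_cone A \<xi>"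
  obtains l w where "v = l + w" "l \<in> Lam_real A" "keys w \<subseteq> generators \<xi>"
    "\<And>x. lookup w x \<ge> 0"
proof -
  let ?T = "{l + w | l w. l \<in> Lam_real A \<and> keys w \<subseteq> generators \<xi> \<and>
      (\<forall>x. lookup w x \<ge> (0::real))}"
  have sub: "subspace (Lam_real A)" unfolding Lam_real_def by (rule subspace_span)
  have "convex_cone ?T"
    unfolding convex_cone_iff
  proof (intro conjI ballI allI impI)
    show "0 \<in> ?T" using subspace_0[OF sub] by (auto intro!: exI[of _ 0])
    fix x y assume "x \<in> ?T" "y \<in> ?T"
    then obtain l w l' w' where *: "x = l + w" "y = l' + w'" "l \<in> Lam_real A" "l' \<in> Lam_real A"
      "keys w \<subseteq> generators \<xi>" "keys w' \<subseteq> generators \<xi>"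
      "\<forall>x. lookup w x \<ge> 0" "\<forall>x. lookup w' x \<ge> 0" by blast
    have "x + y = (l + l') + (w + w')" using * by simp
    moreover have "l + l' \<in> Lam_real A" using subspace_add[OF sub] * by blast
    moreover have "keys (w + w') \<subseteq> generators \<xi>" using keys_add[of w w'] * by blast
    moreover have "\<forall>x. lookup (w + w') x \<ge> 0" using * by (simp add: lookup_add)
    ultimately show "x + y \<in> ?T" by blast
  next
    fix x and c :: real assume "x \<in> ?T" "0 \<le> c"
    then obtain l w where *: "x = l + w" "l \<in> Lam_real A"
      "keys w \<subseteq> generators \<xi>" "\<forall>x. lookup w x \<ge> 0" by blast
    have "c *\<^sub>R x = c *\<^sub>R l + c *\<^sub>R w" using * by (simp add: scaleR_add_right)
    moreover have "c *\<^sub>R l \<in> Lam_real A" using subspace_scale[OF sub] * by blast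
    moreover have "keys (c *\<^sub>R w) \<subseteq> generators \<xi>" using * by (auto simp: in_keys_iff)
    moreover have "\<forall>x. lookup (c *\<^sub>R w) x \<ge> 0" using * \<open>0 \<le> c\<close> by simp
    ultimately show "c *\<^sub>R x \<in> ?T" by blast
  qed
  moreover have "single x 1 \<in> ?T" if "x \<in> generators \<xi>" for x
    using that subspace_0[OF sub]
    by (intro CollectI exI[of _ 0] exI[of _ "single x 1"]) (auto simp: lookup_single when_def)
  moreover have "l \<in> ?T" if "l \<in> Lam_real A" for l
    using that by (intro CollectI exI[of _ l] exI[of _ 0]) auto
  ultimately have "vertex_cone A \<xi> \<subseteq> ?T"
    unfolding vertex_cone_generators by (intro hull_minimal) auto
  then show thesis using assms that by blast
qed

text \<open>The cone of a vertex has full dimension. A functional that kills it also kills the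
  relations, so its differences between \<open>Pos\<close> and \<open>Neg\<close> come from some
  \<open>m\<close>. At hyperplanes through \<xi> both generators are present, so \<open>m\<close>
  vanishes on their normals and is 0. As every index has a generator of at least one sign, all
  values are 0.\<close>

lemma span_vertex_cone:
  assumes \<xi>: "\<xi> \<in> vertices A" and x: "x \<in> E \<times> UNIV"
  shows "single x 1 \<in> span (vertex_cone A \<xi>)"
proof (rule ccontr)
  assume "\<not> ?thesis"
  then obtain f :: "_ \<Rightarrow> real" where f: "linear f" "\<And>v. v \<in> span (vertex_cone A \<xi>) \<Longrightarrow> f v = 0"
    "f (single x 1) = 1"
    using exists_separating_functional by blast
  let ?s = "\<lambda>x. f (single x 1)"
  have gen: "?s y = 0" if "y \<in> generators \<xi>" for y
    using f(2) single_in_vertex_cone[OF that] span_base by blast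
  have "(\<Sum>e\<in>E. real_of_int (lookup c e) * (?s (e, Pos) - ?s (e, Neg))) = 0"
    if "c \<in> relations A" for c
  proof -
    have "relation_vec A c \<in> span (vertex_cone A \<xi>)"
      using that Lam_real_subset_vertex_cone span_base unfolding Lam_real_def by blast
    then have "0 = f (relation_vec A c)" using f(2) by simp
    also have "\<dots> = (\<Sum>e\<in>E. real_of_int (lookup c e) * (?s (e, Pos) - ?s (e, Neg)))"
      unfolding relation_vec_def using f(1) by (simp add: linear_sum linear_scale linear_diff)
    finally show ?thesis by simp
  qed
  then obtain m where m: "m \<in> coord_space d" "\<And>e. e \<in> E \<Longrightarrow> ?s (e, Pos) - ?s (e, Neg) = slope A e m"
    using functional_from_slope[of "\<lambda>e. ?s (e, Pos) - ?s (e, Neg)"] by blast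
  have "slope A e m = 0" if "e \<in> E" "aff A e \<xi> = 0" for e
    using m(2)[OF that(1)] gen[of "(e, Pos)"] gen[of "(e, Neg)"] that
    by (simp add: generators_def E_pos_def E_neg_def)
  then have "m = (\<lambda>_. 0)" using vertex_slope_eq_0_imp[OF \<xi> m(1)] by blast
  then have eq: "?s (e, Pos) = ?s (e, Neg)" if "e \<in> E" for e
    using m(2)[OF that] by (simp add: slope_def)
  obtain e s where es: "x = (e, s)" "e \<in> E" using x by auto
  have "?s (e, Pos) = 0 \<or> ?s (e, Neg) = 0"
    using gen[of "(e, Pos)"] gen[of "(e, Neg)"] es(2)
    by (cases "aff A e \<xi> \<le> 0") (auto simp: generators_def E_pos_def E_neg_def)
  then show False using eq[OF es(2)] f(3) es by (cases s) auto
qed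

lemma in_span_singles:
  fixes v :: "'x \<Rightarrow>\<^sub>0 real"
  assumes "keys v \<subseteq> Y"
  shows "v \<in> span ((\<lambda>x. single x 1) ` Y)"
proof -
  have "v = (\<Sum>x\<in>keys v. lookup v x *\<^sub>R single x 1)"
    by (rule poly_mapping_eqI)
      (simp add: lookup_sum lookup_single when_def if_distrib[of "(*) _"] in_keys_iff cong: if_cong)
  also have "\<dots> \<in> span ((\<lambda>x. single x 1) ` Y)"
    by (intro span_sum span_scale span_base) (use assms in auto)
  finally show ?thesis .
qed

lemma span_singles_keys:
  fixes v :: "'x \<Rightarrow>\<^sub>0 real"
  assumes "v \<in> span ((\<lambda>x. single x 1) ` Y)"
  shows "keys v \<subseteq> Y"
proof -
  have "subspace {v :: 'x \<Rightarrow>\<^sub>0 real. \<forall>x. x \<notin> Y \<longrightarrow> lookup v x = 0}"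
    by (rule subspaceI) (simp_all add: lookup_add)
  moreover have "(\<lambda>x. single x 1) ` Y \<subseteq> {v :: 'x \<Rightarrow>\<^sub>0 real. \<forall>x. x \<notin> Y \<longrightarrow> lookup v x = 0}"
    by (auto simp: lookup_single when_def)
  ultimately have "v \<in> {v. \<forall>x. x \<notin> Y \<longrightarrow> lookup v x = 0}"
    using assms by (metis (no_types, lifting) span_minimal subsetD)
  then show ?thesis by (auto simp: in_keys_iff)
qed

text \<open>A basis of Lambda_R together with the unit vectors at \<open>coords B\<close> is
  independent, and by \<open>span_vertex_cone\<close> it lies in the span of the cone.\<close>

lemma card_coords_le_cone_dim:
  assumes B: "is_basis B" and \<xi>: "\<xi> \<in> vertices A"
  shows "card (coords B) \<le> cone_dim A (vertex_cone A \<xi>)"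
proof -
  let ?C = "vertex_cone A \<xi>" and ?s = "\<lambda>x :: 'e \<times> sign. single x (1::real)"
  let ?U = "?s ` (E \<times> UNIV)"
  have "finite ?U" by simp
  obtain D where D: "D \<subseteq> Lam_real A" "independent D" "Lam_real A \<subseteq> span D" "card D = dim (Lam_real A)"
    using basis_exists[of "Lam_real A"] by blast
  have span_D: "span D = Lam_real A"
    using D(3) span_mono[OF D(1)] unfolding Lam_real_def span_span by (rule subset_antisym[rotated])
  have "D \<subseteq> span ?U"
  proof
    fix v assume "v \<in> D"
    then have "v \<in> Lam_real A" using D(1) by blast
    then show "v \<in> span ?U" by (intro in_span_singles Lam_realD(1))
  qed
  then have "finite D" using independent_span_bound[OF \<open>finite ?U\<close> D(2)] by blast
  have "independent (D \<union> ?s ` J) \<and> card (D \<union> ?s ` J) = card D + card J" if "finite J" "J \<subseteq> coords B" for J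
    using that
  proof (induction J)
    case empty
    then show ?case using D by simp
  next
    case (insert j J)
    have notin: "?s j \<notin> span (D \<union> ?s ` J)"
    proof
      assume "?s j \<in> span (D \<union> ?s ` J)"
      then obtain l w where lw: "?s j = l + w" "l \<in> Lam_real A" "w \<in> span (?s ` J)"
        unfolding span_Un span_D by auto
      have kw: "keys w \<subseteq> J" by (rule span_singles_keys[OF lw(3)])
      have l: "l = ?s j - w" using lw(1) by simp
      \<comment> \<open>As \<open>?s j\<close> and \<open>w\<close> are supported on
        \<open>coords B\<close>, the \<open>Pos\<close> part of \<open>l\<close> is a linear
        relation among the normals of \<open>B\<close> alone, hence zero.\<close>
      have "lookup l (e, Pos) = 0" for e
      proof (rule basis_independent[OF B])
        fix e assume "e \<notin> B"
        then have "(e, Pos) \<notin> coords B" by (simp add: coords_def)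
        then have "(e, Pos) \<noteq> j" "(e, Pos) \<notin> keys w" using insert.prems kw by auto
        then show "lookup l (e, Pos) = 0"
          by (simp add: l lookup_minus lookup_single in_keys_iff when_def)
      qed (rule Lam_realD(3)[OF lw(2)])
      moreover from this have "lookup l (e, Neg) = 0" for e
        using Lam_realD(2)[OF lw(2), of e] by simp
      ultimately have "lookup l (e, s) = 0" for e s by (cases s) auto
      then have "l = 0" by (intro poly_mapping_eqI) auto
      then have "lookup w j = 1" using lw(1) by (metis add_0 lookup_single_eq)
      then have "j \<in> keys w" by (simp add: in_keys_iff)
      then show False using kw insert.hyps by blast
    qed
    have IH: "independent (D \<union> ?s ` J)" "card (D \<union> ?s ` J) = card D + card J"
      using insert.IH insert.prems by auto
    have "independent (insert (?s j) (D \<union> ?s ` J))"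
      by (rule independent_insertI[OF notin IH(1)])
    moreover have "?s j \<notin> D \<union> ?s ` J" using notin span_base[of "?s j" "D \<union> ?s ` J"] by blast
    ultimately show ?case using IH(2) insert.hyps \<open>finite D\<close> by (simp add: card_insert_if)
  qed
  from this[OF finite_coords[OF B] order_refl]
  have ind: "independent (D \<union> ?s ` coords B)" and card: "card (D \<union> ?s ` coords B) = card D + card (coords B)"
    by auto
  have "?C \<subseteq> span ?U"
  proof
    fix v assume "v \<in> ?C"
    then obtain l w where *: "v = l + w" "l \<in> Lam_real A" "keys w \<subseteq> generators \<xi>"
      using vertex_cone_decompose by blast
    then have "keys v \<subseteq> E \<times> UNIV"
      using keys_add[of l w] Lam_realD(1) generators_subset[of \<xi>] by blast
    then show "v \<in> span ?U" by (rule in_span_singles)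
  qed
  obtain F where F: "F \<subseteq> ?C" "independent F" "?C \<subseteq> span F" "card F = dim ?C"
    using basis_exists[of ?C] by blast
  have "finite F" using independent_span_bound[OF \<open>finite ?U\<close> F(2)] F(1) \<open>?C \<subseteq> span ?U\<close> by blast
  have "D \<subseteq> span F" using D(1) F(3) Lam_real_subset_vertex_cone by blast
  moreover have "span ?C \<subseteq> span F" using span_mono[OF F(3)] by (simp only: span_span)
  then have "?s ` coords B \<subseteq> span F"
    using span_vertex_cone[OF \<xi>] coords_subset[OF B] by blast
  ultimately have "card (D \<union> ?s ` coords B) \<le> card F"
    using independent_span_bound[OF \<open>finite F\<close> ind] by blast
  then show ?thesis using card D(4) F(4) unfolding cone_dim_def by linarith
qed

text \<open>The sum of all coordinates is positive on the generators and vanishes on \<open>\<Lambda>\<close>.\<close>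

lemma Lam_real_face_of_vertex_cone: "Lam_real A face_of vertex_cone A \<xi>"
  unfolding face_of_def
proof (intro conjI ballI impI)
  have sub: "subspace (Lam_real A)" unfolding Lam_real_def by (rule subspace_span)
  show "convex (Lam_real A)" by (rule subspace_imp_convex[OF sub])
  show "Lam_real A \<subseteq> vertex_cone A \<xi>" by (rule Lam_real_subset_vertex_cone)
  fix a b x assume a: "a \<in> vertex_cone A \<xi>" and b: "b \<in> vertex_cone A \<xi>" and x: "x \<in> Lam_real A"
    and seg: "x \<in> open_segment a b"
  define S where "S v = (\<Sum>x\<in>E \<times> UNIV. lookup v x)" for v :: "'e \<times> sign \<Rightarrow>\<^sub>0 real"
  have S_Lam: "S v = 0" if "v \<in> Lam_real A" for v
    unfolding S_def sum_sign using Lam_realD(2)[OF that] by simp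
  have S_add: "S (v + w) = S v + S w" for v w by (simp add: S_def lookup_add sum.distrib)
  have S_scale: "S (c *\<^sub>R v) = c * S v" for c v by (simp add: S_def sum_distrib_left)
  have S_nonneg: "S v \<ge> 0" and S_0: "S v = 0 \<Longrightarrow> v \<in> Lam_real A" if v: "v \<in> vertex_cone A \<xi>" for v
  proof -
    obtain l w where lw: "v = l + w" "l \<in> Lam_real A" "keys w \<subseteq> generators \<xi>"
      "\<And>x. lookup w x \<ge> 0" using vertex_cone_decompose[OF v] by blast
    have Sv: "S v = S w" using S_Lam[OF lw(2)] lw(1) by (simp add: S_add)
    then show "S v \<ge> 0" using lw(4) by (simp add: S_def sum_nonneg)
    assume "S v = 0"
    then have "\<forall>x\<in>E \<times> UNIV. lookup w x = 0"
      using Sv lw(4) sum_nonneg_eq_0_iff[OF finite_EU, of "lookup w"] by (simp add: S_def)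
    then have "w = 0"
      using lw(3) generators_subset[of \<xi>] by (metis in_keys_iff keys_eq_empty subset_empty subset_eq)
    then show "v \<in> Lam_real A" using lw by simp
  qed
  obtain t where t: "0 < t" "t < 1" "x = (1 - t) *\<^sub>R a + t *\<^sub>R b"
    using seg by (auto simp: in_segment)
  have "0 = (1 - t) * S a + t * S b" using S_Lam[OF x] t(3) by (simp add: S_add S_scale)
  moreover have "(1 - t) * S a \<ge> 0" "t * S b \<ge> 0" using t S_nonneg a b by auto
  ultimately have "(1 - t) * S a = 0" "t * S b = 0" by linarith+
  then have "S a = 0" "S b = 0" using t by auto
  then show "a \<in> Lam_real A" "b \<in> Lam_real A" using S_0 a b by auto
qed

text \<open>This is the cone 0 of the quotient space, so its orbit is the dense torus.\<close>

lemma Lam_real_in_fan: "Lam_real A \<in> lawrence_fan A"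
proof -
  have "Lam_real A \<noteq> {}" unfolding Lam_real_def using span_0 by blast
  then show ?thesis
    using vertex_exists Lam_real_face_of_vertex_cone unfolding lawrence_fan_def by blast
qed

lemma vertex_cone_in_fan: "\<xi> \<in> vertices A \<Longrightarrow> vertex_cone A \<xi> \<in> lawrence_fan A"
  unfolding lawrence_fan_def
  by (auto simp: vertex_cone_generators convex_cone_hull_nonempty
      intro!: bexI[of _ \<xi>] face_of_refl convex_convex_cone_hull)

lemma dual_monoid_Lam_real: "dual_monoid A (Lam_real A) = M_tilde A"
  and perp_lattice_Lam_real: "perp_lattice A (Lam_real A) = M_tilde A"
  unfolding dual_monoid_def perp_lattice_def using pairing_Lam_real by auto

text \<open>The unit vectors of all coordinates lie in the span of the cone, so each entry of
  \<open>u\<close> is its pairing with a vector that it kills.\<close>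

lemma perp_lattice_vertex_cone:
  assumes "\<xi> \<in> vertices A" "u \<in> perp_lattice A (vertex_cone A \<xi>)"
  shows "u = 0"
proof (rule poly_mapping_eqI)
  fix x
  have u: "u \<in> M_tilde A" "\<And>v. v \<in> vertex_cone A \<xi> \<Longrightarrow> pairing u v = 0"
    using assms(2) by (auto simp: perp_lattice_def)
  show "lookup u x = lookup 0 x"
  proof (cases "x \<in> E \<times> UNIV")
    case True
    have "pairing u (single x 1) = 0"
      using linear_eq_0_on_span[OF linear_pairing u(2) span_vertex_cone[OF assms(1) True]] .
    then show ?thesis by (simp add: pairing_single)
  next
    case False
    then show ?thesis using u(1) by (auto simp: M_tilde_def in_keys_iff)
  qed
qed

section \<open>The characters pulled back from affine space\<close>

abbreviation phi_exp :: "'e \<Rightarrow> ('e \<times> sign \<Rightarrow>\<^sub>0 int)" where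
  "phi_exp e \<equiv> single (e, Pos) 1 + single (e, Neg) 1"

lemma phi_exp_nonzero: "phi_exp e \<noteq> 0"
proof
  assume "phi_exp e = 0"
  then have "lookup (phi_exp e) (e, Pos) = 0" by simp
  then show False by (simp add: lookup_add lookup_single)
qed

lemma inj_phi_exp: "inj phi_exp"
proof
  fix e f assume "phi_exp e = phi_exp f"
  then have "lookup (phi_exp e) (e, Pos) = lookup (phi_exp f) (e, Pos)" by simp
  then show "e = f" by (auto simp: lookup_add lookup_single when_def split: if_splits)
qed

lemma pairing_phi_exp: "pairing (phi_exp e) v = lookup v (e, Pos) + lookup v (e, Neg)"
proof -
  have "pairing (phi_exp e) v = (\<Sum>x\<in>{(e, Pos), (e, Neg)}. real_of_int (lookup (phi_exp e) x) * lookup v x)"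
    by (rule pairing_superset) (auto simp: in_keys_iff lookup_add lookup_single when_def split: if_splits)
  then show ?thesis by (simp add: lookup_add lookup_single when_def)
qed

lemma phi_exp_M_tilde: "e \<in> E \<Longrightarrow> phi_exp e \<in> M_tilde A"
  unfolding M_tilde_def
  by (auto simp: pairing_phi_exp lookup_relation_vec in_keys_iff lookup_add lookup_single when_def split: if_splits)

text \<open>The two opposite entries of a vector of Lambda_R cancel in the pairing, and the other
  summand has nonnegative entries.\<close>

lemma phi_exp_dual_monoid: "e \<in> E \<Longrightarrow> phi_exp e \<in> dual_monoid A (vertex_cone A \<xi>)"
  unfolding dual_monoid_def
proof (intro CollectI conjI ballI)
  fix v assume "v \<in> vertex_cone A \<xi>"
  then obtain l w where lw: "v = l + w" "l \<in> Lam_real A" "\<And>x. lookup w x \<ge> 0"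
    using vertex_cone_decompose by metis
  then show "pairing (phi_exp e) v \<ge> 0"
    using Lam_realD(2)[OF lw(2), of e] by (simp add: pairing_phi_exp lookup_add)
qed (rule phi_exp_M_tilde)

end

section \<open>Improper intersection with an orbit\<close>

lemma add_submonoid_dual_monoid: "add_submonoid (dual_monoid A \<sigma>)"
  unfolding add_submonoid_def
proof (intro conjI ballI)
  show "0 \<in> dual_monoid A \<sigma>"
    by (simp add: dual_monoid_def M_tilde_def pairing_def)
  fix x y assume "x \<in> dual_monoid A \<sigma>" "y \<in> dual_monoid A \<sigma>"
  then show "x + y \<in> dual_monoid A \<sigma>"
    using keys_add[of x y] by (auto simp: dual_monoid_def M_tilde_def pairing_add)
qed

text \<open>The nonvanishing locus of 1 on the chart where a point is listed is a basic open set
  containing the point.\<close>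

lemma topspace_zariski:
  assumes "\<And>x. x \<in> pts X \<Longrightarrow> fst x \<in> charts X \<and> sub X (fst x) (fst x) \<and> 0 \<in> mon X (fst x) \<and> 1 \<notin> snd x"
  shows "topspace (zariski X) = pts X"
proof
  show "topspace (zariski X) \<subseteq> pts X"
    by (auto simp: zariski_def chart_open_def)
  show "pts X \<subseteq> topspace (zariski X)"
  proof
    fix x assume x: "x \<in> pts X"
    have "{y \<in> chart_open X (fst x). 1 \<notin> snd y} \<in> {{x \<in> chart_open X i. f \<notin> snd x} | i f.
        i \<in> charts X \<and> f \<in> carrier (monoid_algebra (mon X i))}"
      using assms[OF x] by (force simp: carrier_monoid_algebra)
    moreover have "x \<in> {y \<in> chart_open X (fst x). 1 \<notin> snd y}"
      using x assms[OF x] by (simp add: chart_open_def)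
    ultimately show "x \<in> topspace (zariski X)"
      unfolding zariski_def topology_generated_by_topspace by blast
  qed
qed

lemma fan_convex: "\<sigma> \<in> lawrence_fan A \<Longrightarrow> convex \<sigma>"
  by (auto simp: lawrence_fan_def face_of_imp_convex)

lemma hypertoric_atlas_simps [simp]:
  "charts (hypertoric_atlas A) = lawrence_fan A"
  "sub (hypertoric_atlas A) = (face_of)"
  "mon (hypertoric_atlas A) = dual_monoid A"
  "van (hypertoric_atlas A) = hypertoric_ideal A"
  by (simp_all add: hypertoric_atlas_def closed_subatlas_def lawrence_atlas_def)

lemma pts_hypertoric_atlas:
  "(\<sigma>, q) \<in> pts (hypertoric_atlas A) \<longleftrightarrow> \<sigma> \<in> lawrence_fan A \<and>
     primeideal q (monoid_algebra (dual_monoid A \<sigma>)) \<and>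
     (\<forall>u \<in> dual_monoid A \<sigma> - perp_lattice A \<sigma>. monomial u \<in> q) \<and> hypertoric_ideal A \<sigma> \<subseteq> q"
  by (auto simp: hypertoric_atlas_def closed_subatlas_def lawrence_atlas_def)

lemma topo_hypertoric: "topo (hypertoric A) = zariski (hypertoric_atlas A)"
  by (simp add: scheme_of_def)

lemma topspace_hypertoric: "topspace (topo (hypertoric A)) = pts (hypertoric_atlas A)"
  unfolding topo_hypertoric
proof (rule topspace_zariski)
  fix x :: "(('a \<times> sign) \<Rightarrow>\<^sub>0 real) set \<times> ((('a \<times> sign) \<Rightarrow>\<^sub>0 int) \<Rightarrow>\<^sub>0 'b) set"
  assume x: "x \<in> pts (hypertoric_atlas A)"
  obtain \<sigma> q where xq: "x = (\<sigma>, q)" by (cases x)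
  show "fst x \<in> charts (hypertoric_atlas A :: (_, _, 'b) atlas) \<and> sub (hypertoric_atlas A :: (_, _, 'b) atlas) (fst x) (fst x) \<and>
      0 \<in> mon (hypertoric_atlas A :: (_, _, 'b) atlas) (fst x) \<and> 1 \<notin> snd x"
    using x add_submonoid_dual_monoid[of A \<sigma>] primeideal_monoid_algebraD(2)
    by (auto simp: xq pts_hypertoric_atlas add_submonoid_def fan_convex face_of_refl)
qed

lemma hypertoric_subset_orbit_iff:
  "(\<sigma>, q) \<in> topspace (topo (hypertoric A)) \<inter> orbit A \<tau> \<longleftrightarrow> \<sigma> = \<tau> \<and> (\<sigma>, q) \<in> pts (hypertoric_atlas A)"
  unfolding topspace_hypertoric unfolding orbit_def hypertoric_atlas_def closed_subatlas_def by auto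

lemma of_int_mult_monomial:
  "of_int k * monomial u = single u (of_int k :: 'k::field)"
proof -
  have "(of_int k :: _ \<Rightarrow>\<^sub>0 'k) * monomial u = single 0 (of_int k) * monomial u"
    by (simp only: single_of_int)
  also have "\<dots> = single (0 + u) (of_int k * 1)" by (rule mult_single)
  finally show ?thesis by simp
qed

text \<open>If all entries vanish in the field, its characteristic divides \<open>v\<close>, and the
  characteristic is never 1. In characteristic 0 the same argument writes \<open>v\<close> as 0
  times a vector, which primitivity excludes as well.\<close>

lemma primitive_vector_not_zero_in_field:
  assumes "primitive_vector n v"
  shows "\<exists>i<n. (of_int (v i) :: 'k::field) \<noteq> 0"
proof (rule ccontr)
  assume *: "\<not> ?thesis"
  have v: "v \<in> coord_space n" using assms by (simp add: primitive_vector_def)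
  let ?p = "int (CHAR('k))"
  have dvd: "?p dvd v i" for i
    using * v by (cases "i < n") (auto simp: of_int_eq_0_iff_char_dvd coord_space_def not_less)
  have "v = (\<lambda>i. ?p * (v i div ?p))" using dvd by simp
  moreover have "(\<lambda>i. v i div ?p) \<in> coord_space n" using v by (simp add: coord_space_def)
  moreover have "\<forall>k. \<forall>w\<in>coord_space n. v = (\<lambda>i. k * w i) \<longrightarrow> \<bar>k\<bar> = 1"
    using assms by (simp add: primitive_vector_def)
  ultimately have "\<bar>?p\<bar> = 1" by (elim allE[of _ ?p]) (drule (1) bspec, erule (1) mp)
  then show False using CHAR_not_1[where 'a = 'k] by simp
qed

section \<open>The linear equations over the field\<close>

context spanning_arrangement
begin

definition relation_form :: "('e \<Rightarrow>\<^sub>0 int) \<Rightarrow> (('e \<times> sign \<Rightarrow>\<^sub>0 int) \<Rightarrow>\<^sub>0 'k::field)" where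
  "relation_form c = (\<Sum>e\<in>E. of_int (lookup c e) * Phi_pullback e)"

lemma hypertoric_ideal_relation_form:
  "hypertoric_ideal A \<sigma> = genideal (monoid_algebra (dual_monoid A \<sigma>)) (relation_form ` relations A)"
  unfolding hypertoric_ideal_def relation_form_def by (simp add: image_def Setcompr_eq_image)

lemma relation_form_single:
  "relation_form c = (\<Sum>e\<in>E. single (phi_exp e) (of_int (lookup c e) :: 'k::field))"
  unfolding relation_form_def Phi_pullback_def of_int_mult_monomial ..

lemma keys_relation_form: "keys (relation_form c :: _ \<Rightarrow>\<^sub>0 'k::field) \<subseteq> phi_exp ` E"
  unfolding relation_form_single by (rule keys_sum_subset) auto

lemma lookup_relation_form:
  assumes "e \<in> E"
  shows "lookup (relation_form c) (phi_exp e) = (of_int (lookup c e) :: 'k::field)"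
proof -
  have "lookup (relation_form c) (phi_exp e)
     = (\<Sum>f\<in>E. if f = e then of_int (lookup c f) else (0 :: 'k))"
    unfolding relation_form_single lookup_sum
    by (rule sum.cong) (auto simp: lookup_single when_def dest: injD[OF inj_phi_exp])
  then show ?thesis using assms by simp
qed

text \<open>If all coefficients of a relation vanish in the field, they are divisible by its
  characteristic, and the quotient is again a relation because N is torsion-free. Dividing decreases
  the sum of the absolute values.\<close>

lemma nonzero_relation_in_field:
  assumes "c \<in> relations A" "c \<noteq> 0"
  shows "\<exists>c'\<in>relations A. (relation_form c' :: _ \<Rightarrow>\<^sub>0 'k::field) \<noteq> 0"
  using assms
proof (induction "nat (\<Sum>e\<in>E. \<bar>lookup c e\<bar>)" arbitrary: c rule: less_induct)
  case less
  let ?p = "int (CHAR('k))"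
  show ?case
  proof (cases "\<forall>e\<in>E. (of_int (lookup c e) :: 'k) = 0")
    case False
    then obtain e where "e \<in> E" "(of_int (lookup c e) :: 'k) \<noteq> 0" by blast
    then have "(relation_form c :: _ \<Rightarrow>\<^sub>0 'k) \<noteq> 0" using lookup_relation_form[of e c, where 'k = 'k] by auto
    then show ?thesis using less.prems by blast
  next
    case True
    then have dvd: "?p dvd lookup c e" if "e \<in> E" for e
      using that by (simp add: of_int_eq_0_iff_char_dvd)
    define c' where "c' = poly_mapping_on E (\<lambda>e. lookup c e div ?p)"
    have c': "lookup c e = ?p * lookup c' e" if "e \<in> E" for e
      using dvd[OF that] that by (simp add: c'_def lookup_poly_mapping_on)
    have keys_c: "keys c \<subseteq> E" using less.prems by (simp add: relations_def)
    obtain e0 where e0: "e0 \<in> keys c" using less.prems(2) by (metis all_not_in_conv keys_eq_empty)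
    have e0E: "e0 \<in> E" using keys_c e0 by blast
    have nz: "?p * lookup c' e0 \<noteq> 0" using c'[OF e0E] e0 by (simp add: in_keys_iff)
    then have "c' \<noteq> 0" and "?p \<noteq> 0" by auto
    moreover have "?p \<noteq> 1" using CHAR_not_1[where 'a = 'k] by simp
    ultimately have p2: "?p \<ge> 2" by linarith
    have "(\<Sum>e\<in>E. lookup c' e * normal A e i) = 0" for i
    proof -
      have "(\<Sum>e\<in>E. lookup c e * normal A e i) = 0"
        using less.prems by (simp add: relations_def)
      also have "(\<Sum>e\<in>E. lookup c e * normal A e i)
         = ?p * (\<Sum>e\<in>E. lookup c' e * normal A e i)"
        by (simp add: c' sum_distrib_left mult.assoc)
      finally show ?thesis using \<open>?p \<noteq> 0\<close> by simp
    qed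
    then have "c' \<in> relations A"
      by (simp add: relations_def c'_def keys_poly_mapping_on)
    moreover have "(\<Sum>e\<in>E. \<bar>lookup c e\<bar>) = ?p * (\<Sum>e\<in>E. \<bar>lookup c' e\<bar>)"
      by (simp add: c' sum_distrib_left abs_mult)
    moreover have "(\<Sum>e\<in>E. \<bar>lookup c' e\<bar>) > 0"
      using nz e0E by (intro sum_pos2[of _ e0]) auto
    ultimately show ?thesis
      using less.hyps[of c'] \<open>c' \<noteq> 0\<close> p2 mult_strict_right_mono[of 1 ?p "\<Sum>e\<in>E. \<bar>lookup c' e\<bar>"]
      by (simp add: zless_nat_conj)
  qed
qed

lemma keys_relation_form_subset:
  assumes "\<And>e. e \<in> E \<Longrightarrow> phi_exp e \<in> S"
  shows "keys (relation_form c :: _ \<Rightarrow>\<^sub>0 'k::field) \<subseteq> S"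
  using keys_relation_form[of c, where 'k = 'k] assms by blast

subsection \<open>The fixed point of a vertex\<close>

text \<open>The functions without constant term; as the monoid of a vertex cone is pointed, they
  form the maximal ideal of the point fixed by the torus.\<close>

definition vertex_ideal :: "(nat \<Rightarrow> real) \<Rightarrow> (('e \<times> sign \<Rightarrow>\<^sub>0 int) \<Rightarrow>\<^sub>0 'k::field) set" where
  "vertex_ideal \<xi> = {f. keys f \<subseteq> dual_monoid A (vertex_cone A \<xi>) - {0}}"

text \<open>Both \<open>u\<close> and its negative are nonnegative on the cone, so \<open>u\<close>
  vanishes on it, and the cone has full dimension.\<close>

lemma dual_monoid_vertex_pointed:
  assumes "\<xi> \<in> vertices A" "u \<in> dual_monoid A (vertex_cone A \<xi>)" "v \<in> dual_monoid A (vertex_cone A \<xi>)"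
    "u + v = 0"
  shows "u = 0"
proof (rule perp_lattice_vertex_cone[OF assms(1)])
  have "pairing u w = 0" if "w \<in> vertex_cone A \<xi>" for w
  proof -
    have "pairing (u + v) w = 0" unfolding assms(4) by (simp add: pairing_def)
    then have "pairing u w + pairing v w = 0" by (simp only: pairing_add)
    moreover have "pairing u w \<ge> 0" "pairing v w \<ge> 0" using assms(2,3) that by (auto simp: dual_monoid_def)
    ultimately show ?thesis by linarith
  qed
  then show "u \<in> perp_lattice A (vertex_cone A \<xi>)"
    using assms(2) by (auto simp: perp_lattice_def dual_monoid_def)
qed

lemma split_constant_term:
  assumes "keys f \<subseteq> dual_monoid A (vertex_cone A \<xi>)"
  obtains f' where "f = single 0 (lookup f 0) + f'" "f' \<in> vertex_ideal \<xi>"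
proof
  let ?f = "f - single 0 (lookup f 0)"
  show "f = single 0 (lookup f 0) + ?f" by simp
  show "?f \<in> vertex_ideal \<xi>"
    using assms by (auto simp: vertex_ideal_def in_keys_iff lookup_minus lookup_single when_def split: if_splits)
qed

lemma vertex_ideal_mult:
  assumes "\<xi> \<in> vertices A" "f \<in> vertex_ideal \<xi>" "keys g \<subseteq> dual_monoid A (vertex_cone A \<xi>)"
  shows "g * f \<in> vertex_ideal \<xi>"
  unfolding vertex_ideal_def
proof (intro CollectI subsetI)
  fix u assume "u \<in> keys (g * f)"
  then obtain a b where ab: "u = a + b" "a \<in> keys g" "b \<in> keys f"
    using keys_mult[of g f] by blast
  let ?S = "dual_monoid A (vertex_cone A \<xi>)"
  have "a \<in> ?S" "b \<in> ?S" "b \<noteq> 0" using ab assms by (auto simp: vertex_ideal_def)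
  moreover have "a + b \<noteq> 0"
    using dual_monoid_vertex_pointed[OF assms(1), of b a] calculation by (metis add.commute)
  ultimately show "u \<in> ?S - {0}"
    using add_submonoid_dual_monoid[of A "vertex_cone A \<xi>"] ab by (simp add: add_submonoid_def)
qed

lemma primeideal_vertex_ideal:
  assumes \<xi>: "\<xi> \<in> vertices A"
  shows "primeideal (vertex_ideal \<xi> :: (_ \<Rightarrow>\<^sub>0 'k::field) set) (monoid_algebra (dual_monoid A (vertex_cone A \<xi>)))"
proof (rule primeideal_monoid_algebraI[OF add_submonoid_dual_monoid])
  fix f g :: "('e \<times> sign \<Rightarrow>\<^sub>0 int) \<Rightarrow>\<^sub>0 'k"
  let ?S = "dual_monoid A (vertex_cone A \<xi>)"
  show add: "f + g \<in> vertex_ideal \<xi>" if "f \<in> vertex_ideal \<xi>" "g \<in> vertex_ideal \<xi>" for f g :: "_ \<Rightarrow>\<^sub>0 'k"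
    using that keys_add[of f g] by (auto simp: vertex_ideal_def)
  show "g * f \<in> vertex_ideal \<xi>" if "f \<in> vertex_ideal \<xi>" "keys g \<subseteq> ?S"
    by (rule vertex_ideal_mult[OF \<xi> that])
  assume f: "keys f \<subseteq> ?S" and g: "keys g \<subseteq> ?S" and fg: "f * g \<in> vertex_ideal \<xi>"
  obtain f' where f': "f = single 0 (lookup f 0) + f'" "f' \<in> vertex_ideal \<xi>"
    using split_constant_term[OF f] by blast
  obtain g' where g': "g = single 0 (lookup g 0) + g'" "g' \<in> vertex_ideal \<xi>"
    using split_constant_term[OF g] by blast
  have lk: "lookup h 0 = 0" if "h \<in> vertex_ideal \<xi>" for h :: "_ \<Rightarrow>\<^sub>0 'k"
    using that by (auto simp: vertex_ideal_def in_keys_iff)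
  let ?r = "single 0 (lookup f 0) * g' + g * f'"
  have "f * g = single 0 (lookup f 0 * lookup g 0) + ?r"
    using f'(1) g'(1) by (metis (no_types, lifting) add.assoc add.left_neutral distrib_left distrib_right mult.commute mult_single)
  then have "lookup (f * g) 0
      = lookup f 0 * lookup g 0 + lookup ?r 0"
    by (simp only: lookup_add lookup_single_eq)
  moreover have "?r \<in> vertex_ideal \<xi>"
    by (intro add vertex_ideal_mult \<xi> f' g' g keys_single0_subset add_submonoid_dual_monoid)
  ultimately have "lookup f 0 * lookup g 0 = 0"
    using lk[OF fg] lk[of ?r] by simp
  then show "f \<in> vertex_ideal \<xi> \<or> g \<in> vertex_ideal \<xi>"
    using f' g' by (metis add.left_neutral mult_eq_0_iff single_zero)
qed (auto simp: vertex_ideal_def)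

text \<open>Only the exponent 0 is orthogonal to the cone, so a prime in this orbit contains all
  other monomials and thus \<open>vertex_ideal \<xi>\<close>; any further element would put a
  nonzero constant into it. The relation forms have no constant term, so this single point lies on
  the hypertoric variety.\<close>

lemma vertex_point:
  assumes \<xi>: "\<xi> \<in> vertices A"
  shows "topspace (topo (hypertoric A :: (_, _, 'k::field) k_space)) \<inter> orbit A (vertex_cone A \<xi>)
     = {(vertex_cone A \<xi>, vertex_ideal \<xi>)}"
proof -
  let ?C = "vertex_cone A \<xi>"
  let ?S = "dual_monoid A ?C"
  let ?I = "vertex_ideal \<xi> :: (_ \<Rightarrow>\<^sub>0 'k) set"
  have prime: "primeideal ?I (monoid_algebra ?S)" by (rule primeideal_vertex_ideal[OF \<xi>])
  have "relation_form ` relations A \<subseteq> ?I"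
  proof clarify
    fix c assume "c \<in> relations A"
    show "relation_form c \<in> ?I"
      unfolding vertex_ideal_def mem_Collect_eq
      by (rule keys_relation_form_subset) (use phi_exp_dual_monoid phi_exp_nonzero in blast)
  qed
  then have "hypertoric_ideal A ?C \<subseteq> ?I"
    unfolding hypertoric_ideal_relation_form genideal_subset_iff[OF primeideal_monoid_algebraD(1)[OF prime]] .
  moreover have "monomial u \<in> ?I" if "u \<in> ?S - perp_lattice A ?C" for u
  proof -
    have "0 \<in> perp_lattice A ?C"
      by (simp add: perp_lattice_def M_tilde_def pairing_def)
    then show ?thesis using that by (auto simp: vertex_ideal_def)
  qed
  ultimately have point: "(?C, ?I) \<in> pts (hypertoric_atlas A)"
    using prime vertex_cone_in_fan[OF \<xi>] by (simp add: pts_hypertoric_atlas)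
  have unique: "q = ?I" if "(?C, q) \<in> pts (hypertoric_atlas A)" for q
  proof -
    have q: "primeideal q (monoid_algebra ?S)" and mon: "\<And>u. u \<in> ?S - perp_lattice A ?C \<Longrightarrow> monomial u \<in> q"
      using that by (auto simp: pts_hypertoric_atlas)
    note id = primeideal_monoid_algebraD(1)[OF q]
    have sub: "?I \<subseteq> q"
    proof
      fix f assume f: "f \<in> ?I"
      have "(\<Sum>u\<in>U. single u (lookup f u)) \<in> q" if "finite U" "U \<subseteq> keys f" for U
        using that
      proof (induction U)
        case empty
        then show ?case using ideal_monoid_algebraD(2)[OF id] by simp
      next
        case (insert u U)
        have "u \<in> ?S - perp_lattice A ?C"
          using insert.prems f perp_lattice_vertex_cone[OF \<xi>] by (auto simp: vertex_ideal_def)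
        from ideal_monoid_algebraD(4)[OF id mon[OF this] keys_single0_subset[OF add_submonoid_dual_monoid]]
        have "single u (lookup f u) \<in> q"
          by (metis add_0 mult.right_neutral mult_single)
        then show ?case using insert ideal_monoid_algebraD(3)[OF id] by simp
      qed
      from this[OF finite_keys order_refl] show "f \<in> q" by (simp flip: poly_mapping_sum_single)
    qed
    moreover have "q \<subseteq> ?I"
    proof
      fix f assume f: "f \<in> q"
      obtain f' where f': "f = single 0 (lookup f 0) + f'" "f' \<in> ?I"
        using split_constant_term[OF ideal_monoid_algebraD(1)[OF id f]] by blast
      have "- f' \<in> ?I" using f'(2) by (auto simp: vertex_ideal_def in_keys_iff)
      then have "- f' \<in> q" using sub by blast
      then have "f + - f' \<in> q" using f ideal_monoid_algebraD(3)[OF id] by blast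
      then have "single 0 (lookup f 0) \<in> q"
        using f'(1) by (metis add_diff_cancel_right' diff_conv_add_uminus)
      from ideal_monoid_algebraD(4)[OF id this keys_single0_subset[OF add_submonoid_dual_monoid]]
      have "single 0 (inverse (lookup f 0) * lookup f 0) \<in> q"
        by (metis add_0 mult_single)
      then have "lookup f 0 = 0"
        using primeideal_monoid_algebraD(2)[OF q] by (cases "lookup f 0 = 0") auto
      then show "f \<in> ?I" using f' by (metis add_0 single_zero)
    qed
    ultimately show ?thesis by blast
  qed
  have "x \<in> topspace (topo (hypertoric A :: (_, _, 'k) k_space)) \<inter> orbit A ?C \<longleftrightarrow> x = (?C, ?I)" for x
  proof (cases x)
    case (Pair \<sigma> q)
    have "x \<in> topspace (topo (hypertoric A :: (_, _, 'k) k_space)) \<inter> orbit A ?C \<longleftrightarrow>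
        \<sigma> = ?C \<and> (\<sigma>, q) \<in> pts (hypertoric_atlas A)"
      unfolding Pair by (rule hypertoric_subset_orbit_iff)
    also have "\<dots> \<longleftrightarrow> x = (?C, ?I)" unfolding Pair using point unique[of q] by blast
    finally show ?thesis .
  qed
  then show ?thesis by blast
qed

subsection \<open>The dense torus\<close>

lemma torus_point_exists:
  "topspace (topo (hypertoric A :: (_, _, 'k::field) k_space)) \<inter> orbit A (Lam_real A) \<noteq> {}"
proof -
  text \<open>The point of the torus with coordinates \<open>x\<^sub>e = \<langle>(1, t, t\<^sup>2, \<dots>), a\<^sub>e\<rangle>\<close> over the field \<open>K(t)\<close>.\<close>
  define lin :: "'e \<Rightarrow> 'k poly fract" where
    "lin e = to_fract (\<Sum>i<d. monom (of_int (normal A e i)) i)" for e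
  \<comment> \<open>The \<open>Pos\<close> coordinates of the torus point are \<open>lin e\<close>
    and the \<open>Neg\<close> coordinates are 1, so \<open>phi_exp e\<close> takes the value
    \<open>lin e\<close>.\<close>
  define w :: "('e \<times> sign \<Rightarrow>\<^sub>0 int) \<Rightarrow> 'k poly fract" where
    "w u = (\<Prod>e\<in>E. lin e powi lookup u (e, Pos))" for u
  define s :: "'k \<Rightarrow> 'k poly fract" where "s c = to_fract [:c:]" for c
  have lin_nz: "lin e \<noteq> 0" if "e \<in> E" for e
  proof -
    obtain i where i: "i < d" "(of_int (normal A e i) :: 'k) \<noteq> 0"
      using primitive_vector_not_zero_in_field[of d "normal A e", where 'k = 'k] primitive_spanning \<open>e \<in> E\<close>
      unfolding primitive_spanning_def by blast
    have "coeff (\<Sum>i<d. monom (of_int (normal A e i) :: 'k) i) i = of_int (normal A e i)"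
      using i by (simp add: coeff_sum)
    then have "(\<Sum>i<d. monom (of_int (normal A e i) :: 'k) i) \<noteq> 0" using i(2) by auto
    then show ?thesis unfolding lin_def to_fract_eq_0_iff .
  qed
  interpret algebra_hom s w
  proof
    fix u v
    show "w (u + v) = w u * w v"
      unfolding w_def prod.distrib[symmetric]
      by (rule prod.cong) (use lin_nz in \<open>auto simp: lookup_add power_int_add\<close>)
  qed (simp_all add: s_def w_def flip: one_pCons to_fract_add to_fract_mult)
  let ?S = "M_tilde A"
  let ?q = "{f. keys f \<subseteq> ?S \<and> lin_ext s w f = 0}"
  have S: "add_submonoid ?S"
    using add_submonoid_dual_monoid[of A "Lam_real A"] by (simp add: dual_monoid_Lam_real)
  have prime: "primeideal ?q (monoid_algebra ?S)"
    by (rule primeideal_kernel[OF algebra_hom_axioms S])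
  have w_phi: "w (phi_exp e) = lin e" if "e \<in> E" for e
  proof -
    have "w (phi_exp e) = (\<Prod>f\<in>E. if f = e then lin f else 1)"
      unfolding w_def by (rule prod.cong) (auto simp: lookup_add lookup_single when_def)
    then show ?thesis using that by simp
  qed
  have "lin_ext s w (relation_form c) = 0" if c: "c \<in> relations A" for c
  proof -
    have "lin_ext s w (relation_form c) = (\<Sum>e\<in>E. s (of_int (lookup c e)) * lin e)"
      unfolding relation_form_single by (simp add: lin_ext_sum lin_ext_single w_phi)
    also have "\<dots> = (\<Sum>e\<in>E. to_fract (\<Sum>i<d. monom (of_int (lookup c e * normal A e i) :: 'k) i))"
    proof (rule sum.cong)
      fix e
      have "[:of_int (lookup c e) :: 'k:] * (\<Sum>i<d. monom (of_int (normal A e i)) i)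
          = (\<Sum>i<d. monom (of_int (lookup c e * normal A e i)) i)"
        by (simp add: sum_distrib_left smult_monom)
      then show "s (of_int (lookup c e)) * lin e
          = to_fract (\<Sum>i<d. monom (of_int (lookup c e * normal A e i)) i)"
        unfolding s_def lin_def to_fract_mult[symmetric] by (rule arg_cong)
    qed simp
    also have "\<dots> = to_fract (\<Sum>e\<in>E. \<Sum>i<d. monom (of_int (lookup c e * normal A e i) :: 'k) i)"
      by (simp only: to_fract_sum)
    also have "(\<Sum>e\<in>E. \<Sum>i<d. monom (of_int (lookup c e * normal A e i) :: 'k) i)
        = (\<Sum>i<d. monom (of_int (\<Sum>e\<in>E. lookup c e * normal A e i)) i)"
      by (subst sum.swap) (simp only: monom_sum of_int_sum)
    also have "\<dots> = 0" using c by (simp add: relations_def)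
    finally show ?thesis by simp
  qed
  then have "relation_form ` relations A \<subseteq> ?q"
    using keys_relation_form_subset phi_exp_M_tilde by blast
  then have "hypertoric_ideal A (Lam_real A) \<subseteq> ?q"
    unfolding hypertoric_ideal_relation_form dual_monoid_Lam_real
      genideal_subset_iff[OF primeideal_monoid_algebraD(1)[OF prime]] .
  then have "(Lam_real A, ?q) \<in> pts (hypertoric_atlas A)"
    using prime Lam_real_in_fan by (simp add: pts_hypertoric_atlas dual_monoid_Lam_real perp_lattice_Lam_real)
  then show ?thesis using hypertoric_subset_orbit_iff[of _ _ A "Lam_real A", where 'b = 'k] by blast
qed

text \<open>An instance of \<open>krull_dim_spectrum_less\<close>: on the zero cone the chart
  algebra is the group algebra of \<open>M_tilde A\<close>, and a relation form that is nonzero over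
  the field vanishes on the whole intersection.\<close>

lemma krull_dim_torus:
  assumes "c \<in> relations A" "c \<noteq> 0" and B: "is_basis B"
  shows "krull_dim (subtopology (topo (hypertoric A :: (_, _, 'k::field) k_space)) (orbit A (Lam_real A)))
     \<le> enat (card (coords B) - 1)"
proof -
  let ?L = "Lam_real A"
  let ?X = "hypertoric_atlas A :: (_, _, 'k) atlas"
  let ?T = "subtopology (topo (hypertoric A :: (_, _, 'k) k_space)) (orbit A ?L)"
  let ?S = "M_tilde A"
  have S: "add_submonoid ?S"
    using add_submonoid_dual_monoid[of A ?L] by (simp add: dual_monoid_Lam_real)
  obtain c' where c': "c' \<in> relations A" "(relation_form c' :: _ \<Rightarrow>\<^sub>0 'k) \<noteq> 0"
    using nonzero_relation_in_field[OF assms(1,2)] by blast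
  have top: "topspace ?T = topspace (topo (hypertoric A :: (_, _, 'k) k_space)) \<inter> orbit A ?L" by simp
  have mem: "fst x = ?L \<and> x \<in> pts ?X" if "x \<in> topspace ?T" for x
    using that unfolding top by (metis hypertoric_subset_orbit_iff prod.collapse)
  have mem': "fst x = ?L \<and> primeideal (snd x) (monoid_algebra ?S) \<and> hypertoric_ideal A ?L \<subseteq> snd x"
    if "x \<in> topspace ?T" for x
  proof -
    have "(?L, snd x) \<in> pts ?X" using mem[OF that] by (metis prod.collapse)
    then show ?thesis using mem[OF that] by (simp add: pts_hypertoric_atlas dual_monoid_Lam_real)
  qed
  have LL: "?L face_of ?L" by (intro face_of_refl fan_convex[OF Lam_real_in_fan])
  show ?thesis
  proof (rule krull_dim_spectrum_less[where S = ?S and Y = "E \<times> UNIV" and p = snd and g = "relation_form c'"])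
    fix x assume "x \<in> topspace ?T"
    then show "primeideal (snd x) (monoid_algebra ?S)" using mem' by blast
    have "relation_form ` relations A \<subseteq> (hypertoric_ideal A ?L :: (_ \<Rightarrow>\<^sub>0 'k) set)"
      unfolding hypertoric_ideal_relation_form by (auto simp: genideal_def)
    then show "relation_form c' \<in> snd x" using c' mem'[OF \<open>x \<in> topspace ?T\<close>] by blast
  next
    fix f :: "_ \<Rightarrow>\<^sub>0 'k" assume f: "keys f \<subseteq> ?S"
    let ?D = "{x \<in> chart_open ?X ?L. f \<notin> snd x}"
    have "openin (zariski ?X) ?D"
      unfolding zariski_def
      by (rule topology_generated_by_Basis, intro CollectI exI[of _ ?L] exI[of _ f])
        (use f Lam_real_in_fan in \<open>auto simp: carrier_monoid_algebra dual_monoid_Lam_real\<close>)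
    then have "openin ?T (?D \<inter> orbit A ?L)"
      unfolding openin_subtopology topo_hypertoric by blast
    moreover have "{x \<in> topspace ?T. f \<notin> snd x} = ?D \<inter> orbit A ?L"
    proof
      show "{x \<in> topspace ?T. f \<notin> snd x} \<subseteq> ?D \<inter> orbit A ?L"
      proof
        fix x assume x: "x \<in> {x \<in> topspace ?T. f \<notin> snd x}"
        then have "fst x = ?L" "x \<in> pts ?X" "x \<in> orbit A ?L" using mem[of x] top by blast+
        then show "x \<in> ?D \<inter> orbit A ?L" using x LL by (simp add: chart_open_def)
      qed
      show "?D \<inter> orbit A ?L \<subseteq> {x \<in> topspace ?T. f \<notin> snd x}"
        unfolding top topspace_hypertoric by (auto simp: chart_open_def)
    qed
    ultimately show "openin ?T {x \<in> topspace ?T. f \<notin> snd x}" by simp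
  next
    fix W y assume "openin ?T W" "y \<in> W"
    then obtain V where V: "openin (zariski ?X) V" "W = V \<inter> orbit A ?L"
      unfolding openin_subtopology topo_hypertoric by blast
    have y: "y \<in> topspace ?T" using openin_subset[OF \<open>openin ?T W\<close>] \<open>y \<in> W\<close> by blast
    have "generate_topology_on {{x \<in> chart_open ?X i. f \<notin> snd x} | i f.
        i \<in> charts ?X \<and> f \<in> carrier (monoid_algebra (mon ?X i))} V"
      using V(1) unfolding zariski_def by (rule openin_topology_generated_by)
    \<comment> \<open>Induction over the generation of the topology: products of functions handle
      intersections, and basic open sets of any chart restrict to the torus since the monoids of the
      charts lie in \<open>M_tilde A\<close>.\<close>
    then have "y \<in> V \<longrightarrow> (\<exists>f. keys f \<subseteq> ?S \<and> f \<notin> snd y \<and> (\<forall>x\<in>topspace ?T. f \<notin> snd x \<longrightarrow> x \<in> V))"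
    proof (induction rule: generate_topology_on.induct)
      case (Int a b)
      show ?case
      proof
        assume "y \<in> a \<inter> b"
        then obtain f g where f: "keys f \<subseteq> ?S" "f \<notin> snd y" "\<forall>x\<in>topspace ?T. f \<notin> snd x \<longrightarrow> x \<in> a"
          and g: "keys g \<subseteq> ?S" "g \<notin> snd y" "\<forall>x\<in>topspace ?T. g \<notin> snd x \<longrightarrow> x \<in> b"
          using Int.IH by blast
        have fg: "f * g \<in> snd x \<longleftrightarrow> f \<in> snd x \<or> g \<in> snd x" if "x \<in> topspace ?T" for x
          using primeideal_monoid_algebraD(3)[of "snd x" ?S f g] mem'[OF that] f(1) g(1) by blast
        have "keys (f * g) \<subseteq> ?S" by (rule monoid_algebra_mult_closed[OF S f(1) g(1)])
        moreover have "f * g \<notin> snd y" using fg[OF y] f g by blast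
        moreover have "\<forall>x\<in>topspace ?T. f * g \<notin> snd x \<longrightarrow> x \<in> a \<inter> b" using fg f g by blast
        ultimately show "\<exists>f. keys f \<subseteq> ?S \<and> f \<notin> snd y \<and> (\<forall>x\<in>topspace ?T. f \<notin> snd x \<longrightarrow> x \<in> a \<inter> b)"
          by blast
      qed
    next
      case (UN K)
      then show ?case by blast
    next
      case (Basis D)
      then obtain i f where D: "D = {x \<in> chart_open ?X i. f \<notin> snd x}" and i: "i \<in> lawrence_fan A"
        and f: "keys f \<subseteq> dual_monoid A i" by (auto simp: carrier_monoid_algebra)
      show ?case
      proof (intro impI exI conjI ballI)
        show "keys f \<subseteq> ?S" using f by (auto simp: dual_monoid_def)
        assume "y \<in> D"
        then show "f \<notin> snd y" by (simp add: D)
        fix x assume "x \<in> topspace ?T" "f \<notin> snd x"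
        \<comment> \<open>The zero cone is a face of \<open>i\<close> because the point
          \<open>y\<close>, which is listed there, lies in chart \<open>i\<close>.\<close>
        then show "x \<in> D" using \<open>y \<in> D\<close> mem[of x] mem[OF y] by (simp add: D chart_open_def)
      qed
    qed simp
    then show "\<exists>f. keys f \<subseteq> ?S \<and> f \<notin> snd y \<and> (\<forall>x\<in>topspace ?T. f \<notin> snd x \<longrightarrow> x \<in> W)"
      using V(2) \<open>y \<in> W\<close> top by blast
  next
    fix u v assume "u \<in> ?S" "v \<in> ?S" "\<And>x. x \<in> coords B \<Longrightarrow> lookup u x = lookup v x"
    then show "u = v" by (rule coords_injective[OF B])
  next
    show "keys (relation_form c' :: _ \<Rightarrow>\<^sub>0 'k) \<subseteq> ?S"
      by (rule keys_relation_form_subset[OF phi_exp_M_tilde])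
  next
    fix u assume "u \<in> ?S"
    then show "keys u \<subseteq> E \<times> UNIV" by (simp add: M_tilde_def)
  qed (use S c' B in \<open>auto intro: finite_coords\<close>)
qed

text \<open>No particular orbit is exhibited: properness both at the fixed point of a vertex and at
  the torus would contradict the two bounds that involve \<open>card (coords B)\<close>.\<close>

lemma improper_intersection:
  assumes "c \<in> relations A" "c \<noteq> 0"
  shows "\<exists>\<sigma> \<in> lawrence_fan A.
           topspace (topo (hypertoric A :: (_, _, 'k::field) k_space)) \<inter> orbit A \<sigma> \<noteq> {} \<and>
           ereal_of_enat (krull_dim
             (subtopology (topo (hypertoric A :: (_, _, 'k) k_space)) (orbit A \<sigma>)))
           \<noteq> ereal_of_enat (krull_dim (topo (hypertoric A :: (_, _, 'k) k_space)))
               - ereal (real (cone_dim A \<sigma>))" (is "\<exists>\<sigma>\<in>_. ?meets \<sigma> \<and> ?L \<sigma> \<noteq> ?R \<sigma>")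
proof (rule ccontr)
  assume "\<not> ?thesis"
  then have proper: "?L \<sigma> = ?R \<sigma>" if "\<sigma> \<in> lawrence_fan A" "?meets \<sigma>" for \<sigma> using that by blast
  obtain \<xi> where \<xi>: "\<xi> \<in> vertices A" using vertex_exists by blast
  obtain B where B: "is_basis B" using is_basis_exists by blast
  let ?C = "vertex_cone A \<xi>"
  let ?D = "krull_dim (topo (hypertoric A :: (_, _, 'k) k_space))"
  have "?L ?C = ?R ?C" using vertex_point[OF \<xi>, where 'k = 'k] by (intro proper vertex_cone_in_fan[OF \<xi>]) auto
  moreover have "krull_dim (subtopology (topo (hypertoric A :: (_, _, 'k) k_space)) (orbit A ?C)) = 0"
    by (rule krull_dim_singleton) (use vertex_point[OF \<xi>, where 'k = 'k] in simp)
  ultimately have "ereal_of_enat ?D - ereal (real (cone_dim A ?C)) = 0" by simp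
  \<comment> \<open>An infinite \<open>?D\<close> is excluded too, since subtracting a real number
    would leave it infinite.\<close>
  then have D: "?D = enat (cone_dim A ?C)" by (cases ?D) auto
  have "?L (Lam_real A) = ?R (Lam_real A)" by (intro proper Lam_real_in_fan torus_point_exists)
  then have "krull_dim (subtopology (topo (hypertoric A :: (_, _, 'k) k_space)) (orbit A (Lam_real A)))
     = enat (cone_dim A ?C)"
    by (cases "krull_dim (subtopology (topo (hypertoric A :: (_, _, 'k) k_space)) (orbit A (Lam_real A)))")
      (auto simp: D cone_dim_def)
  then have "cone_dim A ?C \<le> card (coords B) - 1"
    using krull_dim_torus[OF assms B, where 'k = 'k] by simp
  moreover have "card (coords B) \<le> cone_dim A ?C" by (rule card_coords_le_cone_dim[OF B \<xi>])
  \<comment> \<open>This guards against truncation in \<open>card (coords B) - 1\<close>; an index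
    with a nonzero coefficient in \<open>c\<close> gives an element.\<close>
  moreover have "card (coords B) > 0"
  proof -
    obtain e where "e \<in> keys c" using assms(2) by (metis all_not_in_conv keys_eq_empty)
    then have "(e, Neg) \<in> coords B" using assms(1) by (auto simp: relations_def coords_def)
    then show ?thesis using finite_coords[OF B] by (metis card_gt_0_iff empty_iff)
  qed
  ultimately show False by linarith
qed

end

section \<open>Germs of fractions in a domain\<close>

text \<open>Sums and products of germs are defined as unions over all representatives. If the result
  does not depend on them, the union collapses to one germ.\<close>

lemma UN_pair_constant:
  assumes "\<And>a b a' b'. (a, b) \<in> P \<Longrightarrow> (a', b') \<in> Q \<Longrightarrow> F a b a' b' = K"
    and "(f, g) \<in> P" "(f', g') \<in> Q"
  shows "(\<Union>(a, b)\<in>P. \<Union>(a', b')\<in>Q. F a b a' b') = K"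
proof
  show "(\<Union>(a, b)\<in>P. \<Union>(a', b')\<in>Q. F a b a' b') \<subseteq> K" by (auto simp: assms(1))
  have "F f g f' g' \<subseteq> (\<Union>(a, b)\<in>P. \<Union>(a', b')\<in>Q. F a b a' b')" using assms(2,3) by force
  then show "K \<subseteq> (\<Union>(a, b)\<in>P. \<Union>(a', b')\<in>Q. F a b a' b')" using assms by simp
qed

text \<open>In a domain the auxiliary factor \<open>h\<close> in the definition of
  \<open>germ\<close> cancels, so fractions have the same germ exactly when they agree after cross
  multiplication.\<close>

locale domain_prime =
  fixes S :: "'m::comm_monoid_add set" and q :: "('m \<Rightarrow>\<^sub>0 'k::field) set"
  assumes S: "add_submonoid S" and q: "primeideal q (monoid_algebra S)"
    and dom: "\<And>f g :: 'm \<Rightarrow>\<^sub>0 'k. keys f \<subseteq> S \<Longrightarrow> keys g \<subseteq> S \<Longrightarrow> f * g = 0 \<Longrightarrow> f = 0 \<or> g = 0"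
begin

abbreviation C :: "('m \<Rightarrow>\<^sub>0 'k) set" where "C \<equiv> {f. keys f \<subseteq> S}"

lemma C_mult: "f \<in> C \<Longrightarrow> g \<in> C \<Longrightarrow> f * g \<in> C"
  using monoid_algebra_mult_closed[OF S] by simp

lemma C_add: "f \<in> C \<Longrightarrow> g \<in> C \<Longrightarrow> f + g \<in> C"
  using monoid_algebra_add_closed by simp

lemma C_diff: "f \<in> C \<Longrightarrow> g \<in> C \<Longrightarrow> f - g \<in> C"
proof -
  assume fg: "f \<in> C" "g \<in> C"
  have "t \<in> S" if "t \<in> keys (f - g)" for t
  proof -
    have "t \<in> keys f \<or> t \<in> keys g"
      using that by (auto simp: in_keys_iff lookup_minus)
    then show ?thesis using fg by blast
  qed
  then show ?thesis by blast
qed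

lemma one_C: "1 \<in> C" and one_q: "1 \<notin> q"
  using S primeideal_monoid_algebraD(2)[OF q] by (simp_all add: add_submonoid_def)

lemma nonzero: "g \<notin> q \<Longrightarrow> g \<noteq> 0"
  using ideal_monoid_algebraD(2)[OF primeideal_monoid_algebraD(1)[OF q]] by blast

lemma q_mult: "f \<in> C \<Longrightarrow> g \<in> C \<Longrightarrow> f * g \<in> q \<longleftrightarrow> f \<in> q \<or> g \<in> q"
  using primeideal_monoid_algebraD(3)[OF q] by simp

lemma cancel:
  assumes "h \<in> C" "h \<notin> q" "a \<in> C" "b \<in> C" "h * a = h * b"
  shows "a = b"
proof -
  have "h * (a - b) = 0" using assms(5) by (simp add: right_diff_distrib)
  then show ?thesis using dom[of h "a - b"] C_diff assms nonzero by auto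
qed

lemma mem_germ_iff:
  assumes "f \<in> C" "g \<in> C"
  shows "(f', g') \<in> germ S {0} q f g \<longleftrightarrow> f' \<in> C \<and> g' \<in> C \<and> g' \<notin> q \<and> f * g' = f' * g"
proof
  assume "(f', g') \<in> germ S {0} q f g"
  then obtain h where *: "f' \<in> C" "g' \<in> C" "g' \<notin> q" "h \<in> C" "h \<notin> q" "h * (f * g' - f' * g) = 0"
    by (auto simp: germ_def carrier_monoid_algebra)
  then have "h * (f * g') = h * (f' * g)" by (simp add: right_diff_distrib)
  then have "f * g' = f' * g"
    by (rule cancel[OF *(4,5) C_mult[OF assms(1) *(2)] C_mult[OF *(1) assms(2)]])
  then show "f' \<in> C \<and> g' \<in> C \<and> g' \<notin> q \<and> f * g' = f' * g" using * by blast
next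
  assume "f' \<in> C \<and> g' \<in> C \<and> g' \<notin> q \<and> f * g' = f' * g"
  then show "(f', g') \<in> germ S {0} q f g"
    using one_C one_q by (auto simp: germ_def carrier_monoid_algebra intro!: bexI[of _ 1])
qed

lemma germ_self: "f \<in> C \<Longrightarrow> g \<in> C \<Longrightarrow> g \<notin> q \<Longrightarrow> (f, g) \<in> germ S {0} q f g"
  by (simp add: mem_germ_iff)

lemma germ_subset:
  assumes "f \<in> C" "g \<in> C" "g \<notin> q" "f' \<in> C" "g' \<in> C" "f * g' = f' * g"
  shows "germ S {0} q f g \<subseteq> germ S {0} q f' g'"
proof clarify
  fix a b assume "(a, b) \<in> germ S {0} q f g"
  then have ab: "a \<in> C" "b \<in> C" "b \<notin> q" "f * b = a * g" using mem_germ_iff assms by blast+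
  have "g * (f' * b) = (f' * g) * b" by (simp add: mult_ac)
  also have "\<dots> = (f * g') * b" by (simp only: assms(6))
  also have "\<dots> = g' * (f * b)" by (simp only: mult_ac)
  also have "\<dots> = g' * (a * g)" by (simp only: ab(4))
  also have "\<dots> = g * (a * g')" by (simp only: mult_ac)
  finally have "f' * b = a * g'"
    by (rule cancel[OF assms(2,3) C_mult[OF assms(4) ab(2)] C_mult[OF ab(1) assms(5)]])
  then show "(a, b) \<in> germ S {0} q f' g'" using ab assms by (simp add: mem_germ_iff)
qed

lemma germ_eq_iff:
  assumes "f \<in> C" "g \<in> C" "g \<notin> q" "f' \<in> C" "g' \<in> C" "g' \<notin> q"
  shows "germ S {0} q f g = germ S {0} q f' g' \<longleftrightarrow> f * g' = f' * g"
proof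
  assume "germ S {0} q f g = germ S {0} q f' g'"
  then have "(f', g') \<in> germ S {0} q f g" using germ_self assms by blast
  then show "f * g' = f' * g" using mem_germ_iff assms by blast
next
  assume "f * g' = f' * g"
  then show "germ S {0} q f g = germ S {0} q f' g'"
    using germ_subset[of f g f' g'] germ_subset[of f' g' f g] assms by (simp add: subset_antisym)
qed

lemma germ_rep:
  assumes "f \<in> C" "g \<in> C" "g \<notin> q" "(a, b) \<in> germ S {0} q f g"
  shows "a \<in> C" "b \<in> C" "b \<notin> q" "f * b = a * g"
  using assms mem_germ_iff by blast+

lemma germ_mult_union:
  assumes "f \<in> C" "g \<in> C" "g \<notin> q" "f' \<in> C" "g' \<in> C" "g' \<notin> q"
  shows "(\<Union>(a, b)\<in>germ S {0} q f g. \<Union>(a', b')\<in>germ S {0} q f' g'. germ S {0} q (a * a') (b * b'))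
     = germ S {0} q (f * f') (g * g')"
proof -
  have "germ S {0} q (a * a') (b * b') = germ S {0} q (f * f') (g * g')"
    if "(a, b) \<in> germ S {0} q f g" "(a', b') \<in> germ S {0} q f' g'" for a b a' b'
  proof -
    note ab = germ_rep[OF assms(1-3) that(1)] and ab' = germ_rep[OF assms(4-6) that(2)]
    have "a * a' * (g * g') = (a * g) * (a' * g')" by (simp add: mult_ac)
    also have "\<dots> = (f * b) * (f' * b')" by (simp only: ab(4) ab'(4))
    also have "\<dots> = f * f' * (b * b')" by (simp only: mult_ac)
    finally show ?thesis
      by (subst germ_eq_iff) (use ab ab' assms q_mult C_mult in simp_all)
  qed
  moreover have "(f, g) \<in> germ S {0} q f g" "(f', g') \<in> germ S {0} q f' g'"
    using germ_self assms by blast+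
  ultimately show ?thesis by (rule UN_pair_constant)
qed

lemma germ_add_union:
  assumes "f \<in> C" "g \<in> C" "g \<notin> q" "f' \<in> C" "g' \<in> C" "g' \<notin> q"
  shows "(\<Union>(a, b)\<in>germ S {0} q f g. \<Union>(a', b')\<in>germ S {0} q f' g'. germ S {0} q (a * b' + a' * b) (b * b'))
     = germ S {0} q (f * g' + f' * g) (g * g')"
proof -
  have "germ S {0} q (a * b' + a' * b) (b * b') = germ S {0} q (f * g' + f' * g) (g * g')"
    if "(a, b) \<in> germ S {0} q f g" "(a', b') \<in> germ S {0} q f' g'" for a b a' b'
  proof -
    note ab = germ_rep[OF assms(1-3) that(1)] and ab' = germ_rep[OF assms(4-6) that(2)]
    have "(a * b' + a' * b) * (g * g') = (a * g) * (b' * g') + (a' * g') * (b * g)"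
      by (simp add: algebra_simps)
    also have "\<dots> = (f * b) * (b' * g') + (f' * b') * (b * g)" by (simp only: ab(4) ab'(4))
    also have "\<dots> = (f * g' + f' * g) * (b * b')" by (simp add: algebra_simps)
    finally show ?thesis
      by (subst germ_eq_iff) (use ab ab' assms q_mult C_mult C_add in simp_all)
  qed
  moreover have "(f, g) \<in> germ S {0} q f g" "(f', g') \<in> germ S {0} q f' g'"
    using germ_self assms by blast+
  ultimately show ?thesis by (rule UN_pair_constant)
qed

end

lemma affine_atlas_simps [simp]:
  "charts (affine_atlas n) = UNIV" "sub (affine_atlas n) i j = True"
  "mon (affine_atlas n) i = {u. keys u \<subseteq> {..<n}}" "van (affine_atlas n) i = {0}"
  by (simp_all add: affine_atlas_def Let_def)

lemma pts_affine_atlas: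
  "y \<in> pts (affine_atlas n) \<longleftrightarrow> primeideal (snd y) (monoid_algebra {u. keys u \<subseteq> {..<n}})"
  by (simp add: affine_atlas_def Let_def)

lemma chart_open_affine: "chart_open (affine_atlas n) i = pts (affine_atlas n)"
  by (auto simp: chart_open_def)

lemma add_submonoid_keys: "add_submonoid {u :: 'x \<Rightarrow>\<^sub>0 'b::comm_monoid_add. keys u \<subseteq> Y}"
  unfolding add_submonoid_def
proof (intro conjI ballI)
  fix u v :: "'x \<Rightarrow>\<^sub>0 'b" assume "u \<in> {u. keys u \<subseteq> Y}" "v \<in> {u. keys u \<subseteq> Y}"
  then show "u + v \<in> {u. keys u \<subseteq> Y}" using keys_add[of u v] by blast
qed simp

lemma domain_prime_affine:
  assumes "y \<in> pts (affine_atlas n)"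
  shows "domain_prime {u. keys u \<subseteq> {..<n}} (snd y)"
  using assms by (intro domain_prime.intro) (auto simp: pts_affine_atlas add_submonoid_keys)

section \<open>Toric atlases of affine space\<close>

text \<open>The charts are the open subsets of affine space, with coordinates indexed by \<open>Y\<close>, on
  which the coordinates outside \<open>G i\<close> are invertible.\<close>

locale orthant_atlas =
  fixes X :: "('i, 'x \<Rightarrow>\<^sub>0 int, 'k::field) atlas" and Y :: "'x set" and G :: "'i \<Rightarrow> 'x set"
  assumes finite_Y: "finite Y"
    and G_bij: "bij_betw G (charts X) (Pow Y)"
    and sub_iff: "\<And>i j. i \<in> charts X \<Longrightarrow> j \<in> charts X \<Longrightarrow> sub X i j \<longleftrightarrow> G i \<subseteq> G j"
    and mon_eq: "\<And>i. i \<in> charts X \<Longrightarrow>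
      mon X i = {u. keys u \<subseteq> Y \<and> (\<forall>x\<in>G i. lookup u x \<ge> 0)}"
    and van_eq: "\<And>i. i \<in> charts X \<Longrightarrow> van X i = {0}"
    and pts_iff: "\<And>i q. (i, q) \<in> pts X \<longleftrightarrow> i \<in> charts X \<and> primeideal q (monoid_algebra (mon X i)) \<and>
      (\<forall>u\<in>mon X i. (\<exists>x\<in>G i. lookup u x \<noteq> 0) \<longrightarrow> monomial u \<in> q)"
begin

section \<open>The polynomial ring as the algebra of the largest chart\<close>

abbreviation n :: nat where "n \<equiv> card Y"
abbreviation N :: "('x \<Rightarrow>\<^sub>0 int) set" where
  "N \<equiv> {u. keys u \<subseteq> Y \<and> (\<forall>x. lookup u x \<ge> 0)}"
abbreviation S0 :: "(nat \<Rightarrow>\<^sub>0 nat) set" where "S0 \<equiv> {u. keys u \<subseteq> {..<n}}"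
abbreviation Gp :: "'i \<times> (('x \<Rightarrow>\<^sub>0 int) \<Rightarrow>\<^sub>0 'k) set \<Rightarrow> 'x set" where "Gp x \<equiv> G (fst x)"
abbreviation A0 :: "(unit, nat \<Rightarrow>\<^sub>0 nat, 'k) atlas" where "A0 \<equiv> affine_atlas n"

definition \<beta> :: "nat \<Rightarrow> 'x" where "\<beta> = (SOME b. bij_betw b {..<n} Y)"

lemma \<beta>: "bij_betw \<beta> {..<n} Y"
  using ex_bij_betw_nat_finite[OF finite_Y] unfolding \<beta>_def atLeast0LessThan by (rule someI_ex)

definition relabel :: "(nat \<Rightarrow>\<^sub>0 nat) \<Rightarrow> ('x \<Rightarrow>\<^sub>0 int)" where
  "relabel = reindex \<beta> {..<n} int"

text \<open>Embeds the polynomial ring \<open>K[S0]\<close> in numbered variables into the Laurent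
  polynomials with variables in \<open>Y\<close>. The image is \<open>K[N]\<close>, the algebra of
  the chart with \<open>G i = Y\<close>.\<close>

definition \<iota> :: "((nat \<Rightarrow>\<^sub>0 nat) \<Rightarrow>\<^sub>0 'k) \<Rightarrow> (('x \<Rightarrow>\<^sub>0 int) \<Rightarrow>\<^sub>0 'k)" where
  "\<iota> = lin_ext (single 0) (\<lambda>u. monomial (relabel u))"

sublocale \<iota>: algebra_hom "single 0" "\<lambda>u. monomial (relabel u) :: ('x \<Rightarrow>\<^sub>0 int) \<Rightarrow>\<^sub>0 'k"
  unfolding relabel_def by (rule algebra_hom_reindex) auto

lemma \<iota>_mult: "\<iota> (f * g) = \<iota> f * \<iota> g" and \<iota>_add: "\<iota> (f + g) = \<iota> f + \<iota> g"
  and \<iota>_0: "\<iota> 0 = 0" and \<iota>_1: "\<iota> 1 = 1"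
  unfolding \<iota>_def by (rule \<iota>.lin_ext_mult \<iota>.lin_ext_add \<iota>.lin_ext_0 \<iota>.lin_ext_1)+

lemma relabel_0: "relabel 0 = 0"
  by (simp add: relabel_def reindex_def)

lemma \<iota>_const: "\<iota> (single 0 c) = single 0 c"
  unfolding \<iota>_def \<iota>.lin_ext_single relabel_0 by (simp add: mult_single)

lemma relabel_N: "relabel u \<in> N"
proof -
  have inj: "inj_on \<beta> {..<n}" using \<beta> bij_betw_imp_inj_on by blast
  have im: "\<beta> ` {..<n} = Y" using \<beta> bij_betw_imp_surj_on by blast
  have nn: "lookup (relabel u) x \<ge> 0" for x
  proof (cases "x \<in> \<beta> ` {..<n}")
    case True
    then show ?thesis using lookup_reindex(1)[OF _ inj, of _ int u] by (auto simp: relabel_def)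
  next
    case False
    then show ?thesis using lookup_reindex(2)[OF _ inj False, of int u] by (simp add: relabel_def)
  qed
  have "keys (relabel u) \<subseteq> Y"
    using lookup_reindex(2)[OF _ inj, of _ int u] im by (force simp: relabel_def in_keys_iff)
  then show ?thesis using nn by simp
qed

lemma relabel_surj:
  assumes "u \<in> N"
  obtains v where "v \<in> S0" "relabel v = u"
proof -
  have inj: "inj_on \<beta> {..<n}" using \<beta> bij_betw_imp_inj_on by blast
  have im: "\<beta> ` {..<n} = Y" using \<beta> bij_betw_imp_surj_on by blast
  define v where "v = poly_mapping_on {..<n} (\<lambda>k. nat (lookup u (\<beta> k)))"
  have "lookup (relabel v) x = lookup u x" for x
  proof (cases "x \<in> Y")
    case True
    then obtain k where k: "k < n" "x = \<beta> k" using im by auto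
    then have "lookup (relabel v) x = int (lookup v k)"
      using lookup_reindex(1)[OF _ inj, of k int v] by (simp add: relabel_def)
    also have "\<dots> = lookup u x"
      using assms k by (simp add: v_def lookup_poly_mapping_on)
    finally show ?thesis .
  next
    case False
    then have "lookup (relabel v) x = 0"
      using lookup_reindex(2)[OF _ inj, of x int v] im by (simp add: relabel_def)
    then show ?thesis using False assms by (auto simp: in_keys_iff)
  qed
  then have "relabel v = u" by (rule poly_mapping_eqI)
  moreover have "v \<in> S0" by (simp add: v_def keys_poly_mapping_on)
  ultimately show thesis using that by blast
qed

lemma inj_\<iota>: "inj_on \<iota> {f. keys f \<subseteq> S0}"
  unfolding \<iota>_def relabel_def
  by (rule inj_on_lin_ext_monomial[OF inj_on_reindex[OF _ bij_betw_imp_inj_on[OF \<beta>]]])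
    (simp_all add: inj_def)

lemma \<iota>_N: "keys (\<iota> f) \<subseteq> N"
  unfolding \<iota>_def lin_ext_def using relabel_N by (intro keys_sum_subset) (auto simp: mult_single)

lemma \<iota>_surj:
  assumes "keys f \<subseteq> N"
  obtains f0 where "keys f0 \<subseteq> S0" "\<iota> f0 = f"
proof -
  have "\<forall>u\<in>keys f. \<exists>v. v \<in> S0 \<and> relabel v = u"
  proof
    fix u assume "u \<in> keys f"
    then have "u \<in> N" using assms by (rule subsetD[rotated])
    then show "\<exists>v. v \<in> S0 \<and> relabel v = u" by (rule relabel_surj) blast
  qed
  then obtain t where t: "\<And>u. u \<in> keys f \<Longrightarrow> t u \<in> S0 \<and> relabel (t u) = u" by metis
  define f0 where "f0 = (\<Sum>u\<in>keys f. single (t u) (lookup f u))"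
  have "\<iota> f0 = (\<Sum>u\<in>keys f. single u (lookup f u))"
    unfolding f0_def \<iota>_def \<iota>.lin_ext_sum \<iota>.lin_ext_single by (rule sum.cong) (auto simp: t mult_single)
  then have "\<iota> f0 = f" by (simp flip: poly_mapping_sum_single)
  moreover have "keys f0 \<subseteq> S0"
    unfolding f0_def by (rule keys_sum_subset) (use t in auto)
  ultimately show thesis using that by blast
qed

section \<open>Clearing denominators\<close>

lemma G_subset: "i \<in> charts X \<Longrightarrow> G i \<subseteq> Y"
  using G_bij bij_betwE by blast

lemma add_submonoid_mon: "i \<in> charts X \<Longrightarrow> add_submonoid (mon X i)"
proof -
  assume i: "i \<in> charts X"
  show ?thesis
    unfolding add_submonoid_def mon_eq[OF i]
  proof (intro conjI ballI)
    fix u v :: "'x \<Rightarrow>\<^sub>0 int"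
    assume "u \<in> {u. keys u \<subseteq> Y \<and> (\<forall>x\<in>G i. lookup u x \<ge> 0)}"
      "v \<in> {u. keys u \<subseteq> Y \<and> (\<forall>x\<in>G i. lookup u x \<ge> 0)}"
    then show "u + v \<in> {u. keys u \<subseteq> Y \<and> (\<forall>x\<in>G i. lookup u x \<ge> 0)}"
      using keys_add[of u v] by (auto simp: lookup_add)
  qed simp
qed

lemma N_subset_mon: "i \<in> charts X \<Longrightarrow> N \<subseteq> mon X i"
  by (auto simp: mon_eq)

lemma mon_mono: "i \<in> charts X \<Longrightarrow> j \<in> charts X \<Longrightarrow> G j \<subseteq> G i \<Longrightarrow> mon X i \<subseteq> mon X j"
  by (auto simp: mon_eq)

lemma add_submonoid_N: "add_submonoid N"
  unfolding add_submonoid_def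
proof (intro conjI ballI)
  fix u v assume "u \<in> N" "v \<in> N"
  then show "u + v \<in> N" using keys_add[of u v] by (auto simp: lookup_add)
qed simp

lemma ptsD:
  assumes "x \<in> pts X"
  shows "fst x \<in> charts X" and "primeideal (snd x) (monoid_algebra (mon X (fst x)))"
    and "u \<in> mon X (fst x) \<Longrightarrow> z \<in> Gp x \<Longrightarrow> lookup u z \<noteq> 0 \<Longrightarrow> monomial u \<in> snd x"
  using assms pts_iff[of "fst x" "snd x"] by auto

lemma domain_prime_pts:
  assumes "x \<in> pts X"
  shows "domain_prime (mon X (fst x)) (snd x)"
proof (rule domain_prime.intro)
  fix f g :: "('x \<Rightarrow>\<^sub>0 int) \<Rightarrow>\<^sub>0 'k"
  assume "keys f \<subseteq> mon X (fst x)" "keys g \<subseteq> mon X (fst x)" "f * g = 0"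
  then show "f = 0 \<or> g = 0"
    by (intro group_algebra_no_zero_divisors[OF finite_Y]) (use mon_eq[OF ptsD(1)[OF assms]] in auto)
qed (use assms ptsD(1,2) add_submonoid_mon in blast)+

text \<open>With \<open>u\<close> also \<open>- u\<close> lies in the monoid, so the monomial is a
  unit of the chart and belongs to no prime.\<close>

lemma monomial_unit:
  assumes x: "x \<in> pts X" and u: "keys u \<subseteq> Y - Gp x"
  shows "u \<in> mon X (fst x)" "monomial u \<notin> snd x"
proof -
  interpret D: domain_prime "mon X (fst x)" "snd x" by (rule domain_prime_pts[OF x])
  have zero: "lookup u z = 0" if "z \<in> Gp x" for z
    using u that by (auto simp: in_keys_iff)
  then show um: "u \<in> mon X (fst x)" using u by (auto simp: mon_eq[OF ptsD(1)[OF x]])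
  have "- u \<in> mon X (fst x)" using u zero by (auto simp: mon_eq[OF ptsD(1)[OF x]])
  moreover have "monomial u * monomial (- u) = (1 :: _ \<Rightarrow>\<^sub>0 'k)" by (simp add: mult_single)
  ultimately show "monomial u \<notin> snd x"
    using D.q_mult[of "monomial u" "monomial (- u)"] um D.one_q by auto
qed

text \<open>Negative exponents occur only outside \<open>G i\<close>, where the sum of all absolute
  values compensates them. Because of its support the resulting monomial is a unit on chart
  \<open>i\<close>.\<close>

lemma clear_denominators:
  assumes i: "i \<in> charts X" and V: "finite V" "V \<subseteq> mon X i"
  obtains u where "u \<in> N" "keys u \<subseteq> Y - G i" "\<forall>v\<in>V. u + v \<in> N"
proof -
  have fin: "finite (Y - G i)" using finite_Y by simp
  define u where "u = poly_mapping_on (Y - G i) (\<lambda>y. \<Sum>v\<in>V. \<bar>lookup v y\<bar>)"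
  have lk: "lookup u y = (if y \<in> Y - G i then \<Sum>v\<in>V. \<bar>lookup v y\<bar> else 0)" for y
    unfolding u_def by (rule lookup_poly_mapping_on[OF fin])
  have keys: "keys u \<subseteq> Y - G i" unfolding u_def by (rule keys_poly_mapping_on[OF fin])
  have uN: "u \<in> N" using keys by (auto simp: lk sum_nonneg)
  have "u + v \<in> N" if v: "v \<in> V" for v
  proof -
    have vm: "keys v \<subseteq> Y" "\<forall>x\<in>G i. lookup v x \<ge> 0"
      using v V mon_eq[OF i] by auto
    have "lookup (u + v) y \<ge> 0" for y
    proof (cases "y \<in> Y - G i")
      case True
      have "\<bar>lookup v y\<bar> \<le> (\<Sum>v\<in>V. \<bar>lookup v y\<bar>)"
        using member_le_sum[OF v, of "\<lambda>v. \<bar>lookup v y\<bar>"] V by auto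
      then show ?thesis using True by (simp add: lookup_add lk)
    next
      case False
      then have "lookup v y \<ge> 0" 
        using vm False in_keys_iff[of y v] by (cases "y \<in> Y") auto
      then show ?thesis using False by (simp add: lookup_add lk)
    qed
    moreover have "keys (u + v) \<subseteq> Y" using keys_add[of u v] keys vm by blast
    ultimately show ?thesis by simp
  qed
  then show thesis by (intro that[OF uN keys] ballI)
qed

lemma keys_monomial_mult:
  assumes "\<And>v. v \<in> keys f \<Longrightarrow> u + v \<in> T"
  shows "keys (monomial u * f :: _ \<Rightarrow>\<^sub>0 'k) \<subseteq> T"
  using keys_mult[of "monomial u :: _ \<Rightarrow>\<^sub>0 'k" f] assms by fastforce

lemma clear_denominators2:
  fixes f g :: "('x \<Rightarrow>\<^sub>0 int) \<Rightarrow>\<^sub>0 'k"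
  assumes i: "i \<in> charts X" and "keys f \<subseteq> mon X i" "keys g \<subseteq> mon X i"
  obtains u where "u \<in> N" "keys u \<subseteq> Y - G i"
    "keys (monomial u * f) \<subseteq> N" "keys (monomial u * g) \<subseteq> N"
proof -
  have V: "finite (keys f \<union> keys g)" "keys f \<union> keys g \<subseteq> mon X i"
    using assms by simp_all
  obtain u where u: "u \<in> N" "keys u \<subseteq> Y - G i"
    "\<forall>v\<in>keys f \<union> keys g. u + v \<in> N"
    by (rule clear_denominators[OF i V])
  show thesis
    by (rule that[OF u(1,2)]) (rule keys_monomial_mult, rule bspec[OF u(3)], simp)+
qed

text \<open>One chart contains all points, which is why the glued scheme is affine.\<close>

lemma top_chart: obtains t where "t \<in> charts X" "G t = Y" "mon X t = N" "chart_open X t = pts X"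
proof -
  have "Y \<in> G ` charts X" using bij_betw_imp_surj_on[OF G_bij] by simp
  then obtain t where t: "t \<in> charts X" "G t = Y" by auto
  have "lookup u x = 0" if "keys u \<subseteq> Y" "x \<notin> Y" for u :: "'x \<Rightarrow>\<^sub>0 int" and x
    using that by (auto simp: in_keys_iff)
  then have "mon X t = N"
    unfolding mon_eq[OF t(1)] t(2) by (intro Collect_cong conj_cong refl) (metis order_refl)
  moreover have "sub X (fst x) t" if "x \<in> pts X" for x
    using sub_iff[OF ptsD(1)[OF that] t(1)] G_subset[OF ptsD(1)[OF that]] t(2) by simp
  then have "chart_open X t = pts X" unfolding chart_open_def by blast
  ultimately show thesis using that t by blast
qed

lemma chart_openD:
  assumes "x \<in> chart_open X i" "i \<in> charts X"
  shows "x \<in> pts X" "Gp x \<subseteq> G i"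
  using assms ptsD(1) sub_iff[of "fst x" i] by (auto simp: chart_open_def)

lemma openin_X_\<iota>: "openin (zariski X) {x \<in> pts X. \<iota> f \<notin> snd x}"
proof -
  obtain t where t: "t \<in> charts X" "G t = Y" "mon X t = N" "chart_open X t = pts X" by (rule top_chart)
  have "{x \<in> pts X. \<iota> f \<notin> snd x} \<in> {{x \<in> chart_open X i. f \<notin> snd x} | i f.
        i \<in> charts X \<and> f \<in> carrier (monoid_algebra (mon X i))}"
    by (intro CollectI exI[of _ t] exI[of _ "\<iota> f"]) (use t \<iota>_N in \<open>auto simp: carrier_monoid_algebra\<close>)
  then show ?thesis unfolding zariski_def by (rule topology_generated_by_Basis)
qed

text \<open>Two monomials are multiplied in: \<open>u\<close> clears denominators and is a unit on
  chart \<open>i\<close>, while \<open>u'\<close>, the product of the coordinates outside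
  \<open>G i\<close>, vanishes exactly at the points outside that chart. So one polynomial describes
  the basic open set among all points.\<close>

lemma basic_open_\<iota>:
  assumes i: "i \<in> charts X" and f: "keys f \<subseteq> mon X i"
  obtains f0 where "keys f0 \<subseteq> S0" "{x \<in> chart_open X i. f \<notin> snd x} = {x \<in> pts X. \<iota> f0 \<notin> snd x}"
proof -
  obtain u where u: "u \<in> N" "keys u \<subseteq> Y - G i" "keys (monomial u * f) \<subseteq> N"
    "keys (monomial u * f) \<subseteq> N"
    by (rule clear_denominators2[OF i f f])
  define u' where "u' = poly_mapping_on (Y - G i) (\<lambda>_. 1 :: int)"
  have fin: "finite (Y - G i)" using finite_Y by simp
  have lk: "lookup u' y = (if y \<in> Y - G i then 1 else 0)" for y
    unfolding u'_def by (rule lookup_poly_mapping_on[OF fin])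
  have keys_u': "keys u' \<subseteq> Y - G i" unfolding u'_def by (rule keys_poly_mapping_on[OF fin])
  have u'N: "u' \<in> N" using keys_u' by (auto simp: lk)
  let ?h = "monomial u * f"
  let ?g = "monomial u' * ?h"
  have "keys ?g \<subseteq> N" using monoid_algebra_mult_closed[OF add_submonoid_N _ u(3)] u'N by auto
  then obtain f0 where f0: "keys f0 \<subseteq> S0" "\<iota> f0 = ?g" by (rule \<iota>_surj)
  have "x \<in> chart_open X i \<and> f \<notin> snd x \<longleftrightarrow> ?g \<notin> snd x" if x: "x \<in> pts X" for x
  proof -
    interpret D: domain_prime "mon X (fst x)" "snd x" by (rule domain_prime_pts[OF x])
    have NC: "keys a \<subseteq> N \<Longrightarrow> a \<in> D.C" for a using N_subset_mon[OF ptsD(1)[OF x]] by blast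
    have u'C: "monomial u' \<in> D.C" and hC: "?h \<in> D.C" and uC: "monomial u \<in> D.C"
      using NC[of "monomial u'"] NC[OF u(3)] NC[of "monomial u"] u'N u(1) by auto
    have g_iff: "?g \<in> snd x \<longleftrightarrow> monomial u' \<in> snd x \<or> ?h \<in> snd x" by (rule D.q_mult[OF u'C hC])
    show ?thesis
    proof (cases "Gp x \<subseteq> G i")
      case True
      have "monomial u' \<notin> snd x" "monomial u \<notin> snd x"
        using monomial_unit(2)[OF x] keys_u' u(2) True by blast+
      moreover have "f \<in> D.C" using f mon_mono[OF i ptsD(1)[OF x] True] by auto
      ultimately show ?thesis
        using g_iff D.q_mult[OF uC] True x sub_iff[OF ptsD(1)[OF x] i] by (auto simp: chart_open_def)
    next
      case False
      then obtain y where y: "y \<in> Gp x" "y \<notin> G i" by blast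
      then have "y \<in> Y - G i" using G_subset[OF ptsD(1)[OF x]] by blast
      then have "monomial u' \<in> snd x"
        using ptsD(3)[OF x _ y(1), of u'] u'C by (auto simp: lk)
      then show ?thesis
        using g_iff False sub_iff[OF ptsD(1)[OF x] i] by (auto simp: chart_open_def)
    qed
  qed
  then have "{x \<in> chart_open X i. f \<notin> snd x} = {x \<in> pts X. \<iota> f0 \<notin> snd x}"
    unfolding f0(2) by (auto simp: chart_open_def)
  then show thesis by (rule that[OF f0(1)])
qed

section \<open>Points: contraction of primes along \<open>\<iota>\<close>\<close>

definition \<phi> :: "'i \<times> (('x \<Rightarrow>\<^sub>0 int) \<Rightarrow>\<^sub>0 'k) set \<Rightarrow> unit \<times> ((nat \<Rightarrow>\<^sub>0 nat) \<Rightarrow>\<^sub>0 'k) set" where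
  "\<phi> x = ((), {f. keys f \<subseteq> S0 \<and> \<iota> f \<in> snd x})"

lemma snd_\<phi>: "keys f \<subseteq> S0 \<Longrightarrow> f \<in> snd (\<phi> x) \<longleftrightarrow> \<iota> f \<in> snd x"
  by (simp add: \<phi>_def)

lemma \<phi>_pts:
  assumes x: "x \<in> pts X"
  shows "\<phi> x \<in> pts A0"
proof -
  interpret D: domain_prime "mon X (fst x)" "snd x" by (rule domain_prime_pts[OF x])
  note id = primeideal_monoid_algebraD(1)[OF D.q]
  have \<iota>C: "\<iota> f \<in> D.C" for f using \<iota>_N[of f] N_subset_mon[OF ptsD(1)[OF x]] by blast
  have "primeideal (snd (\<phi> x)) (monoid_algebra S0)"
  proof (rule primeideal_monoid_algebraI[OF add_submonoid_keys])
    fix f g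
    show "f \<in> snd (\<phi> x) \<Longrightarrow> keys f \<subseteq> S0" by (simp add: \<phi>_def)
    show "f \<in> snd (\<phi> x) \<Longrightarrow> g \<in> snd (\<phi> x) \<Longrightarrow> f + g \<in> snd (\<phi> x)"
      using ideal_monoid_algebraD(3)[OF id] monoid_algebra_add_closed[of f S0 g] by (simp add: \<phi>_def \<iota>_add)
    show "f \<in> snd (\<phi> x) \<Longrightarrow> keys g \<subseteq> S0 \<Longrightarrow> g * f \<in> snd (\<phi> x)"
      using ideal_monoid_algebraD(4)[OF id] \<iota>C monoid_algebra_mult_closed[OF add_submonoid_keys, of g "{..<n}" f]
      by (simp add: \<phi>_def \<iota>_mult)
    show "keys f \<subseteq> S0 \<Longrightarrow> keys g \<subseteq> S0 \<Longrightarrow> f * g \<in> snd (\<phi> x) \<Longrightarrow> f \<in> snd (\<phi> x) \<or> g \<in> snd (\<phi> x)"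
      using D.q_mult[OF \<iota>C \<iota>C] by (simp add: \<phi>_def \<iota>_mult)
  qed (use D.one_q ideal_monoid_algebraD(2)[OF id] in \<open>auto simp: \<phi>_def \<iota>_0 \<iota>_1\<close>)
  then show ?thesis by (simp add: pts_affine_atlas)
qed

lemma mem_snd_iff_cleared:
  assumes x: "x \<in> pts X" and f: "f \<in> {f. keys f \<subseteq> mon X (fst x)}"
    and u: "keys u \<subseteq> Y - Gp x"
  shows "monomial u * f \<in> snd x \<longleftrightarrow> f \<in> snd x"
proof -
  interpret D: domain_prime "mon X (fst x)" "snd x" by (rule domain_prime_pts[OF x])
  show ?thesis using D.q_mult[of "monomial u" f] monomial_unit[OF x u] f by simp
qed

lemma single_N: "y \<in> Y \<Longrightarrow> single y 1 \<in> N"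
  by (auto simp: lookup_single when_def)

text \<open>By the definition of \<open>pts\<close> the coordinates in \<open>Gp x\<close> vanish at
  \<open>x\<close>, and all others are units. So the contracted prime remembers in which chart the
  point is listed.\<close>

lemma Gp_iff:
  assumes x: "x \<in> pts X" and y: "y \<in> Y"
  shows "y \<in> Gp x \<longleftrightarrow> monomial (single y 1) \<in> snd x"
proof
  assume "y \<in> Gp x"
  moreover have "single y 1 \<in> mon X (fst x)"
    using single_N[OF y] N_subset_mon[OF ptsD(1)[OF x]] by blast
  ultimately show "monomial (single y 1) \<in> snd x" by (rule_tac ptsD(3)[OF x]) auto
next
  assume "monomial (single y 1) \<in> snd x"
  then show "y \<in> Gp x" using monomial_unit(2)[OF x, of "single y 1"] y by auto
qed

lemma snd_eqI:
  assumes "x \<in> pts X" "x' \<in> pts X" "snd (\<phi> x) = snd (\<phi> x')" "keys f \<subseteq> N"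
  shows "f \<in> snd x \<longleftrightarrow> f \<in> snd x'"
proof -
  obtain f0 where f0: "keys f0 \<subseteq> S0" "\<iota> f0 = f" by (rule \<iota>_surj[OF assms(4)])
  show ?thesis using snd_\<phi>[OF f0(1), of x] snd_\<phi>[OF f0(1), of x'] assms(3) f0(2) by simp
qed

text \<open>The contracted prime determines the chart by \<open>Gp_iff\<close>; there, every element
  is moved into \<open>K[N]\<close> by a unit monomial, which does not affect membership in the
  prime.\<close>

lemma inj_\<phi>: "inj_on \<phi> (pts X)"
proof (rule inj_onI)
  fix x x' assume x: "x \<in> pts X" and x': "x' \<in> pts X" and "\<phi> x = \<phi> x'"
  then have eq: "snd (\<phi> x) = snd (\<phi> x')" by simp
  have "y \<in> Gp x \<longleftrightarrow> y \<in> Gp x'" if "y \<in> Y" for y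
    unfolding Gp_iff[OF x that] Gp_iff[OF x' that] by (rule snd_eqI[OF x x' eq]) (use single_N[OF that] in auto)
  then have "Gp x = Gp x'" using G_subset[OF ptsD(1)[OF x]] G_subset[OF ptsD(1)[OF x']] by blast
  then have fst: "fst x = fst x'"
    by (rule inj_onD[OF bij_betw_imp_inj_on[OF G_bij] _ ptsD(1)[OF x] ptsD(1)[OF x']])
  have "f \<in> snd x \<longleftrightarrow> f \<in> snd x'" if f: "keys f \<subseteq> mon X (fst x)" for f
  proof -
    obtain u where "u \<in> N" and u: "keys u \<subseteq> Y - Gp x" "keys (monomial u * f) \<subseteq> N"
      "keys (monomial u * f) \<subseteq> N"
      by (rule clear_denominators2[OF ptsD(1)[OF x] f f])
    have "f \<in> snd x \<longleftrightarrow> monomial u * f \<in> snd x" using mem_snd_iff_cleared[OF x _ u(1), of f] f by simp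
    also have "\<dots> \<longleftrightarrow> monomial u * f \<in> snd x'" by (rule snd_eqI[OF x x' eq u(2)])
    also have "\<dots> \<longleftrightarrow> f \<in> snd x'" using mem_snd_iff_cleared[OF x', of f u] f u(1) fst by simp
    finally show ?thesis .
  qed
  moreover have "f \<in> snd x \<Longrightarrow> keys f \<subseteq> mon X (fst x)" for f
    using ideal_monoid_algebraD(1)[OF primeideal_monoid_algebraD(1)[OF ptsD(2)[OF x]]] .
  moreover have "f \<in> snd x' \<Longrightarrow> keys f \<subseteq> mon X (fst x)" for f
    using ideal_monoid_algebraD(1)[OF primeideal_monoid_algebraD(1)[OF ptsD(2)[OF x']]] fst by simp
  ultimately have "snd x = snd x'" by blast
  then show "x = x'" using fst by (simp add: prod_eq_iff)
qed

text \<open>Induction on the degree, splitting off one variable at a time.\<close>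

lemma monomial_in_prime:
  assumes p: "primeideal p (monoid_algebra N)" and "u \<in> N" "monomial u \<in> (p :: (_ \<Rightarrow>\<^sub>0 'k) set)"
  shows "\<exists>y\<in>keys u. monomial (single y 1) \<in> p"
  using assms(2,3)
proof (induction "nat (\<Sum>y\<in>Y. lookup u y)" arbitrary: u rule: less_induct)
  case less
  have "u \<noteq> 0" using less.prems primeideal_monoid_algebraD(2)[OF p] by auto
  then obtain y where y: "y \<in> keys u" by (metis all_not_in_conv keys_eq_empty)
  then have yY: "y \<in> Y" using less.prems by blast
  have pos: "lookup u y \<ge> 1" 
  proof -
    have "lookup u y \<noteq> 0" "lookup u y \<ge> 0"
      using y less.prems by (simp_all add: in_keys_iff)
    then show ?thesis by linarith
  qed
  let ?v = "u - single y 1"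
  have lk: "lookup ?v z = lookup u z - (if z = y then 1 else 0)" for z
    by (auto simp: lookup_minus lookup_single when_def)
  have sub: "keys ?v \<subseteq> keys u" using y by (auto simp: in_keys_iff lk split: if_splits)
  have vN: "?v \<in> N" using sub less.prems pos by (auto simp: lk)
  have "monomial (single y 1) * monomial ?v = (monomial u :: _ \<Rightarrow>\<^sub>0 'k)" by (simp add: mult_single)
  then have "monomial (single y 1) \<in> p \<or> monomial ?v \<in> p"
    using primeideal_monoid_algebraD(3)[OF p, of "monomial (single y 1)" "monomial ?v"]
      single_N[OF yY] vN less.prems by auto
  moreover have "nat (\<Sum>z\<in>Y. lookup ?v z) < nat (\<Sum>z\<in>Y. lookup u z)"
  proof -
    have "(\<Sum>z\<in>Y. lookup ?v z) = (\<Sum>z\<in>Y. lookup u z) - 1"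
      using finite_Y yY by (simp add: lk sum_subtractf)
    moreover have "(\<Sum>z\<in>Y. lookup ?v z) \<ge> 0" using vN by (intro sum_nonneg) auto
    ultimately show ?thesis by linarith
  qed
  ultimately show ?case using less.hyps[of ?v] vN sub y by blast
qed

text \<open>The coordinates contained in a prime of the polynomial ring select the chart, and the
  point sought is the extension of this prime to the localization at the remaining
  coordinates.\<close>

lemma surj_\<phi>:
  assumes y: "y \<in> pts A0"
  shows "\<exists>x\<in>pts X. \<phi> x = y"
proof -
  define p where "p = \<iota> ` snd y"
  have py: "primeideal (snd y) (monoid_algebra S0)" using y by (simp add: pts_affine_atlas)
  note idy = primeideal_monoid_algebraD(1)[OF py]
  have subS0: "f \<in> snd y \<Longrightarrow> keys f \<subseteq> S0" for f by (rule ideal_monoid_algebraD(1)[OF idy])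
  have p_iff: "\<iota> f \<in> p \<longleftrightarrow> f \<in> snd y" if f: "keys f \<subseteq> S0" for f
    unfolding p_def using inj_on_image_mem_iff[OF inj_\<iota>, of f "snd y"] subS0 f by blast
  have p: "primeideal p (monoid_algebra N)"
  proof (rule primeideal_monoid_algebraI[OF add_submonoid_N])
    show "0 \<in> p" unfolding p_def using ideal_monoid_algebraD(2)[OF idy] \<iota>_0 by (metis image_eqI)
    show "1 \<notin> p" using p_iff[of 1] primeideal_monoid_algebraD(2)[OF py] by (simp add: \<iota>_1)
    fix f g :: "('x \<Rightarrow>\<^sub>0 int) \<Rightarrow>\<^sub>0 'k"
    show "f \<in> p \<Longrightarrow> keys f \<subseteq> N" unfolding p_def using \<iota>_N by blast
    show "f \<in> p \<Longrightarrow> g \<in> p \<Longrightarrow> f + g \<in> p"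
      unfolding p_def using ideal_monoid_algebraD(3)[OF idy] by (auto simp flip: \<iota>_add)
    show "f \<in> p \<Longrightarrow> keys g \<subseteq> N \<Longrightarrow> g * f \<in> p"
    proof -
      assume "f \<in> p" "keys g \<subseteq> N"
      obtain g0 where g0: "keys g0 \<subseteq> S0" "\<iota> g0 = g"
        by (rule \<iota>_surj[OF \<open>keys g \<subseteq> N\<close>])
      obtain f0 where f0: "f0 \<in> snd y" "f = \<iota> f0" using \<open>f \<in> p\<close> unfolding p_def by blast
      have "g0 * f0 \<in> snd y" by (rule ideal_monoid_algebraD(4)[OF idy f0(1) g0(1)])
      then show ?thesis unfolding p_def using \<iota>_mult[of g0 f0] f0(2) g0(2) by (metis imageI)
    qed
    show "f \<in> p \<or> g \<in> p" if f: "keys f \<subseteq> N" and g: "keys g \<subseteq> N" and fg: "f * g \<in> p"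
    proof -
      obtain f0 where f0: "keys f0 \<subseteq> S0" "\<iota> f0 = f" by (rule \<iota>_surj[OF f])
      obtain g0 where g0: "keys g0 \<subseteq> S0" "\<iota> g0 = g" by (rule \<iota>_surj[OF g])
      have "f0 * g0 \<in> snd y"
        using fg p_iff[OF monoid_algebra_mult_closed[OF add_submonoid_keys f0(1) g0(1)]] f0 g0
        by (simp add: \<iota>_mult)
      then show ?thesis
        using primeideal_monoid_algebraD(3)[OF py f0(1) g0(1)] p_iff[OF f0(1)] p_iff[OF g0(1)] f0 g0 by simp
    qed
  qed
  note idp = primeideal_monoid_algebraD(1)[OF p]
  define Z where "Z = {z \<in> Y. monomial (single z 1) \<in> p}"
  have "Z \<in> G ` charts X" using bij_betw_imp_surj_on[OF G_bij] by (auto simp: Z_def)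
  then obtain i where i: "i \<in> charts X" "G i = Z" by auto
  have unit: "monomial u \<notin> p" if "u \<in> N" "keys u \<subseteq> Y - G i" for u
    using monomial_in_prime[OF p that(1)] that i by (auto simp: Z_def)
  \<comment> \<open>The extension of \<open>p\<close> to chart \<open>i\<close>: all elements that
    some monomial invertible on the chart moves into \<open>p\<close>.\<close>
  define q where "q = {f. keys f \<subseteq> mon X i \<and>
     (\<exists>u\<in>N. keys u \<subseteq> Y - G i \<and> monomial u * f \<in> p)}"
  have mu: "monomial (u + v) = monomial u * (monomial v :: _ \<Rightarrow>\<^sub>0 'k)" for u v :: "'x \<Rightarrow>\<^sub>0 int" by (simp add: mult_single)
  have uvN: "u + v \<in> N" and uvK: "keys (u + v) \<subseteq> Y - G i"
    if "u \<in> N" "v \<in> N" "keys u \<subseteq> Y - G i" "keys v \<subseteq> Y - G i" for u v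
    using that add_submonoid_N keys_add[of u v] unfolding add_submonoid_def by blast+
  have keysm: "keys (monomial u :: _ \<Rightarrow>\<^sub>0 'k) \<subseteq> N" if "u \<in> N" for u using that by simp
  have q: "primeideal q (monoid_algebra (mon X i))"
  proof (rule primeideal_monoid_algebraI[OF add_submonoid_mon[OF i(1)]])
    show "0 \<in> q" using ideal_monoid_algebraD(2)[OF idp] by (auto simp: q_def intro!: bexI[of _ 0])
    show "1 \<notin> q" using unit by (auto simp: q_def)
    fix f g :: "('x \<Rightarrow>\<^sub>0 int) \<Rightarrow>\<^sub>0 'k"
    show "f \<in> q \<Longrightarrow> keys f \<subseteq> mon X i" by (simp add: q_def)
    show "f + g \<in> q" if "f \<in> q" "g \<in> q"
    proof -
      obtain u v where u: "u \<in> N" "keys u \<subseteq> Y - G i" "monomial u * f \<in> p"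
        and v: "v \<in> N" "keys v \<subseteq> Y - G i" "monomial v * g \<in> p"
        using \<open>f \<in> q\<close> \<open>g \<in> q\<close> unfolding q_def by blast
      have "monomial v * (monomial u * f) + monomial u * (monomial v * g) \<in> p"
        by (intro ideal_monoid_algebraD(3)[OF idp] ideal_monoid_algebraD(4)[OF idp] keysm u v)
      moreover have "monomial v * (monomial u * f) + monomial u * (monomial v * g) = monomial (u + v) * (f + g)"
        unfolding mu distrib_left by (simp only: mult_ac)
      ultimately have "monomial (u + v) * (f + g) \<in> p" by simp
      moreover have "keys (f + g) \<subseteq> mon X i"
        using that by (intro monoid_algebra_add_closed) (auto simp: q_def)
      ultimately show ?thesis using uvN[OF u(1) v(1) u(2) v(2)] uvK[OF u(1) v(1) u(2) v(2)] unfolding q_def by blast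
    qed
    show "g * f \<in> q" if f: "f \<in> q" and g: "keys g \<subseteq> mon X i"
    proof -
      obtain u where u: "u \<in> N" "keys u \<subseteq> Y - G i" "monomial u * f \<in> p"
        using f unfolding q_def by blast
      obtain v where v: "v \<in> N" "keys v \<subseteq> Y - G i" "keys (monomial v * g) \<subseteq> N"
        "keys (monomial v * g) \<subseteq> N"
        by (rule clear_denominators2[OF i(1) g g])
      have "(monomial v * g) * (monomial u * f) \<in> p" by (rule ideal_monoid_algebraD(4)[OF idp u(3) v(3)])
      moreover have "(monomial v * g) * (monomial u * f) = monomial (u + v) * (g * f)"
        by (simp only: mu mult_ac)
      ultimately have "monomial (u + v) * (g * f) \<in> p" by simp
      moreover have "keys (g * f) \<subseteq> mon X i"
        using f g by (intro monoid_algebra_mult_closed add_submonoid_mon i) (auto simp: q_def)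
      ultimately show ?thesis using uvN[OF u(1) v(1) u(2) v(2)] uvK[OF u(1) v(1) u(2) v(2)] unfolding q_def by blast
    qed
    show "f \<in> q \<or> g \<in> q" if f: "keys f \<subseteq> mon X i" and g: "keys g \<subseteq> mon X i" and fg: "f * g \<in> q"
    proof -
      obtain u where u: "u \<in> N" "keys u \<subseteq> Y - G i" "monomial u * (f * g) \<in> p"
        using fg unfolding q_def by blast
      obtain v where v: "v \<in> N" "keys v \<subseteq> Y - G i"
        "keys (monomial v * f) \<subseteq> N" "keys (monomial v * g) \<subseteq> N"
        by (rule clear_denominators2[OF i(1) f g])
      \<comment> \<open>Each of the factors \<open>f\<close> and \<open>g\<close> takes one copy of
        the monomial that clears its denominators.\<close>
      have "(monomial v * monomial v) * (monomial u * (f * g)) \<in> p"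
        by (intro ideal_monoid_algebraD(4)[OF idp u(3)] monoid_algebra_mult_closed[OF add_submonoid_N] keysm v)
      moreover have "(monomial v * monomial v) * (monomial u * (f * g)) = monomial u * ((monomial v * f) * (monomial v * g))"
        by (simp only: mult_ac)
      ultimately have "monomial u * ((monomial v * f) * (monomial v * g)) \<in> p" by simp
      then have "monomial v * f \<in> p \<or> monomial v * g \<in> p"
        using primeideal_monoid_algebraD(3)[OF p keysm[OF u(1)] monoid_algebra_mult_closed[OF add_submonoid_N v(3,4)]]
          primeideal_monoid_algebraD(3)[OF p v(3,4)] unit[OF u(1,2)] by blast
      then show ?thesis using v f g unfolding q_def by blast
    qed
  qed
  have "monomial v \<in> q" if v: "v \<in> mon X i" and z: "z \<in> G i" "lookup v z \<noteq> 0" for v z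
  proof -
    have V: "finite {v}" "{v} \<subseteq> mon X i" using v by simp_all
    obtain u where u: "u \<in> N" "keys u \<subseteq> Y - G i" and "\<forall>v'\<in>{v}. u + v' \<in> N"
      by (rule clear_denominators[OF i(1) V])
    then have uvN': "u + v \<in> N" by blast
    have zY: "z \<in> Y" and zp: "monomial (single z 1) \<in> p" using z i by (auto simp: Z_def)
    \<comment> \<open>After clearing denominators the monomial is still divisible by the coordinate
      \<open>z\<close>, which lies in \<open>p\<close>, since \<open>u\<close> does not involve
      coordinates in \<open>G i\<close>.\<close>
    let ?w = "u + v - single z 1"
    have lk: "lookup ?w x = lookup (u + v) x - (if x = z then 1 else 0)" for x
      by (auto simp: lookup_minus lookup_single when_def)
    have uz: "lookup u z = 0" using u(2) z(1) by (auto simp: in_keys_iff)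
    have "lookup v z \<ge> 0" using v z(1) mon_eq[OF i(1)] by auto
    then have pos: "lookup (u + v) z \<ge> 1" using z(2) uz by (simp add: lookup_add)
    have "keys ?w \<subseteq> Y"
    proof
      fix x assume "x \<in> keys ?w"
      then have "x = z \<or> x \<in> keys (u + v)" unfolding in_keys_iff lk by (auto split: if_splits)
      then show "x \<in> Y" using zY uvN' by blast
    qed
    moreover have "lookup ?w x \<ge> 0" for x
      unfolding lk using pos uvN' by auto
    ultimately have wN: "?w \<in> N" by blast
    have "monomial ?w * monomial (single z 1) \<in> p"
      by (rule ideal_monoid_algebraD(4)[OF idp zp keysm[OF wN]])
    moreover have "monomial ?w * monomial (single z 1) = monomial u * (monomial v :: _ \<Rightarrow>\<^sub>0 'k)"
      by (simp add: mult_single)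
    ultimately have "monomial u * monomial v \<in> p" by simp
    then show ?thesis using u v by (auto simp: q_def)
  qed
  then have x: "(i, q) \<in> pts X" using i q by (auto simp: pts_iff)
  have "f \<in> snd (\<phi> (i, q)) \<longleftrightarrow> f \<in> snd y" if f: "keys f \<subseteq> S0" for f
  proof -
    have "\<iota> f \<in> q \<longleftrightarrow> \<iota> f \<in> p"
    proof
      assume "\<iota> f \<in> q"
      then obtain u where u: "u \<in> N" "keys u \<subseteq> Y - G i" "monomial u * \<iota> f \<in> p"
        unfolding q_def by blast
      then show "\<iota> f \<in> p"
        using primeideal_monoid_algebraD(3)[OF p keysm[OF u(1)] \<iota>_N] unit[OF u(1,2)] by blast
    next
      assume "\<iota> f \<in> p"
      then show "\<iota> f \<in> q" using \<iota>_N[of f] N_subset_mon[OF i(1)] by (auto simp: q_def intro!: bexI[of _ 0])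
    qed
    then show ?thesis using p_iff[OF f] snd_\<phi>[OF f, of "(i, q)"] by simp
  qed
  moreover have "f \<in> snd (\<phi> (i, q)) \<Longrightarrow> keys f \<subseteq> S0" for f by (simp add: \<phi>_def)
  ultimately have "snd (\<phi> (i, q)) = snd y" using subS0 by blast
  then have "\<phi> (i, q) = y" by (simp add: prod_eq_iff)
  then show ?thesis using x by blast
qed

lemma bij_\<phi>: "bij_betw \<phi> (pts X) (pts A0)"
  unfolding bij_betw_def
proof (intro conjI inj_\<phi> equalityI subsetI)
  fix y assume "y \<in> pts A0"
  then obtain x where "x \<in> pts X" "\<phi> x = y" using surj_\<phi> by blast
  then show "y \<in> \<phi> ` pts X" by blast
qed (use \<phi>_pts in blast)

section \<open>The homeomorphism\<close>

lemma topspace_X: "topspace (zariski X) = pts X"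
proof (rule topspace_zariski)
  fix x assume x: "x \<in> pts X"
  then show "fst x \<in> charts X \<and> sub X (fst x) (fst x) \<and> 0 \<in> mon X (fst x) \<and> 1 \<notin> snd x"
    using ptsD(1)[OF x] sub_iff primeideal_monoid_algebraD(2)[OF ptsD(2)[OF x]] by (simp add: mon_eq)
qed

lemma topspace_A0: "topspace (zariski A0) = pts A0"
  by (rule topspace_zariski) (auto simp: pts_affine_atlas primeideal_monoid_algebraD(2))

lemma openin_A0: "keys f \<subseteq> S0 \<Longrightarrow> openin (zariski A0) {y \<in> pts A0. f \<notin> snd y}"
  unfolding zariski_def
  by (rule topology_generated_by_Basis)
    (auto simp: chart_open_affine carrier_monoid_algebra)

text \<open>Basic open sets correspond: those of affine space pull back by
  \<open>snd_\<phi>\<close>, and those of any chart are given by one polynomial by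
  \<open>basic_open_\<iota>\<close>.\<close>

lemma homeomorphic_\<phi>: "homeomorphic_map (zariski X) (zariski A0) \<phi>"
proof -
  define \<psi> where "\<psi> = inv_into (pts X) \<phi>"
  have \<psi>\<phi>: "\<psi> (\<phi> x) = x" if "x \<in> pts X" for x
    unfolding \<psi>_def by (rule inv_into_f_f[OF inj_\<phi> that])
  have \<phi>\<psi>: "\<phi> (\<psi> y) = y" and \<psi>_pts: "\<psi> y \<in> pts X" if "y \<in> pts A0" for y
    unfolding \<psi>_def using bij_\<phi> that by (auto simp: bij_betw_def f_inv_into_f inv_into_into)
  have "continuous_map (zariski X) (zariski A0) \<phi>"
    unfolding zariski_def[of A0]
  proof (rule continuous_on_generated_topo)
    fix U assume "U \<in> {{x \<in> chart_open A0 i. f \<notin> snd x} | i f.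
        i \<in> charts A0 \<and> f \<in> carrier (monoid_algebra (mon A0 i))}"
    then obtain f where U: "U = {y \<in> pts A0. f \<notin> snd y}" and f: "keys f \<subseteq> S0"
      by (auto simp: chart_open_affine carrier_monoid_algebra)
    have "\<phi> -` U \<inter> topspace (zariski X) = {x \<in> pts X. \<iota> f \<notin> snd x}"
      unfolding topspace_X U using \<phi>_pts snd_\<phi>[OF f] by auto
    then show "openin (zariski X) (\<phi> -` U \<inter> topspace (zariski X))" using openin_X_\<iota> by simp
  next
    show "\<phi> ` topspace (zariski X) \<subseteq> \<Union> {{x \<in> chart_open A0 i. f \<notin> snd x} | i f.
        i \<in> charts A0 \<and> f \<in> carrier (monoid_algebra (mon A0 i))}"
      unfolding topspace_A0[unfolded zariski_def topology_generated_by_topspace] topspace_X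
      by (rule image_subsetI) (rule \<phi>_pts)
  qed
  moreover have "continuous_map (zariski A0) (zariski X) \<psi>"
    unfolding zariski_def[of X]
  proof (rule continuous_on_generated_topo)
    fix U assume "U \<in> {{x \<in> chart_open X i. f \<notin> snd x} | i f.
        i \<in> charts X \<and> f \<in> carrier (monoid_algebra (mon X i))}"
    then obtain i f where U: "U = {x \<in> chart_open X i. f \<notin> snd x}" and i: "i \<in> charts X"
      and f: "keys f \<subseteq> mon X i"
      by (auto simp: carrier_monoid_algebra)
    obtain f0 where f0: "keys f0 \<subseteq> S0" "U = {x \<in> pts X. \<iota> f0 \<notin> snd x}"
      unfolding U by (rule basic_open_\<iota>[OF i f])
    have "\<iota> f0 \<in> snd (\<psi> y) \<longleftrightarrow> f0 \<in> snd y" if "y \<in> pts A0" for y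
      using snd_\<phi>[OF f0(1), of "\<psi> y"] \<phi>\<psi>[OF that] by simp
    then have "\<psi> -` U \<inter> topspace (zariski A0) = {y \<in> pts A0. f0 \<notin> snd y}"
      unfolding topspace_A0 f0(2) using \<psi>_pts by blast
    then show "openin (zariski A0) (\<psi> -` U \<inter> topspace (zariski A0))" using openin_A0[OF f0(1)] by simp
  next
    show "\<psi> ` topspace (zariski A0) \<subseteq> \<Union> {{x \<in> chart_open X i. f \<notin> snd x} | i f.
        i \<in> charts X \<and> f \<in> carrier (monoid_algebra (mon X i))}"
      unfolding topspace_X[unfolded zariski_def topology_generated_by_topspace] topspace_A0
      by (rule image_subsetI) (rule \<psi>_pts)
  qed
  ultimately have "homeomorphic_maps (zariski X) (zariski A0) \<phi> \<psi>"
    unfolding homeomorphic_maps_def topspace_X topspace_A0 using \<psi>\<phi> \<phi>\<psi> by blast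
  then show ?thesis using homeomorphic_map_maps by blast
qed

end

section \<open>Comparison of the structure sheaves\<close>

lemma topo_scheme_of: "topo (scheme_of X) = zariski X"
  and sheaf_scheme_of: "sheaf (scheme_of X) = structure_sheaf X"
  by (simp_all add: scheme_of_def)

context orthant_atlas
begin

text \<open>The induced map on stalks without a choice of representative, a union like those that
  define the operations on germs. By \<open>stalk_map_germ\<close> all representatives yield the
  same germ.\<close>

definition stalk_map ::
  "'i \<times> (('x \<Rightarrow>\<^sub>0 int) \<Rightarrow>\<^sub>0 'k) set \<Rightarrow> (((nat \<Rightarrow>\<^sub>0 nat) \<Rightarrow>\<^sub>0 'k) \<times> ((nat \<Rightarrow>\<^sub>0 nat) \<Rightarrow>\<^sub>0 'k)) set \<Rightarrow>
   ((('x \<Rightarrow>\<^sub>0 int) \<Rightarrow>\<^sub>0 'k) \<times> (('x \<Rightarrow>\<^sub>0 int) \<Rightarrow>\<^sub>0 'k)) set" where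
  "stalk_map x H = (\<Union>(a, b)\<in>H. germ_at X x (\<iota> a) (\<iota> b))"

definition preim :: "(unit \<times> ((nat \<Rightarrow>\<^sub>0 nat) \<Rightarrow>\<^sub>0 'k) set) set \<Rightarrow> ('i \<times> (('x \<Rightarrow>\<^sub>0 int) \<Rightarrow>\<^sub>0 'k) set) set" where
  "preim V = {x \<in> pts X. \<phi> x \<in> V}"

definition \<theta> where
  "\<theta> V s = (\<lambda>x\<in>preim V. stalk_map x (s (\<phi> x)))"

lemma \<iota>_mon: "x \<in> pts X \<Longrightarrow> keys (\<iota> f) \<subseteq> mon X (fst x)"
  by (rule subset_trans[OF \<iota>_N N_subset_mon[OF ptsD(1)]])

lemma germ_at_X: "x \<in> pts X \<Longrightarrow> germ_at X x f g = germ (mon X (fst x)) {0} (snd x) f g"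
  using van_eq[OF ptsD(1)] by simp

lemma germ_at_A0: "germ_at A0 y f g = germ S0 {0} (snd y) f g"
  by simp

lemma stalk_map_germ:
  assumes x: "x \<in> pts X" and f: "keys f \<subseteq> S0" and g: "keys g \<subseteq> S0" "g \<notin> snd (\<phi> x)"
  shows "stalk_map x (germ_at A0 (\<phi> x) f g) = germ_at X x (\<iota> f) (\<iota> g)"
proof -
  interpret D: domain_prime "mon X (fst x)" "snd x" by (rule domain_prime_pts[OF x])
  interpret D0: domain_prime S0 "snd (\<phi> x)" by (rule domain_prime_affine[OF \<phi>_pts[OF x]])
  have fC: "f \<in> D0.C" and gC: "g \<in> D0.C" using f g by simp_all
  have \<iota>C: "\<iota> a \<in> D.C" for a using \<iota>_mon[OF x] by simp
  have eq: "germ_at X x (\<iota> a) (\<iota> b) = germ_at X x (\<iota> f) (\<iota> g)" if "(a, b) \<in> germ_at A0 (\<phi> x) f g" for a b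
  proof -
    have ab: "a \<in> D0.C" "b \<in> D0.C" "b \<notin> snd (\<phi> x)" "f * b = a * g"
      using D0.germ_rep[OF fC gC g(2)] that unfolding germ_at_A0 by blast+
    have "\<iota> a * \<iota> g = \<iota> f * \<iota> b" by (simp only: \<iota>_mult[symmetric] ab(4))
    moreover have "\<iota> b \<notin> snd x" using snd_\<phi>[of b x] ab by simp
    moreover have "\<iota> g \<notin> snd x" using snd_\<phi>[of g x] g by simp
    ultimately show ?thesis
      unfolding germ_at_X[OF x] using D.germ_eq_iff[OF \<iota>C \<iota>C _ \<iota>C \<iota>C] by blast
  qed
  have "(f, g) \<in> germ_at A0 (\<phi> x) f g" unfolding germ_at_A0 by (rule D0.germ_self[OF fC gC g(2)])
  then have "germ_at X x (\<iota> f) (\<iota> g) \<subseteq> stalk_map x (germ_at A0 (\<phi> x) f g)"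
    unfolding stalk_map_def by blast
  moreover have "stalk_map x (germ_at A0 (\<phi> x) f g) \<subseteq> germ_at X x (\<iota> f) (\<iota> g)"
    unfolding stalk_map_def using eq by (intro UN_least) auto
  ultimately show ?thesis by (rule subset_antisym[rotated])
qed

lemma germ_mult_X:
  assumes x: "x \<in> pts X" and "keys f \<subseteq> mon X (fst x)" "keys g \<subseteq> mon X (fst x)" "g \<notin> snd x"
    "keys f' \<subseteq> mon X (fst x)" "keys g' \<subseteq> mon X (fst x)" "g' \<notin> snd x"
  shows "germ_mult X x (germ_at X x f g) (germ_at X x f' g') = germ_at X x (f * f') (g * g')"
    and "germ_add X x (germ_at X x f g) (germ_at X x f' g') = germ_at X x (f * g' + f' * g) (g * g')"
proof -
  interpret D: domain_prime "mon X (fst x)" "snd x" by (rule domain_prime_pts[OF x])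
  show "germ_mult X x (germ_at X x f g) (germ_at X x f' g') = germ_at X x (f * f') (g * g')"
    unfolding germ_mult_def germ_at_X[OF x] by (rule D.germ_mult_union) (use assms in simp_all)
  show "germ_add X x (germ_at X x f g) (germ_at X x f' g') = germ_at X x (f * g' + f' * g) (g * g')"
    unfolding germ_add_def germ_at_X[OF x] by (rule D.germ_add_union) (use assms in simp_all)
qed

lemma germ_mult_A0:
  assumes y: "y \<in> pts A0" and "keys f \<subseteq> S0" "keys g \<subseteq> S0" "g \<notin> snd y"
    "keys f' \<subseteq> S0" "keys g' \<subseteq> S0" "g' \<notin> snd y"
  shows "germ_mult A0 y (germ_at A0 y f g) (germ_at A0 y f' g') = germ_at A0 y (f * f') (g * g')"
    and "germ_add A0 y (germ_at A0 y f g) (germ_at A0 y f' g') = germ_at A0 y (f * g' + f' * g) (g * g')"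
proof -
  interpret D: domain_prime S0 "snd y" by (rule domain_prime_affine[OF y])
  show "germ_mult A0 y (germ_at A0 y f g) (germ_at A0 y f' g') = germ_at A0 y (f * f') (g * g')"
    unfolding germ_mult_def germ_at_A0 by (rule D.germ_mult_union) (use assms in simp_all)
  show "germ_add A0 y (germ_at A0 y f g) (germ_at A0 y f' g') = germ_at A0 y (f * g' + f' * g) (g * g')"
    unfolding germ_add_def germ_at_A0 by (rule D.germ_add_union) (use assms in simp_all)
qed

lemma section_A0_local:
  assumes "s \<in> carrier (structure_sheaf A0 V)" "y \<in> V"
  obtains f g V' where "keys f \<subseteq> S0" "keys g \<subseteq> S0" "openin (zariski A0) V'"
    "y \<in> V'" "V' \<subseteq> V" "\<forall>z\<in>V'. g \<notin> snd z \<and> s z = germ_at A0 z f g"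
proof -
  have "\<exists>i \<in> charts A0. \<exists>f \<in> carrier (monoid_algebra (mon A0 i)).
          \<exists>g \<in> carrier (monoid_algebra (mon A0 i)). \<exists>V'.
            openin (zariski A0) V' \<and> y \<in> V' \<and> V' \<subseteq> V \<inter> chart_open A0 i \<and>
            (\<forall>z \<in> V'. g \<notin> snd z \<and> s z = germ_at A0 z f g)"
    using assms by (simp add: structure_sheaf_def)
  then obtain i f g V' where "f \<in> carrier (monoid_algebra (mon A0 i))" "g \<in> carrier (monoid_algebra (mon A0 i))"
    and V': "openin (zariski A0) V'" "y \<in> V'" "V' \<subseteq> V \<inter> chart_open A0 i"
      "\<forall>z \<in> V'. g \<notin> snd z \<and> s z = germ_at A0 z f g"
    by (elim bexE exE conjE)
  then have "keys f \<subseteq> S0" "keys g \<subseteq> S0" "V' \<subseteq> V"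
    by (simp_all add: carrier_monoid_algebra)
  then show thesis using V'(1,2,4) by (intro that)
qed

lemma section_X_local:
  assumes "s \<in> carrier (structure_sheaf X U)" "x \<in> U"
  obtains i f g V' where "i \<in> charts X" "keys f \<subseteq> mon X i" "keys g \<subseteq> mon X i"
    "openin (zariski X) V'" "x \<in> V'" "V' \<subseteq> U" "V' \<subseteq> chart_open X i"
    "\<forall>z\<in>V'. g \<notin> snd z \<and> s z = germ_at X z f g"
proof -
  have "\<exists>i \<in> charts X. \<exists>f \<in> carrier (monoid_algebra (mon X i)).
          \<exists>g \<in> carrier (monoid_algebra (mon X i)). \<exists>V'.
            openin (zariski X) V' \<and> x \<in> V' \<and> V' \<subseteq> U \<inter> chart_open X i \<and>
            (\<forall>z \<in> V'. g \<notin> snd z \<and> s z = germ_at X z f g)"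
    using assms by (simp add: structure_sheaf_def)
  then obtain i f g V' where "i \<in> charts X" "f \<in> carrier (monoid_algebra (mon X i))" "g \<in> carrier (monoid_algebra (mon X i))"
    and V': "openin (zariski X) V'" "x \<in> V'" "V' \<subseteq> U \<inter> chart_open X i"
      "\<forall>z \<in> V'. g \<notin> snd z \<and> s z = germ_at X z f g"
    by (elim bexE exE conjE)
  then have "i \<in> charts X" "keys f \<subseteq> mon X i" "keys g \<subseteq> mon X i" "V' \<subseteq> U" "V' \<subseteq> chart_open X i"
    by (simp_all add: carrier_monoid_algebra)
  then show thesis using V'(1,2,4) by (intro that)
qed

lemma section_A0_germ:
  assumes "s \<in> carrier (structure_sheaf A0 V)" "y \<in> V"
  obtains f g where "keys f \<subseteq> S0" "keys g \<subseteq> S0" "g \<notin> snd y" "s y = germ_at A0 y f g"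
proof -
  obtain f g V' where *: "keys f \<subseteq> S0" "keys g \<subseteq> S0" "openin (zariski A0) V'"
    "y \<in> V'" "V' \<subseteq> V" "\<forall>z\<in>V'. g \<notin> snd z \<and> s z = germ_at A0 z f g"
    by (rule section_A0_local[OF assms])
  show thesis by (rule that[OF *(1,2)]) (use *(4,6) in blast)+
qed

text \<open>Multiplying numerator and denominator of a fraction on chart \<open>i\<close> by a
  monomial invertible there turns it into a fraction of polynomials. So sections are locally pulled
  back from affine space.\<close>

lemma section_X_cleared:
  assumes "t \<in> carrier (structure_sheaf X U)" "x \<in> U"
  obtains f g V' where "keys f \<subseteq> S0" "keys g \<subseteq> S0"
    "openin (zariski X) V'" "x \<in> V'" "V' \<subseteq> U"
    "\<forall>z\<in>V'. g \<notin> snd (\<phi> z) \<and> t z = germ_at X z (\<iota> f) (\<iota> g)"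
proof -
  obtain i f' g' V' where *: "i \<in> charts X" "keys f' \<subseteq> mon X i" "keys g' \<subseteq> mon X i"
    "openin (zariski X) V'" "x \<in> V'" "V' \<subseteq> U" "V' \<subseteq> chart_open X i"
    "\<forall>z\<in>V'. g' \<notin> snd z \<and> t z = germ_at X z f' g'"
    by (rule section_X_local[OF assms])
  obtain u where u: "u \<in> N" "keys u \<subseteq> Y - G i"
    "keys (monomial u * f') \<subseteq> N" "keys (monomial u * g') \<subseteq> N"
    by (rule clear_denominators2[OF *(1-3)])
  obtain f where f: "keys f \<subseteq> S0" "\<iota> f = monomial u * f'" by (rule \<iota>_surj[OF u(3)])
  obtain g where g: "keys g \<subseteq> S0" "\<iota> g = monomial u * g'" by (rule \<iota>_surj[OF u(4)])
  have "g \<notin> snd (\<phi> z) \<and> t z = germ_at X z (\<iota> f) (\<iota> g)" if z: "z \<in> V'" for z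
  proof -
    have zi: "z \<in> chart_open X i" using *(7) z by blast
    have zp: "z \<in> pts X" and Gz: "Gp z \<subseteq> G i" using chart_openD[OF zi *(1)] by simp_all
    interpret D: domain_prime "mon X (fst z)" "snd z" by (rule domain_prime_pts[OF zp])
    have mm: "mon X i \<subseteq> mon X (fst z)" by (rule mon_mono[OF *(1) ptsD(1)[OF zp] Gz])
    have f'C: "f' \<in> D.C" and g'C: "g' \<in> D.C" using *(2,3) mm by (simp_all add: subset_trans)
    have uz: "keys u \<subseteq> Y - Gp z" using u(2) Gz by blast
    have g'z: "g' \<notin> snd z" and tz: "t z = germ_at X z f' g'" using *(8) z by blast+
    have gz: "\<iota> g \<notin> snd z" unfolding g(2) using mem_snd_iff_cleared[OF zp g'C uz] g'z by blast
    have \<iota>C: "\<iota> a \<in> D.C" for a using \<iota>_mon[OF zp] by simp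
    have "f' * \<iota> g = \<iota> f * g'" unfolding f(2) g(2) by (simp only: mult_ac)
    then have "germ_at X z f' g' = germ_at X z (\<iota> f) (\<iota> g)"
      unfolding germ_at_X[OF zp] using D.germ_eq_iff[OF f'C g'C g'z \<iota>C \<iota>C gz] by blast
    then show ?thesis using tz gz snd_\<phi>[OF g(1), of z] by simp
  qed
  then have "\<forall>z\<in>V'. g \<notin> snd (\<phi> z) \<and> t z = germ_at X z (\<iota> f) (\<iota> g)" by (rule ballI)
  then show thesis by (rule that[OF f(1) g(1) *(4-6)])
qed

lemma preim_pts: "x \<in> preim V \<Longrightarrow> x \<in> pts X" and preim_\<phi>: "x \<in> preim V \<Longrightarrow> \<phi> x \<in> V"
  by (simp_all add: preim_def)

lemma openin_preim: "openin (zariski A0) V \<Longrightarrow> openin (zariski X) (preim V)"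
  using openin_continuous_map_preimage[OF homeomorphic_imp_continuous_map[OF homeomorphic_\<phi>], of V]
  unfolding preim_def topspace_X by simp

lemma openin_A0_subset: "openin (zariski A0) V \<Longrightarrow> V \<subseteq> pts A0"
  using openin_subset topspace_A0 by metis

lemma \<theta>_germ:
  assumes "x \<in> preim V" "keys f \<subseteq> S0" "keys g \<subseteq> S0" "g \<notin> snd (\<phi> x)"
    "s (\<phi> x) = germ_at A0 (\<phi> x) f g"
  shows "\<theta> V s x = germ_at X x (\<iota> f) (\<iota> g)"
  unfolding \<theta>_def using stalk_map_germ[OF preim_pts[OF assms(1)] assms(2-4)] assms(1,5) by simp

text \<open>Numerators and denominators pulled back by \<open>\<iota>\<close> lie in
  \<open>K[N]\<close>, so the largest chart serves for all local representations.\<close>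

lemma \<theta>_carrier:
  assumes s: "s \<in> carrier (structure_sheaf A0 V)" and V: "openin (zariski A0) V"
  shows "\<theta> V s \<in> carrier (structure_sheaf X (preim V))"
proof -
  obtain t where t: "t \<in> charts X" "G t = Y" "mon X t = N" "chart_open X t = pts X" by (rule top_chart)
  have "\<exists>i \<in> charts X. \<exists>f \<in> carrier (monoid_algebra (mon X i)).
          \<exists>g \<in> carrier (monoid_algebra (mon X i)). \<exists>V'.
            openin (zariski X) V' \<and> x \<in> V' \<and> V' \<subseteq> preim V \<inter> chart_open X i \<and>
            (\<forall>z \<in> V'. g \<notin> snd z \<and> \<theta> V s z = germ_at X z f g)" if x: "x \<in> preim V" for x
  proof -
    obtain f g V' where *: "keys f \<subseteq> S0" "keys g \<subseteq> S0" "openin (zariski A0) V'"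
      "\<phi> x \<in> V'" "V' \<subseteq> V" "\<forall>z\<in>V'. g \<notin> snd z \<and> s z = germ_at A0 z f g"
      by (rule section_A0_local[OF s preim_\<phi>[OF x]])
    have "\<iota> g \<notin> snd z \<and> \<theta> V s z = germ_at X z (\<iota> f) (\<iota> g)" if z: "z \<in> preim V'" for z
    proof -
      have zV: "z \<in> preim V" using z *(5) by (auto simp: preim_def)
      have gz: "g \<notin> snd (\<phi> z)" and sz: "s (\<phi> z) = germ_at A0 (\<phi> z) f g" using *(6) preim_\<phi>[OF z] by blast+
      show ?thesis using \<theta>_germ[where s = s, OF zV *(1,2) gz sz] gz snd_\<phi>[OF *(2), of z] by simp
    qed
    moreover have "x \<in> preim V'" using x *(4) by (simp add: preim_def)
    moreover have "preim V' \<subseteq> preim V \<inter> chart_open X t" using *(5) t(4) by (auto simp: preim_def)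
    moreover have "\<iota> f \<in> carrier (monoid_algebra (mon X t))" "\<iota> g \<in> carrier (monoid_algebra (mon X t))"
      using \<iota>_N t(3) by (simp_all add: carrier_monoid_algebra)
    ultimately show ?thesis using t(1) openin_preim[OF *(3)]
      by (intro bexI[of _ t] bexI[of _ "\<iota> f"] bexI[of _ "\<iota> g"] exI[of _ "preim V'"]) simp_all
  qed
  then show ?thesis by (simp add: structure_sheaf_def \<theta>_def)
qed

lemma \<theta>_ring_hom:
  assumes V: "openin (zariski A0) V"
  shows "\<theta> V \<in> ring_hom (structure_sheaf A0 V) (structure_sheaf X (preim V))"
proof (rule ring_hom_memI)
  fix s assume s: "s \<in> carrier (structure_sheaf A0 V)"
  show "\<theta> V s \<in> carrier (structure_sheaf X (preim V))" by (rule \<theta>_carrier[OF s V])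
  fix t assume t: "t \<in> carrier (structure_sheaf A0 V)"
  have *: "\<theta> V (s \<otimes>\<^bsub>structure_sheaf A0 V\<^esub> t) x = (\<theta> V s \<otimes>\<^bsub>structure_sheaf X (preim V)\<^esub> \<theta> V t) x \<and>
     \<theta> V (s \<oplus>\<^bsub>structure_sheaf A0 V\<^esub> t) x = (\<theta> V s \<oplus>\<^bsub>structure_sheaf X (preim V)\<^esub> \<theta> V t) x" if x: "x \<in> preim V" for x
  proof -
    have xp: "x \<in> pts X" and xV: "\<phi> x \<in> V" using preim_pts[OF x] preim_\<phi>[OF x] by simp_all
    obtain f g where f: "keys f \<subseteq> S0" "keys g \<subseteq> S0" "g \<notin> snd (\<phi> x)" "s (\<phi> x) = germ_at A0 (\<phi> x) f g"
      by (rule section_A0_germ[OF s xV])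
    obtain f' g' where f': "keys f' \<subseteq> S0" "keys g' \<subseteq> S0" "g' \<notin> snd (\<phi> x)" "t (\<phi> x) = germ_at A0 (\<phi> x) f' g'"
      by (rule section_A0_germ[OF t xV])
    interpret D0: domain_prime S0 "snd (\<phi> x)" by (rule domain_prime_affine[OF \<phi>_pts[OF xp]])
    have gx: "\<iota> g \<notin> snd x" "\<iota> g' \<notin> snd x" using snd_\<phi>[OF f(2), of x] snd_\<phi>[OF f'(2), of x] f(3) f'(3) by simp_all
    have keys: "keys (f * f') \<subseteq> S0" "keys (g * g') \<subseteq> S0" "keys (f * g' + f' * g) \<subseteq> S0"
      using D0.C_mult D0.C_add f(1,2) f'(1,2) by simp_all
    have gg: "g * g' \<notin> snd (\<phi> x)" using D0.q_mult f(2,3) f'(2,3) by simp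
    have "(s \<otimes>\<^bsub>structure_sheaf A0 V\<^esub> t) (\<phi> x) = germ_at A0 (\<phi> x) (f * f') (g * g')"
      using germ_mult_A0(1)[OF \<phi>_pts[OF xp] f(1-3) f'(1-3)] f(4) f'(4) xV by (simp add: structure_sheaf_def)
    then have 1: "\<theta> V (s \<otimes>\<^bsub>structure_sheaf A0 V\<^esub> t) x = germ_at X x (\<iota> (f * f')) (\<iota> (g * g'))"
      by (rule \<theta>_germ[OF x keys(1,2) gg])
    have "(s \<oplus>\<^bsub>structure_sheaf A0 V\<^esub> t) (\<phi> x) = germ_at A0 (\<phi> x) (f * g' + f' * g) (g * g')"
      using germ_mult_A0(2)[OF \<phi>_pts[OF xp] f(1-3) f'(1-3)] f(4) f'(4) xV by (simp add: structure_sheaf_def)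
    then have 2: "\<theta> V (s \<oplus>\<^bsub>structure_sheaf A0 V\<^esub> t) x = germ_at X x (\<iota> (f * g' + f' * g)) (\<iota> (g * g'))"
      by (rule \<theta>_germ[OF x keys(3,2) gg])
    have 3: "\<theta> V s x = germ_at X x (\<iota> f) (\<iota> g)" "\<theta> V t x = germ_at X x (\<iota> f') (\<iota> g')"
      by (rule \<theta>_germ[where s = s, OF x f] \<theta>_germ[where s = t, OF x f'])+
    have "(\<theta> V s \<otimes>\<^bsub>structure_sheaf X (preim V)\<^esub> \<theta> V t) x = germ_mult X x (\<theta> V s x) (\<theta> V t x)"
      "(\<theta> V s \<oplus>\<^bsub>structure_sheaf X (preim V)\<^esub> \<theta> V t) x = germ_add X x (\<theta> V s x) (\<theta> V t x)"
      using x by (simp_all add: structure_sheaf_def)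
    then show ?thesis
      unfolding 1 2 3 \<iota>_mult \<iota>_add
      using germ_mult_X[OF xp \<iota>_mon[OF xp] \<iota>_mon[OF xp] gx(1) \<iota>_mon[OF xp] \<iota>_mon[OF xp] gx(2), of f f'] by simp
  qed
  show "\<theta> V (s \<otimes>\<^bsub>structure_sheaf A0 V\<^esub> t) = \<theta> V s \<otimes>\<^bsub>structure_sheaf X (preim V)\<^esub> \<theta> V t"
  proof
    fix x show "\<theta> V (s \<otimes>\<^bsub>structure_sheaf A0 V\<^esub> t) x = (\<theta> V s \<otimes>\<^bsub>structure_sheaf X (preim V)\<^esub> \<theta> V t) x"
      using *[of x] by (cases "x \<in> preim V") (simp, simp add: \<theta>_def structure_sheaf_def)
  qed
  show "\<theta> V (s \<oplus>\<^bsub>structure_sheaf A0 V\<^esub> t) = \<theta> V s \<oplus>\<^bsub>structure_sheaf X (preim V)\<^esub> \<theta> V t"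
  proof
    fix x show "\<theta> V (s \<oplus>\<^bsub>structure_sheaf A0 V\<^esub> t) x = (\<theta> V s \<oplus>\<^bsub>structure_sheaf X (preim V)\<^esub> \<theta> V t) x"
      using *[of x] by (cases "x \<in> preim V") (simp, simp add: \<theta>_def structure_sheaf_def)
  qed
next
  show "\<theta> V \<one>\<^bsub>structure_sheaf A0 V\<^esub> = \<one>\<^bsub>structure_sheaf X (preim V)\<^esub>"
  proof
    fix x
    show "\<theta> V \<one>\<^bsub>structure_sheaf A0 V\<^esub> x = \<one>\<^bsub>structure_sheaf X (preim V)\<^esub> x"
    proof (cases "x \<in> preim V")
      case True
      interpret D0: domain_prime S0 "snd (\<phi> x)" by (rule domain_prime_affine[OF \<phi>_pts[OF preim_pts[OF True]]])
      have "\<one>\<^bsub>structure_sheaf A0 V\<^esub> (\<phi> x) = germ_at A0 (\<phi> x) 1 1"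
        using preim_\<phi>[OF True] by (simp add: structure_sheaf_def)
      then have "\<theta> V \<one>\<^bsub>structure_sheaf A0 V\<^esub> x = germ_at X x (\<iota> 1) (\<iota> 1)"
        using D0.one_C D0.one_q by (intro \<theta>_germ[OF True]) simp_all
      then show ?thesis using True by (simp add: \<iota>_1 structure_sheaf_def)
    qed (simp add: \<theta>_def structure_sheaf_def)
  qed
qed

text \<open>Equal images mean that the cross products agree after applying \<open>\<iota>\<close>,
  which is injective on polynomials.\<close>

lemma \<theta>_inj:
  assumes V: "openin (zariski A0) V"
  shows "inj_on (\<theta> V) (carrier (structure_sheaf A0 V))"
proof (rule inj_onI)
  fix s t assume s: "s \<in> carrier (structure_sheaf A0 V)" and t: "t \<in> carrier (structure_sheaf A0 V)"
    and eq: "\<theta> V s = \<theta> V t"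
  have ext: "s \<in> extensional V" "t \<in> extensional V" using s t by (simp_all add: structure_sheaf_def)
  show "s = t"
  proof (rule extensionalityI[OF ext])
    fix y assume y: "y \<in> V"
    then have yp: "y \<in> pts A0" using openin_A0_subset[OF V] by blast
    obtain x where xp: "x \<in> pts X" and xy: "\<phi> x = y" using surj_\<phi>[OF yp] by blast
    have x: "x \<in> preim V" using xp xy y by (simp add: preim_def)
    have xV: "\<phi> x \<in> V" using xy y by simp
    obtain f g where f: "keys f \<subseteq> S0" "keys g \<subseteq> S0" "g \<notin> snd (\<phi> x)" "s (\<phi> x) = germ_at A0 (\<phi> x) f g"
      by (rule section_A0_germ[OF s xV])
    obtain f' g' where f': "keys f' \<subseteq> S0" "keys g' \<subseteq> S0" "g' \<notin> snd (\<phi> x)" "t (\<phi> x) = germ_at A0 (\<phi> x) f' g'"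
      by (rule section_A0_germ[OF t xV])
    interpret D: domain_prime "mon X (fst x)" "snd x" by (rule domain_prime_pts[OF xp])
    interpret D0: domain_prime S0 "snd (\<phi> x)" by (rule domain_prime_affine[OF \<phi>_pts[OF xp]])
    have \<iota>C: "\<iota> a \<in> D.C" for a using \<iota>_mon[OF xp] by simp
    have gx: "\<iota> g \<notin> snd x" "\<iota> g' \<notin> snd x" using snd_\<phi>[OF f(2), of x] snd_\<phi>[OF f'(2), of x] f(3) f'(3) by simp_all
    have "germ_at X x (\<iota> f) (\<iota> g) = germ_at X x (\<iota> f') (\<iota> g')"
      using \<theta>_germ[where s = s, OF x f] \<theta>_germ[where s = t, OF x f'] eq by simp
    then have "\<iota> f * \<iota> g' = \<iota> f' * \<iota> g"
      unfolding germ_at_X[OF xp] using D.germ_eq_iff[OF \<iota>C \<iota>C gx(1) \<iota>C \<iota>C gx(2)] by blast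
    then have "\<iota> (f * g') = \<iota> (f' * g)" by (simp only: \<iota>_mult)
    moreover have "f * g' \<in> D0.C" "f' * g \<in> D0.C" using D0.C_mult f(1,2) f'(1,2) by simp_all
    ultimately have "f * g' = f' * g" by (rule inj_onD[OF inj_\<iota>])
    then have "s (\<phi> x) = t (\<phi> x)"
      unfolding f(4) f'(4) germ_at_A0
      using D0.germ_eq_iff[of f g f' g'] f(1-3) f'(1-3) by simp
    then show "s y = t y" using xy by simp
  qed
qed

lemma \<theta>_surj:
  assumes V: "openin (zariski A0) V" and t: "t \<in> carrier (structure_sheaf X (preim V))"
  shows "\<exists>s\<in>carrier (structure_sheaf A0 V). \<theta> V s = t"
proof -
  \<comment> \<open>All fractions whose image under \<open>\<iota>\<close> represents the germ of
    \<open>t\<close> at the point over \<open>y\<close>. That point is unique since \<phi> is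
    injective, so the inner quantifier merely names it.\<close>
  define s where "s = (\<lambda>y\<in>V. {(a, b). keys a \<subseteq> S0 \<and> keys b \<subseteq> S0 \<and> b \<notin> snd y \<and>
      (\<forall>x\<in>pts X. \<phi> x = y \<longrightarrow> (\<iota> a, \<iota> b) \<in> t x)})"
  have s_germ: "s (\<phi> x) = germ_at A0 (\<phi> x) f g"
    if x: "x \<in> preim V" and f: "keys f \<subseteq> S0" and g: "keys g \<subseteq> S0" "g \<notin> snd (\<phi> x)"
      and tx: "t x = germ_at X x (\<iota> f) (\<iota> g)" for x f g
  proof -
    have xp: "x \<in> pts X" by (rule preim_pts[OF x])
    interpret D: domain_prime "mon X (fst x)" "snd x" by (rule domain_prime_pts[OF xp])
    interpret D0: domain_prime S0 "snd (\<phi> x)" by (rule domain_prime_affine[OF \<phi>_pts[OF xp]])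
    have \<iota>C: "\<iota> a \<in> D.C" for a using \<iota>_mon[OF xp] by simp
    have uniq: "(\<forall>x'\<in>pts X. \<phi> x' = \<phi> x \<longrightarrow> (\<iota> a, \<iota> b) \<in> t x') \<longleftrightarrow> (\<iota> a, \<iota> b) \<in> t x" for a b
      using inj_onD[OF inj_\<phi> _ _ xp] xp by metis
    have iff: "(\<iota> a, \<iota> b) \<in> t x \<longleftrightarrow> f * b = a * g"
      if a: "keys a \<subseteq> S0" and b: "keys b \<subseteq> S0" "b \<notin> snd (\<phi> x)" for a b
    proof -
      have bx: "\<iota> b \<notin> snd x" using snd_\<phi>[OF b(1), of x] b(2) by simp
      have "f * b \<in> D0.C" "a * g \<in> D0.C" using D0.C_mult f g(1) a b(1) by simp_all
      then have "\<iota> (f * b) = \<iota> (a * g) \<longleftrightarrow> f * b = a * g" by (rule inj_on_eq_iff[OF inj_\<iota>])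
      then show ?thesis
        unfolding tx germ_at_X[OF xp] D.mem_germ_iff[OF \<iota>C \<iota>C] using \<iota>C bx by (simp add: \<iota>_mult)
    qed
    show ?thesis
    proof (rule Set.set_eqI)
      fix ab :: "((nat \<Rightarrow>\<^sub>0 nat) \<Rightarrow>\<^sub>0 'k) \<times> ((nat \<Rightarrow>\<^sub>0 nat) \<Rightarrow>\<^sub>0 'k)"
      obtain a b where ab: "ab = (a, b)" by (cases ab)
      have "ab \<in> s (\<phi> x) \<longleftrightarrow> keys a \<subseteq> S0 \<and> keys b \<subseteq> S0 \<and> b \<notin> snd (\<phi> x) \<and> (\<iota> a, \<iota> b) \<in> t x"
        unfolding s_def using preim_\<phi>[OF x] uniq by (simp add: ab)
      also have "\<dots> \<longleftrightarrow> ab \<in> germ_at A0 (\<phi> x) f g"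
        unfolding ab germ_at_A0 using D0.mem_germ_iff[of f g a b] f g(1) iff[of a b] by auto
      finally show "ab \<in> s (\<phi> x) \<longleftrightarrow> ab \<in> germ_at A0 (\<phi> x) f g" .
    qed
  qed
  have "\<exists>i \<in> charts A0. \<exists>f \<in> carrier (monoid_algebra (mon A0 i)).
          \<exists>g \<in> carrier (monoid_algebra (mon A0 i)). \<exists>V'.
            openin (zariski A0) V' \<and> y \<in> V' \<and> V' \<subseteq> V \<inter> chart_open A0 i \<and>
            (\<forall>z \<in> V'. g \<notin> snd z \<and> s z = germ_at A0 z f g)" if y: "y \<in> V" for y
  proof -
    have yp: "y \<in> pts A0" using openin_A0_subset[OF V] y by blast
    obtain x where xp: "x \<in> pts X" and xy: "\<phi> x = y" using surj_\<phi>[OF yp] by blast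
    have x: "x \<in> preim V" using xp xy y by (simp add: preim_def)
    obtain f g V' where *: "keys f \<subseteq> S0" "keys g \<subseteq> S0"
      "openin (zariski X) V'" "x \<in> V'" "V' \<subseteq> preim V"
      "\<forall>z\<in>V'. g \<notin> snd (\<phi> z) \<and> t z = germ_at X z (\<iota> f) (\<iota> g)"
      by (rule section_X_cleared[OF t x])
    have op: "openin (zariski A0) (\<phi> ` V')"
      using homeomorphic_imp_open_map[OF homeomorphic_\<phi>] *(3) by (simp add: open_map_def)
    have "g \<notin> snd z \<and> s z = germ_at A0 z f g" if z: "z \<in> \<phi> ` V'" for z
    proof -
      obtain x' where x': "x' \<in> V'" "z = \<phi> x'" using z by blast
      have "x' \<in> preim V" using x'(1) *(5) by blast
      then show ?thesis using s_germ[of x' f g] *(1,2,6) x' by blast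
    qed
    moreover have "y \<in> \<phi> ` V'" using *(4) xy by blast
    moreover have "\<phi> ` V' \<subseteq> V \<inter> chart_open A0 ()"
      using *(5) openin_A0_subset[OF V] by (auto simp: preim_def chart_open_affine)
    ultimately show ?thesis using op *(1,2)
      by (intro bexI[of _ "()"] bexI[of _ f] bexI[of _ g] exI[of _ "\<phi> ` V'"]) (simp_all add: carrier_monoid_algebra)
  qed
  then have s: "s \<in> carrier (structure_sheaf A0 V)" by (simp add: structure_sheaf_def s_def)
  have ext: "t \<in> extensional (preim V)" using t by (simp add: structure_sheaf_def)
  have "\<theta> V s = t"
  proof (rule extensionalityI[OF _ ext])
    show "\<theta> V s \<in> extensional (preim V)" by (simp add: \<theta>_def)
    fix x assume x: "x \<in> preim V"
    obtain f g V' where *: "keys f \<subseteq> S0" "keys g \<subseteq> S0"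
      "openin (zariski X) V'" "x \<in> V'" "V' \<subseteq> preim V"
      "\<forall>z\<in>V'. g \<notin> snd (\<phi> z) \<and> t z = germ_at X z (\<iota> f) (\<iota> g)"
      by (rule section_X_cleared[OF t x])
    have gx: "g \<notin> snd (\<phi> x)" and tx: "t x = germ_at X x (\<iota> f) (\<iota> g)" using *(4,6) by blast+
    show "\<theta> V s x = t x" unfolding tx by (rule \<theta>_germ[where s = s, OF x *(1,2) gx s_germ[OF x *(1,2) gx tx]])
  qed
  then show ?thesis using s by blast
qed

lemma k_isomorphic_affine_space: "k_isomorphic (scheme_of X) (affine_space n)"
proof -
  have preim_eq: "{x \<in> topspace (zariski X). \<phi> x \<in> V} = preim V" for V
    by (simp add: topspace_X preim_def)
  have main: "\<theta> V \<in> ring_iso (structure_sheaf A0 V) (structure_sheaf X (preim V)) \<and>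
       (\<forall>c. \<theta> V (const (affine_space n) V c) = const (scheme_of X) (preim V) c) \<and>
       (\<forall>V' s. openin (zariski A0) V' \<and> V' \<subseteq> V \<and> s \<in> carrier (structure_sheaf A0 V) \<longrightarrow>
          \<theta> V' (restrict s V') = restrict (\<theta> V s) (preim V'))"
    if V: "openin (zariski A0) V" for V
  proof (intro conjI allI impI)
    have "\<theta> V ` carrier (structure_sheaf A0 V) = carrier (structure_sheaf X (preim V))"
    proof
      show "\<theta> V ` carrier (structure_sheaf A0 V) \<subseteq> carrier (structure_sheaf X (preim V))"
        by (rule image_subsetI) (rule \<theta>_carrier[OF _ V])
      show "carrier (structure_sheaf X (preim V)) \<subseteq> \<theta> V ` carrier (structure_sheaf A0 V)"
      proof
        fix t assume "t \<in> carrier (structure_sheaf X (preim V))"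
        then obtain s where "s \<in> carrier (structure_sheaf A0 V)" "\<theta> V s = t" using \<theta>_surj[OF V] by blast
        then show "t \<in> \<theta> V ` carrier (structure_sheaf A0 V)" by blast
      qed
    qed
    then show "\<theta> V \<in> ring_iso (structure_sheaf A0 V) (structure_sheaf X (preim V))"
      using \<theta>_ring_hom[OF V] \<theta>_inj[OF V] by (simp add: ring_iso_def bij_betw_def)
    fix c
    show "\<theta> V (const (affine_space n) V c) = const (scheme_of X) (preim V) c"
    proof
      fix x
      show "\<theta> V (const (affine_space n) V c) x = const (scheme_of X) (preim V) c x"
      proof (cases "x \<in> preim V")
        case True
        interpret D0: domain_prime S0 "snd (\<phi> x)" by (rule domain_prime_affine[OF \<phi>_pts[OF preim_pts[OF True]]])
        have "const (affine_space n) V c (\<phi> x) = germ_at A0 (\<phi> x) (single 0 c) 1"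
          using preim_\<phi>[OF True] by (simp add: scheme_of_def)
        then have "\<theta> V (const (affine_space n) V c) x = germ_at X x (\<iota> (single 0 c)) (\<iota> 1)"
          using D0.one_C D0.one_q by (intro \<theta>_germ[OF True]) simp_all
        then show ?thesis using True by (simp add: \<iota>_1 \<iota>_const scheme_of_def)
      qed (simp add: \<theta>_def scheme_of_def)
    qed
  next
    fix V' s
    assume *: "openin (zariski A0) V' \<and> V' \<subseteq> V \<and> s \<in> carrier (structure_sheaf A0 V)"
    show "\<theta> V' (restrict s V') = restrict (\<theta> V s) (preim V')"
    proof
      fix x
      show "\<theta> V' (restrict s V') x = restrict (\<theta> V s) (preim V') x"
      proof (cases "x \<in> preim V'")
        case True
        then have "x \<in> preim V" using * by (auto simp: preim_def)
        then show ?thesis using True preim_\<phi>[OF True] by (simp add: \<theta>_def)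
      qed (simp add: \<theta>_def)
    qed
  qed
  show ?thesis
    unfolding k_isomorphic_def Let_def topo_scheme_of sheaf_scheme_of
    by (intro exI[of _ \<phi>] exI[of _ \<theta>] conjI[OF homeomorphic_\<phi>] allI impI, unfold preim_eq)
      (rule main)
qed

end

section \<open>Arrangements without relations\<close>

definition orthant :: "'x set \<Rightarrow> ('x \<Rightarrow>\<^sub>0 real) set" where
  "orthant G = {v. keys v \<subseteq> G \<and> (\<forall>x. lookup v x \<ge> 0)}"

lemma single_in_orthant: "single x 1 \<in> orthant G \<longleftrightarrow> x \<in> G"
  by (auto simp: orthant_def lookup_single when_def)

lemma orthant_subset_iff: "orthant G \<subseteq> orthant H \<longleftrightarrow> G \<subseteq> H"
proof
  assume *: "orthant G \<subseteq> orthant H"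
  show "G \<subseteq> H"
  proof
    fix x assume "x \<in> G"
    then have "single x 1 \<in> orthant G" by (simp add: single_in_orthant)
    then have "single x 1 \<in> orthant H" using * by (rule subsetD[rotated])
    then show "x \<in> H" by (simp add: single_in_orthant)
  qed
qed (auto simp: orthant_def)

lemma orthant_lookup_eq_0: "v \<in> orthant G \<Longrightarrow> x \<notin> G \<Longrightarrow> lookup v x = 0"
  by (auto simp: orthant_def in_keys_iff)

lemma orthantI:
  assumes "\<And>x. x \<notin> G \<Longrightarrow> lookup v x = 0" "\<And>x. lookup v x \<ge> 0"
  shows "v \<in> orthant G"
  using assms by (auto simp: orthant_def in_keys_iff)

lemma convex_orthant: "convex (orthant G)"
proof (rule convexI)
  fix v w and s t :: real assume *: "v \<in> orthant G" "w \<in> orthant G" "0 \<le> s" "0 \<le> t"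
  then have "lookup v x \<ge> 0" "lookup w x \<ge> 0" for x by (simp_all add: orthant_def)
  then show "s *\<^sub>R v + t *\<^sub>R w \<in> orthant G"
    using * orthant_lookup_eq_0[OF *(1)] orthant_lookup_eq_0[OF *(2)]
    by (intro orthantI) (simp_all add: lookup_add)
qed

text \<open>A coordinate that vanishes at an inner point of a segment between nonnegative vectors
  vanishes at both ends.\<close>

lemma orthant_face_of:
  assumes "G \<subseteq> H"
  shows "orthant G face_of orthant H"
  unfolding face_of_def
proof (intro conjI ballI impI)
  show "orthant G \<subseteq> orthant H" using assms by (simp add: orthant_subset_iff)
  show "convex (orthant G)" by (rule convex_orthant)
  fix a b v assume a: "a \<in> orthant H" and b: "b \<in> orthant H" and v: "v \<in> orthant G" and seg: "v \<in> open_segment a b"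
  obtain t where t: "0 < t" "t < 1" "v = (1 - t) *\<^sub>R a + t *\<^sub>R b" using seg by (auto simp: in_segment)
  have nn: "lookup a x \<ge> 0" "lookup b x \<ge> 0" for x using a b by (simp_all add: orthant_def)
  have "lookup a x = 0 \<and> lookup b x = 0" if "x \<notin> G" for x
  proof -
    have "0 = (1 - t) * lookup a x + t * lookup b x"
      using orthant_lookup_eq_0[OF v that] unfolding t(3) by (simp add: lookup_add)
    moreover have "(1 - t) * lookup a x \<ge> 0" "t * lookup b x \<ge> 0" using t nn by simp_all
    ultimately have "(1 - t) * lookup a x = 0" "t * lookup b x = 0" by linarith+
    then show ?thesis using t by simp
  qed
  then show "a \<in> orthant G" "b \<in> orthant G" using nn by (auto intro!: orthantI)
qed

text \<open>Let \<open>v\<close> be a vector of the face with largest support. Midpoints with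
  \<open>v\<close> show that the whole face has support in \<open>keys v\<close>. Conversely
  \<open>v\<close> is in the relative interior of the orthant on its support, so a segment from any
  \<open>w\<close> there can be prolonged beyond \<open>v\<close>, and the face property yields
  \<open>w\<close>.\<close>

lemma face_of_orthant:
  assumes F: "F face_of orthant Y" and "F \<noteq> {}" "finite Y"
  shows "\<exists>G\<subseteq>Y. F = orthant G"
proof -
  have FY: "F \<subseteq> orthant Y" and conv: "convex F" using F by (auto simp: face_of_def)
  obtain v0 where "v0 \<in> F" using assms(2) by blast
  have "\<forall>v. v \<in> F \<longrightarrow> card (keys v) < Suc (card Y)"
    using FY assms(3) by (intro allI impI le_imp_less_Suc card_mono) (auto simp: orthant_def)
  from Lattices_Big.ex_has_greatest_nat[where P = "\<lambda>v. v \<in> F" and f = "\<lambda>v. card (keys v)", OF \<open>v0 \<in> F\<close> this]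
  obtain v where v: "v \<in> F" and max: "\<And>w. w \<in> F \<Longrightarrow> card (keys w) \<le> card (keys v)"
    by auto
  let ?G = "keys v"
  have v0: "lookup v x \<ge> 0" for x using v FY by (auto simp: orthant_def)
  have "w \<in> orthant ?G" if w: "w \<in> F" for w
  proof -
    have w0: "lookup w x \<ge> 0" for x using w FY by (auto simp: orthant_def)
    let ?m = "(1/2) *\<^sub>R v + (1/2) *\<^sub>R w"
    have "?m \<in> F" using convexD[OF conv v w, of "1/2" "1/2"] by simp
    then have le: "card (keys ?m) \<le> card ?G" by (rule max)
    \<comment> \<open>Nonnegative entries cannot cancel, so the support of the midpoint is the
      union.\<close>
    have keys: "keys ?m = ?G \<union> keys w"
    proof (rule Set.set_eqI)
      fix x show "x \<in> keys ?m \<longleftrightarrow> x \<in> ?G \<union> keys w"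
        using v0[of x] w0[of x] by (auto simp: in_keys_iff lookup_add)
    qed
    have "?G = keys ?m" by (rule card_seteq) (use le keys in auto)
    then have "keys w \<subseteq> ?G" using keys by blast
    then show ?thesis using w0 by (simp add: orthant_def)
  qed
  moreover have "w \<in> F" if w: "w \<in> orthant ?G" for w
  proof -
    have w0: "lookup w x \<ge> 0" for x using w by (simp add: orthant_def)
    \<comment> \<open>Small enough for \<open>v - \<epsilon> *\<^sub>R w\<close> to stay
      nonnegative; the bound 1/2 keeps \<open>1 - \<epsilon>\<close> positive, and the summand 1
      avoids division by zero.\<close>
    define \<epsilon> where "\<epsilon> = Min (insert (1/2) ((\<lambda>x. lookup v x / (lookup w x + 1)) ` ?G))"
    have pos: "lookup v x > 0" if "x \<in> ?G" for x
      using that v0[of x] by (simp add: in_keys_iff)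
    have w1: "lookup w x + 1 > 0" for x using w0[of x] by linarith
    have \<epsilon>: "\<epsilon> > 0" unfolding \<epsilon>_def by (subst Min_gr_iff) (use pos w1 in auto)
    have \<epsilon>1: "\<epsilon> \<le> 1/2" unfolding \<epsilon>_def by (rule Min_le) auto
    have le: "\<epsilon> * lookup w x \<le> lookup v x" for x
    proof (cases "x \<in> ?G")
      case True
      have "\<epsilon> \<le> lookup v x / (lookup w x + 1)"
        unfolding \<epsilon>_def by (rule Min_le) (use True in auto)
      then have "\<epsilon> * (lookup w x + 1) \<le> lookup v x"
        using w1[of x] by (simp add: pos_le_divide_eq)
      then show ?thesis using \<epsilon> by (simp add: algebra_simps)
    next
      case False
      then show ?thesis using orthant_lookup_eq_0[OF w False] v0[of x] by simp
    qed
    \<comment> \<open>The far end of the prolonged segment, obtained by solving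
      \<open>v = (1 - \<epsilon>) *\<^sub>R b + \<epsilon> *\<^sub>R w\<close> for
      \<open>b\<close>.\<close>
    define b where "b = (1 / (1 - \<epsilon>)) *\<^sub>R (v - \<epsilon> *\<^sub>R w)"
    have GY: "?G \<subseteq> Y" using v FY by (auto simp: orthant_def)
    have "b \<in> orthant ?G"
    proof (rule orthantI)
      fix x
      show "lookup b x \<ge> 0" using le[of x] \<epsilon>1 by (simp add: b_def lookup_minus)
      show "lookup b x = 0" if "x \<notin> ?G"
        using orthant_lookup_eq_0[OF w that] that by (simp add: b_def lookup_minus in_keys_iff)
    qed
    then have bY: "b \<in> orthant Y" using orthant_subset_iff[of ?G Y] GY by blast
    have wY: "w \<in> orthant Y" using w orthant_subset_iff[of ?G Y] GY by blast
    have "(1 - \<epsilon>) *\<^sub>R b = v - \<epsilon> *\<^sub>R w" using \<epsilon>1 by (simp add: b_def)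
    then have veq: "v = (1 - \<epsilon>) *\<^sub>R b + \<epsilon> *\<^sub>R w" by simp
    show ?thesis
    \<comment> \<open>For \<open>b = w\<close> the open segment is empty and the face property
      yields nothing, but then \<open>v = w\<close>.\<close>
    proof (cases "b = w")
      case True
      then have "v = w" using veq by (simp flip: scaleR_left_distrib)
      then show ?thesis using v by simp
    next
      case False
      then have "v \<in> open_segment b w" using veq \<epsilon> \<epsilon>1 by (auto simp: in_segment intro!: exI[of _ \<epsilon>])
      then show ?thesis using face_ofD[OF F _ bY wY v] by blast
    qed
  qed
  moreover have "?G \<subseteq> Y" using v FY by (auto simp: orthant_def)
  ultimately show ?thesis by blast
qed

lemma convex_cone_sum:
  assumes "convex_cone S" "finite I" "\<And>i. i \<in> I \<Longrightarrow> f i \<in> S"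
  shows "sum f I \<in> S"
  using assms(2,3) by (induction I) (auto simp: convex_cone_contains_0[OF assms(1)] convex_cone_add[OF assms(1)])

context spanning_arrangement
begin

context
  assumes no_relations: "\<And>c. c \<in> relations A \<Longrightarrow> c = 0"
begin

text \<open>The matrix of the \<open>a\<^sub>e\<close> and that of lifts of the unit vectors are inverse to each other, so
  that their two products have the same trace.\<close>

lemma card_idx_eq_rk: "card E = d"
proof -
  obtain c :: "nat \<Rightarrow> 'e \<Rightarrow> int" where
    c: "\<And>i j. i < d \<Longrightarrow> (\<Sum>e\<in>E. c i e * normal A e j) = (if j = i then 1 else 0)"
    using unit_lifts by blast
  have diag: "(\<Sum>i<d. normal A e i * c i e) = 1" if e: "e \<in> E" for e
  proof -
    have "lookup (poly_mapping_on E (\<lambda>f. (if f = e then 1 else 0) - (\<Sum>i<d. normal A e i * c i f))) e = 0"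
      using no_relations[OF unit_relation[OF c e]] by simp
    then show ?thesis using e by (simp add: lookup_poly_mapping_on)
  qed
  have "int (card E) = (\<Sum>e\<in>E. \<Sum>i<d. normal A e i * c i e)" by (simp add: diag)
  also have "\<dots> = (\<Sum>i<d. \<Sum>e\<in>E. c i e * normal A e i)" by (subst sum.swap) (simp add: mult.commute)
  also have "\<dots> = int d" by (simp add: c)
  finally show ?thesis by simp
qed

section \<open>The fan and the charts when there are no relations\<close>

lemma Lam_real_trivial: "Lam_real A = {0}"
proof -
  have "relation_vec A ` relations A \<subseteq> {0}"
  proof
    fix w assume "w \<in> relation_vec A ` relations A"
    then obtain c where "c \<in> relations A" "w = relation_vec A c" by blast
    then show "w \<in> {0}" using no_relations[of c] by (simp add: relation_vec_def)
  qed
  then have "Lam_real A \<subseteq> span {0}" unfolding Lam_real_def by (rule span_mono)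
  moreover have "span {0 :: 'e \<times> sign \<Rightarrow>\<^sub>0 real} = {0}" by (simp add: span_insert_0)
  moreover have "0 \<in> Lam_real A" unfolding Lam_real_def by (rule span_0)
  ultimately show ?thesis by blast
qed

lemma M_tilde_all: "M_tilde A = {u. keys u \<subseteq> E \<times> UNIV}"
proof -
  have "pairing u (relation_vec A c) = 0" if "c \<in> relations A" for u c
    using no_relations[OF that] by (simp add: relation_vec_def pairing_def)
  then show ?thesis unfolding M_tilde_def by blast
qed

text \<open>Without relations any values on the normals come from some \<open>m\<close>. If the
  hyperplane of \<open>e\<close> missed the vertex, the \<open>m\<close> with value 1 at
  \<open>e\<close> and 0 at all other indices would contradict
  \<open>vertex_slope_eq_0_imp\<close>.\<close>

lemma generators_all:
  assumes \<xi>: "\<xi> \<in> vertices A"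
  shows "generators \<xi> = E \<times> UNIV"
proof -
  have "aff A e \<xi> = 0" if e: "e \<in> E" for e
  proof (rule ccontr)
    assume nz: "aff A e \<xi> \<noteq> 0"
    let ?w = "\<lambda>f. if f = e then 1 else 0 :: real"
    have "(\<Sum>f\<in>E. real_of_int (lookup c f) * ?w f) = 0" if "c \<in> relations A" for c
      using no_relations[OF that] by simp
    then obtain m where m: "m \<in> coord_space d" "\<And>f. f \<in> E \<Longrightarrow> ?w f = slope A f m"
      using functional_from_slope[of ?w] by blast
    have "slope A f m = 0" if "f \<in> E" "aff A f \<xi> = 0" for f
      using m(2)[OF that(1)] that(2) nz by (auto split: if_splits)
    then have "m = (\<lambda>_. 0)" by (rule vertex_slope_eq_0_imp[OF \<xi> m(1)])
    then show False using m(2)[OF e] by (simp add: slope_def)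
  qed
  moreover have "s = Pos \<or> s = Neg" for s by (cases s) auto
  ultimately show ?thesis by (auto simp: generators_def E_pos_def E_neg_def)
qed

lemma vertex_cone_orthant:
  assumes \<xi>: "\<xi> \<in> vertices A"
  shows "vertex_cone A \<xi> = orthant (E \<times> UNIV)"
proof
  show "vertex_cone A \<xi> \<subseteq> orthant (E \<times> UNIV)"
  proof
    fix v assume "v \<in> vertex_cone A \<xi>"
    then obtain l w where "v = l + w" "l \<in> Lam_real A" "keys w \<subseteq> generators \<xi>"
      "\<forall>x. lookup w x \<ge> 0" by (rule vertex_cone_decompose) blast
    then show "v \<in> orthant (E \<times> UNIV)" by (simp add: Lam_real_trivial generators_all[OF \<xi>] orthant_def)
  qed
  show "orthant (E \<times> UNIV) \<subseteq> vertex_cone A \<xi>"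
  proof
    fix v assume v: "v \<in> orthant (E \<times> (UNIV :: sign set))"
    have cc: "convex_cone (vertex_cone A \<xi>)" unfolding vertex_cone_def by (rule convex_cone_convex_cone_hull)
    have "(\<Sum>x\<in>keys v. lookup v x *\<^sub>R single x 1) \<in> vertex_cone A \<xi>"
    proof (rule convex_cone_sum[OF cc])
      fix x assume "x \<in> keys v"
      then have "x \<in> generators \<xi>" using v generators_all[OF \<xi>] by (auto simp: orthant_def)
      moreover have "lookup v x \<ge> 0" using v by (cases x) (simp add: orthant_def)
      ultimately show "lookup v x *\<^sub>R single x 1 \<in> vertex_cone A \<xi>"
        by (intro convex_cone_scaleR[OF cc] single_in_vertex_cone)
    qed simp
    moreover have "(\<Sum>x\<in>keys v. lookup v x *\<^sub>R single x 1) = v"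
      by (rule poly_mapping_eqI)
        (simp add: lookup_sum lookup_single when_def if_distrib[of "(*) _"] in_keys_iff cong: if_cong)
    ultimately show "v \<in> vertex_cone A \<xi>" by simp
  qed
qed

text \<open>The cone of any vertex is the full orthant, whose nonempty faces correspond to the sets
  of coordinates.\<close>

lemma fan_orthants: "lawrence_fan A = orthant ` Pow (E \<times> UNIV)"
proof
  show "lawrence_fan A \<subseteq> orthant ` Pow (E \<times> (UNIV :: sign set))"
  proof
    fix \<sigma> assume "\<sigma> \<in> lawrence_fan A"
    then obtain \<xi> where "\<xi> \<in> vertices A" "\<sigma> \<noteq> {}" "\<sigma> face_of vertex_cone A \<xi>" by (auto simp: lawrence_fan_def)
    then have "\<exists>G\<subseteq>E \<times> UNIV. \<sigma> = orthant G"
      using face_of_orthant[of \<sigma> "E \<times> UNIV"] vertex_cone_orthant[of \<xi>] by simp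
    then show "\<sigma> \<in> orthant ` Pow (E \<times> UNIV)" by blast
  qed
  show "orthant ` Pow (E \<times> UNIV) \<subseteq> lawrence_fan A"
  proof
    fix \<sigma> assume "\<sigma> \<in> orthant ` Pow (E \<times> (UNIV :: sign set))"
    then obtain G where G: "G \<subseteq> E \<times> UNIV" "\<sigma> = orthant G" by blast
    obtain \<xi> where \<xi>: "\<xi> \<in> vertices A" using vertex_exists by blast
    have "\<sigma> face_of vertex_cone A \<xi>" unfolding G(2) vertex_cone_orthant[OF \<xi>] by (rule orthant_face_of[OF G(1)])
    moreover have "0 \<in> \<sigma>" by (simp add: G(2) orthant_def)
    ultimately show "\<sigma> \<in> lawrence_fan A" using \<xi> by (auto simp: lawrence_fan_def)
  qed
qed

lemma pairing_orthant:
  "(\<forall>v\<in>orthant G. pairing u v \<ge> 0) \<longleftrightarrow> (\<forall>x\<in>G. lookup u x \<ge> 0)"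
  "(\<forall>v\<in>orthant G. pairing u v = 0) \<longleftrightarrow> (\<forall>x\<in>G. lookup u x = 0)"
proof -
  have single: "pairing u (single x 1) = real_of_int (lookup u x)"
    "single x 1 \<in> orthant G" if "x \<in> G" for x
    using that by (simp_all add: pairing_single single_in_orthant)
  show "(\<forall>v\<in>orthant G. pairing u v \<ge> 0) \<longleftrightarrow> (\<forall>x\<in>G. lookup u x \<ge> 0)"
  proof
    assume *: "\<forall>v\<in>orthant G. pairing u v \<ge> 0"
    show "\<forall>x\<in>G. lookup u x \<ge> 0"
    proof
      fix x assume "x \<in> G"
      then show "lookup u x \<ge> 0" using * single[of x] by fastforce
    qed
  next
    assume *: "\<forall>x\<in>G. lookup u x \<ge> 0"
    show "\<forall>v\<in>orthant G. pairing u v \<ge> 0"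
    proof
      fix v assume v: "v \<in> orthant G"
      have "real_of_int (lookup u x) * lookup v x \<ge> 0" for x
      proof (cases "x \<in> G")
        case True
        have "lookup v x \<ge> 0" using v by (cases x) (simp add: orthant_def)
        then show ?thesis using * True by simp
      next
        case False
        then show ?thesis using orthant_lookup_eq_0[OF v False] by simp
      qed
      then show "pairing u v \<ge> 0" unfolding pairing_def by (intro sum_nonneg)
    qed
  qed
  show "(\<forall>v\<in>orthant G. pairing u v = 0) \<longleftrightarrow> (\<forall>x\<in>G. lookup u x = 0)"
  proof
    assume *: "\<forall>v\<in>orthant G. pairing u v = 0"
    show "\<forall>x\<in>G. lookup u x = 0"
    proof
      fix x assume "x \<in> G"
      then show "lookup u x = 0" using * single[of x] by fastforce
    qed
  next
    assume *: "\<forall>x\<in>G. lookup u x = 0"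
    show "\<forall>v\<in>orthant G. pairing u v = 0"
    proof
      fix v assume v: "v \<in> orthant G"
      have "real_of_int (lookup u x) * lookup v x = 0" for x
        using orthant_lookup_eq_0[OF v, of x] * by (cases "x \<in> G") simp_all
      then show "pairing u v = 0" unfolding pairing_def by (intro sum.neutral) blast
    qed
  qed
qed

text \<open>Without relations there are no equations, so the hypertoric variety is the whole
  Lawrence toric variety.\<close>

lemma hypertoric_ideal_trivial: "hypertoric_ideal A \<sigma> = ({0} :: (_ \<Rightarrow>\<^sub>0 'k::field) set)"
proof -
  have "0 \<in> relations A" by (simp add: relations_def)
  then have rel: "relations A = {0}" using no_relations by blast
  have form: "relation_form ` relations A = ({0} :: (_ \<Rightarrow>\<^sub>0 'k) set)"
    unfolding rel by (simp add: relation_form_def)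
  have "ideal ({0} :: (_ \<Rightarrow>\<^sub>0 'k) set) (monoid_algebra (dual_monoid A \<sigma>))"
    by (rule ideal_monoid_algebraI[OF add_submonoid_dual_monoid]) auto
  from genideal_subset_iff[OF this, of "{0}"]
  have "hypertoric_ideal A \<sigma> \<subseteq> ({0} :: (_ \<Rightarrow>\<^sub>0 'k) set)"
    unfolding hypertoric_ideal_relation_form form by simp
  moreover have "{0} \<subseteq> (hypertoric_ideal A \<sigma> :: (_ \<Rightarrow>\<^sub>0 'k) set)"
    unfolding hypertoric_ideal_relation_form form by (auto simp: genideal_def)
  ultimately show ?thesis by blast
qed

text \<open>The set of unit vectors in a cone of the fan recovers the coordinates that span it,
  which makes this map inverse to \<open>orthant\<close>.\<close>

lemma orthant_atlas_hypertoric: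
  "orthant_atlas (hypertoric_atlas A :: (_, _, 'k::field) atlas) (E \<times> UNIV)
     (\<lambda>\<sigma>. {x. single x 1 \<in> \<sigma>})"
proof -
  let ?G = "\<lambda>\<sigma>. {x. single x (1::real) \<in> \<sigma>}"
  let ?Y = "E \<times> (UNIV :: sign set)"
  have G: "?G (orthant H) = H" for H :: "('e \<times> sign) set" by (simp add: single_in_orthant)
  have orth: "\<exists>H\<subseteq>?Y. \<sigma> = orthant H" if "\<sigma> \<in> lawrence_fan A" for \<sigma> using that unfolding fan_orthants by blast
  have dual: "dual_monoid A (orthant H) = {u. keys u \<subseteq> ?Y \<and> (\<forall>x\<in>H. lookup u x \<ge> 0)}" for H
    unfolding dual_monoid_def M_tilde_all pairing_orthant by auto
  have perp: "perp_lattice A (orthant H) = {u. keys u \<subseteq> ?Y \<and> (\<forall>x\<in>H. lookup u x = 0)}" for H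
    unfolding perp_lattice_def M_tilde_all pairing_orthant by auto
  show ?thesis
  proof (rule orthant_atlas.intro)
    show "finite ?Y" by simp
    show "bij_betw ?G (charts (hypertoric_atlas A :: (_, _, 'k) atlas)) (Pow ?Y)"
      by (rule bij_betw_byWitness[where f' = orthant]) (auto simp: fan_orthants single_in_orthant)
    fix i assume "i \<in> charts (hypertoric_atlas A :: (_, _, 'k) atlas)"
    then obtain H where H: "H \<subseteq> ?Y" "i = orthant H" using orth by auto
    show "mon (hypertoric_atlas A :: (_, _, 'k) atlas) i = {u. keys u \<subseteq> ?Y \<and> (\<forall>x\<in>?G i. lookup u x \<ge> 0)}"
      unfolding H(2) G by (simp add: dual)
    show "van (hypertoric_atlas A :: (_, _, 'k) atlas) i = {0}" by (simp add: hypertoric_ideal_trivial)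
    fix j assume "j \<in> charts (hypertoric_atlas A :: (_, _, 'k) atlas)"
    then obtain H' where H': "H' \<subseteq> ?Y" "j = orthant H'" using orth by auto
    have "orthant H face_of orthant H' \<longleftrightarrow> H \<subseteq> H'"
      using orthant_face_of[of H H'] face_of_imp_subset[of "orthant H" "orthant H'"] orthant_subset_iff[of H H'] by blast
    then show "sub (hypertoric_atlas A :: (_, _, 'k) atlas) i j \<longleftrightarrow> ?G i \<subseteq> ?G j"
      unfolding H(2) H'(2) G by simp
  next
    fix i and q :: "(_ \<Rightarrow>\<^sub>0 'k) set"
    have zero: "{0} \<subseteq> q" if "primeideal q (monoid_algebra (dual_monoid A i))"
      using ideal_monoid_algebraD(2)[OF primeideal_monoid_algebraD(1)[OF that]] by simp
    have mem: "u \<in> dual_monoid A i - perp_lattice A i \<longleftrightarrow> u \<in> dual_monoid A i \<and> (\<exists>x\<in>?G i. lookup u x \<noteq> 0)"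
      if i: "i \<in> lawrence_fan A" for u
    proof -
      obtain H where H: "H \<subseteq> ?Y" "i = orthant H" using orth[OF i] by blast
      show ?thesis unfolding H(2) G by (auto simp: dual perp)
    qed
    show "(i, q) \<in> pts (hypertoric_atlas A) \<longleftrightarrow> i \<in> charts (hypertoric_atlas A :: (_, _, 'k) atlas) \<and>
        primeideal q (monoid_algebra (mon (hypertoric_atlas A :: (_, _, 'k) atlas) i)) \<and>
        (\<forall>u\<in>mon (hypertoric_atlas A :: (_, _, 'k) atlas) i. (\<exists>x\<in>?G i. lookup u x \<noteq> 0) \<longrightarrow> monomial u \<in> q)"
    proof (cases "i \<in> lawrence_fan A \<and> primeideal q (monoid_algebra (dual_monoid A i))")
      case True
      have "(\<forall>u\<in>dual_monoid A i - perp_lattice A i. monomial u \<in> q) \<longleftrightarrow>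
          (\<forall>u\<in>dual_monoid A i. (\<exists>x\<in>?G i. lookup u x \<noteq> 0) \<longrightarrow> monomial u \<in> q)"
        unfolding Ball_def mem[OF conjunct1[OF True]] imp_conjL ..
      then show ?thesis
        unfolding pts_hypertoric_atlas hypertoric_ideal_trivial hypertoric_atlas_simps
        using True zero by argo
    next
      case False
      then show ?thesis unfolding pts_hypertoric_atlas hypertoric_atlas_simps by argo
    qed
  qed
qed

text \<open>The atlas has one coordinate for each index and sign, that is 2|E| of them, and |E| is
  the rank by \<open>card_idx_eq_rk\<close>.\<close>

lemma hypertoric_affine_space:
  "k_isomorphic (hypertoric A :: (_, _, 'k::field) k_space) (affine_space (2 * rk A))"
proof -
  have "card (UNIV :: sign set) = 2" by (subst UNIV_sign) simp
  then have "card (E \<times> (UNIV :: sign set)) = 2 * rk A" by (simp add: card_cartesian_product card_idx_eq_rk)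
  then show ?thesis
    using orthant_atlas.k_isomorphic_affine_space[OF orthant_atlas_hypertoric, where 'k = 'k] by simp
qed

end

end

theorem corollary5p3:
  fixes v :: "'k::field \<Rightarrow> ereal"
    and A :: "'e arrangement"
  assumes "nonarch_valuation v" and "valuation_complete v"
    and "primitive_spanning A"
    and "\<not> k_isomorphic (hypertoric A :: (_, _, 'k) k_space) (affine_space (2 * rk A))"
  shows "\<exists>\<sigma> \<in> lawrence_fan A.
           topspace (topo (hypertoric A :: (_, _, 'k) k_space)) \<inter> orbit A \<sigma> \<noteq> {} \<and>
           ereal_of_enat (krull_dim
             (subtopology (topo (hypertoric A :: (_, _, 'k) k_space)) (orbit A \<sigma>)))
           \<noteq> ereal_of_enat (krull_dim (topo (hypertoric A :: (_, _, 'k) k_space)))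
               - ereal (real (cone_dim A \<sigma>))"
proof -
  interpret spanning_arrangement A by (rule spanning_arrangement.intro) fact
  show ?thesis
  proof (rule ccontr)
    assume "\<not> ?thesis"
    \<comment> \<open>A single nonzero relation would already produce the desired cone, so only the
      case of independent normals remains, where the hypertoric variety is affine space.\<close>
    then have "c = 0" if "c \<in> relations A" for c
      using improper_intersection[OF that, where 'k = 'k] by argo
    from hypertoric_affine_space[OF this, where 'k = 'k] assms(4) show False by contradiction
  qed
qed

end
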